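(* Let $n\ge 2$ be an integer, $S\subseteq\mathbb{R}^{n-1}$ a non-empty subspace, $p_0\in S$, and $S^{\times}:=S\setminus\{p_0\}$. Let $\mathbb{PF}:=\mathbb{PF}^n_S$ be the (boundary-less) Prüfer $n$-manifold attached to $S$. Identify $\pi_1(\mathbb{PF})$ with the free group $F_{S^\times}$ via the generators $[\alpha_{p_0,p}]$, $p\in S^\times$, and hence $$\mathrm{Hom}(\pi_1(\mathbb{PF}),\mathbb{Z})\cong\mathrm{Hom}(F_{S^\times},\mathbb{Z})\cong\{\text{functions }S^\times\to\mathbb{Z}\}.$$ Then the comparison morphism $\mathrm{comp}:\pi^1(\mathbb{PF})\to\mathrm{Hom}(\pi_1(\mathbb{PF}),\mathbb{Z})$ is an embedding which identifies $\pi^1(\mathbb{PF})$ with the additive group of Baire-1 functions $S^\times\to\mathbb{Z}$.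
   Context: **Prüfer manifolds.** Let $\mathbb{H}_{++}=\{x\in\mathbb{R}^n : x_n>0\}$, $\mathbb{H}_+$ its closure, and identify $\mathbb{R}^{n-1}\cong\partial\mathbb{H}_+=\{x_n=0\}$. For $p\in\mathbb{R}^{n-1}$ let $\mathcal{R}_p$ be the set of rays with origin $p$ which, apart from the origin, lie entirely in $\mathbb{H}_{++}$, topologized as a subspace of the projective space of lines in $\mathbb{R}^n$ through $p$ (equivalently, by angle). For $S\subseteq\mathbb{R}^{n-1}$, the bordered Prüfer manifold is, as a set, $\mathbb{PF}^n_{S,\partial}:=\mathbb{H}_{++}\sqcup\coprod_{p\in S}\mathcal{R}_p$. The set $\mathbb{H}_{++}$ is open with its usual topology, and a neighborhood basis at $r\in\mathcal{R}_p$ is given by the sets (for $\varepsilon>0$) consisting of all rays in $\mathcal{R}_p$ at angle $<\varepsilon$ from $r$ together with all $x\in\mathbb{H}_{++}$ with $|x-p|<\varepsilon$ such that the ray $\overrightarrow{px}$ makes an angle $<\varepsilon$ with $r$. Thus a net in $\mathbb{H}_{++}$ converges to $r\in\mathcal{R}_p$ iff it converges to $p$ in $\mathbb{R}^n$ and the rays from $p$ through its members converge to $r$ in $\mathcal{R}_p$. This is an $n$-manifold with boundary $\coprod_{p\in S}\mathcal{R}_p$. The Prüfer $n$-manifold $\mathbb{PF}^n_S$ is its double: two copies of $\mathbb{PF}^n_{S,\partial}$ glued along the boundary by the identity. It is path-connected when $S\neq\emptyset$. **Loops.** For distinct $p,q\in S$, $\alpha_{p,q}$ is the loop in $\mathbb{PF}^n_S$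 based at the vertical ray at $p$ which first goes, in the first copy of $\mathbb{PF}^n_{S,\partial}$, from the vertical ray at $p$ to the vertical ray at $q$ along the semicircle in $\mathbb{H}_+$ that has the segment $\overline{pq}$ as diameter and meets the vertical ray at $\frac{p+q}{2}$ (i.e. lies in the vertical 2-plane through $p$ and $q$), and then returns along the reversal of the same semicircle in the second copy. It is known that $\pi_1(\mathbb{PF}^n_S)$ is free on the classes $[\alpha_{p_0,p}]$, $p\in S^\times$. **Cohomotopy.** For a space $X$, $\pi^1(X):=[X,\mathbb{S}^1]$ is the group (under pointwise multiplication in $\mathbb{S}^1$) of free homotopy classes of continuous maps $X\to\mathbb{S}^1$. For path-connected $X$, $\mathrm{comp}:\pi^1(X)\to\mathrm{Hom}(\pi_1(X),\mathbb{Z})$ sends $[g]$ to $g_*:\pi_1(X)\to\pi_1(\mathbb{S}^1)\cong\mathbb{Z}$. Under the identifications in the claim, $\mathrm{comp}([g])$ is the function $p\mapsto\deg(g\circ\alpha_{p_0,p})$. **Baire-1.** A function between metrizable spaces is Baire-1 if the preimage of every open set is $F_\sigma$ (a countable union of closed sets). Here $\mathbb{Z}$ is discrete and $S^\times$ has the subspace topology from $\mathbb{R}^{n-1}$. *)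

theory Defs
  imports
    "HOL-Analysis.Analysis"
    "HOL-Complex_Analysis.Winding_Numbers"
    "HOL-Algebra.Product_Groups"
begin

section \<open>Pruefer manifolds\<close>

text \<open>
  The space \<open>\<real>\<^sup>n\<close> is modelled as \<open>'a \<times> real\<close> for a Euclidean space \<open>'a\<close> of dimension
  \<open>n - 1\<close>; the second component is the last coordinate. Euclidean spaces have positive
  dimension, so that \<open>n \<ge> 2\<close>. A boundary point \<open>p \<in> \<real>\<^sup>n\<^sup>-\<^sup>1\<close> is the vector \<open>(p, 0)\<close>.
\<close>

definition upper_half_space :: "('a::euclidean_space \<times> real) set" where
  "upper_half_space = {x. snd x > 0}"

text \<open>
  The ray \<open>{(p, 0) + t u | t \<ge> 0}\<close> is encoded by its origin \<open>p\<close> and its unit direction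
  vector \<open>u\<close>. Apart from its origin it lies in the open upper half space iff \<open>snd u > 0\<close>; see
  \<open>bij_betw_rays\<close> below.
\<close>

definition upward_directions :: "('a::euclidean_space \<times> real) set" where
  "upward_directions = {u. norm u = 1 \<and> snd u > 0}"

definition ray_set :: "'a::euclidean_space \<Rightarrow> 'a \<times> real \<Rightarrow> ('a \<times> real) set" where
  "ray_set p u = {(p, 0) + t *\<^sub>R u | t. t \<ge> 0}"

lemma ray_set_scale:
  assumes "c > 0"
  shows "ray_set p (c *\<^sub>R u) = ray_set p u"
proof (intro equalityI subsetI)
  fix x assume "x \<in> ray_set p (c *\<^sub>R u)"
  then obtain t where "t \<ge> 0" "x = (p, 0) + t *\<^sub>R (c *\<^sub>R u)" unfolding ray_set_def by blast
  then have "t * c \<ge> 0" "x = (p, 0) + (t * c) *\<^sub>R u" using assms by simp_all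
  then show "x \<in> ray_set p u" unfolding ray_set_def by blast
next
  fix x assume "x \<in> ray_set p u"
  then obtain t where "t \<ge> 0" "x = (p, 0) + t *\<^sub>R u" unfolding ray_set_def by blast
  then have "t / c \<ge> 0" "x = (p, 0) + (t / c) *\<^sub>R (c *\<^sub>R u)" using assms by simp_all
  then show "x \<in> ray_set p (c *\<^sub>R u)" unfolding ray_set_def by blast
qed

lemma ray_set_inj:
  assumes "norm u = 1" "norm v = 1" and eq: "ray_set p u = ray_set p v"
  shows "u = v"
proof -
  have "(p, 0) + 1 *\<^sub>R u \<in> ray_set p u"
    unfolding ray_set_def by (rule CollectI, rule exI[of _ 1]) simp
  then have "(p, 0) + 1 *\<^sub>R u \<in> ray_set p v" by (simp only: eq)
  then obtain t where t: "t \<ge> 0" "(p, 0) + 1 *\<^sub>R u = (p, 0) + t *\<^sub>R v"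
    unfolding ray_set_def by blast
  from t(2) have "1 *\<^sub>R u = t *\<^sub>R v" by (rule add_left_imp_eq)
  then have uv: "u = t *\<^sub>R v" by (simp only: scaleR_one)
  have "norm u = t * norm v" unfolding uv using t(1) by (simp only: norm_scaleR abs_of_nonneg)
  then have "t = 1" using assms(1,2) by simp
  then show ?thesis using uv by (simp only: scaleR_one)
qed

lemma ray_set_upper_iff:
  assumes "v \<noteq> 0"
  shows "ray_set p v - {(p, 0)} \<subseteq> upper_half_space \<longleftrightarrow> snd v > 0"
proof
  assume *: "ray_set p v - {(p, 0)} \<subseteq> upper_half_space"
  have "(p, 0) + 1 *\<^sub>R v \<in> ray_set p v"
    unfolding ray_set_def by (rule CollectI, rule exI[of _ 1]) simp
  moreover have "(p, 0) + 1 *\<^sub>R v \<noteq> (p, 0)" using assms by simp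
  ultimately have "(p, 0) + 1 *\<^sub>R v \<in> upper_half_space" using * by blast
  then show "snd v > 0" by (simp add: upper_half_space_def)
next
  assume v: "snd v > 0"
  show "ray_set p v - {(p, 0)} \<subseteq> upper_half_space"
  proof
    fix x assume "x \<in> ray_set p v - {(p, 0)}"
    then obtain t where t: "t \<ge> 0" "x = (p, 0) + t *\<^sub>R v" "x \<noteq> (p, 0)"
      unfolding ray_set_def by blast
    then have "t \<noteq> 0" by auto
    then show "x \<in> upper_half_space" using t(1,2) v by (simp add: upper_half_space_def)
  qed
qed

lemma bij_betw_rays:
  "bij_betw (ray_set p) upward_directions
     {ray_set p v | v. v \<noteq> 0 \<and> ray_set p v - {(p, 0)} \<subseteq> upper_half_space}"
proof (rule bij_betw_imageI)
  show "inj_on (ray_set p) upward_directions"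
    by (rule inj_onI, rule ray_set_inj) (simp_all add: upward_directions_def)
  show "ray_set p ` upward_directions =
          {ray_set p v | v. v \<noteq> 0 \<and> ray_set p v - {(p, 0)} \<subseteq> upper_half_space}"
  proof (intro equalityI subsetI)
    fix r assume "r \<in> ray_set p ` upward_directions"
    then obtain u where u: "norm u = 1" "snd u > 0" "r = ray_set p u"
      unfolding upward_directions_def by blast
    then have "u \<noteq> 0" using norm_zero zero_neq_one by metis
    then show "r \<in> {ray_set p v | v. v \<noteq> 0 \<and> ray_set p v - {(p, 0)} \<subseteq> upper_half_space}"
      using u ray_set_upper_iff by blast
  next
    fix r assume "r \<in> {ray_set p v | v. v \<noteq> 0 \<and> ray_set p v - {(p, 0)} \<subseteq> upper_half_space}"
    then obtain v where v: "v \<noteq> 0" "snd v > 0" "r = ray_set p v"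
      using ray_set_upper_iff by blast
    define u where "u = inverse (norm v) *\<^sub>R v"
    have "norm u = 1" "snd u > 0" using v(1,2) by (simp_all add: u_def)
    moreover have "ray_set p u = r"
      unfolding u_def v(3) by (rule ray_set_scale) (use v(1) in simp)
    ultimately show "r \<in> ray_set p ` upward_directions" unfolding upward_directions_def by blast
  qed
qed

definition vec_angle :: "'b::real_inner \<Rightarrow> 'b \<Rightarrow> real" where
  "vec_angle u v = arccos (u \<bullet> v / (norm u * norm v))"


subsection \<open>The bordered Pruefer manifold\<close>

datatype 'a bordered_pt = Inner "'a \<times> real" | Ray 'a "'a \<times> real"

definition bordered_carrier :: "'a::euclidean_space set \<Rightarrow> 'a bordered_pt set" where
  "bordered_carrier S = Inner ` upper_half_space \<union> {Ray p u | p u. p \<in> S \<and> u \<in> upward_directions}"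

definition ray_nbhd :: "'a::euclidean_space \<Rightarrow> 'a \<times> real \<Rightarrow> real \<Rightarrow> 'a bordered_pt set" where
  "ray_nbhd p u \<epsilon> =
     {Ray p v | v. v \<in> upward_directions \<and> vec_angle v u < \<epsilon>} \<union>
     {Inner x | x. x \<in> upper_half_space \<and> norm (x - (p, 0)) < \<epsilon> \<and> vec_angle (x - (p, 0)) u < \<epsilon>}"

definition bordered_pruefer :: "'a::euclidean_space set \<Rightarrow> 'a bordered_pt topology" where
  "bordered_pruefer S = topology (\<lambda>U.
     U \<subseteq> bordered_carrier S \<and>
     open {x. Inner x \<in> U} \<and>
     (\<forall>p u. Ray p u \<in> U \<longrightarrow> (\<exists>\<epsilon>>0. ray_nbhd p u \<epsilon> \<subseteq> U)))"

lemma ray_nbhd_mono: "\<epsilon> \<le> \<delta> \<Longrightarrow> ray_nbhd p u \<epsilon> \<subseteq> ray_nbhd p u \<delta>"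
  unfolding ray_nbhd_def by fastforce

lemma openin_bordered_pruefer:
  "openin (bordered_pruefer S) U \<longleftrightarrow>
     U \<subseteq> bordered_carrier S \<and>
     open {x. Inner x \<in> U} \<and>
     (\<forall>p u. Ray p u \<in> U \<longrightarrow> (\<exists>\<epsilon>>0. ray_nbhd p u \<epsilon> \<subseteq> U))"
proof -
  let ?P = "\<lambda>U. U \<subseteq> bordered_carrier S \<and> open {x. Inner x \<in> U} \<and>
     (\<forall>p u. Ray p u \<in> U \<longrightarrow> (\<exists>\<epsilon>>0. ray_nbhd p u \<epsilon> \<subseteq> U))"
  have "istopology ?P"
    unfolding istopology_def
  proof (intro conjI allI impI)
    fix U V assume U: "?P U" and V: "?P V"
    show "U \<inter> V \<subseteq> bordered_carrier S" using U by blast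
    have "{x. Inner x \<in> U \<inter> V} = {x. Inner x \<in> U} \<inter> {x. Inner x \<in> V}" by auto
    then show "open {x. Inner x \<in> U \<inter> V}" using U V by (simp add: open_Int)
    fix p u assume "Ray p u \<in> U \<inter> V"
    then obtain \<epsilon> \<delta> where "\<epsilon> > 0" "ray_nbhd p u \<epsilon> \<subseteq> U" "\<delta> > 0" "ray_nbhd p u \<delta> \<subseteq> V"
      using U V by blast
    then have "min \<epsilon> \<delta> > 0 \<and> ray_nbhd p u (min \<epsilon> \<delta>) \<subseteq> U \<inter> V"
      using ray_nbhd_mono[of "min \<epsilon> \<delta>" \<epsilon> p u] ray_nbhd_mono[of "min \<epsilon> \<delta>" \<delta> p u] by auto
    then show "\<exists>\<epsilon>>0. ray_nbhd p u \<epsilon> \<subseteq> U \<inter> V" by blast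
  next
    fix \<K> assume K: "\<forall>U\<in>\<K>. ?P U"
    show "\<Union>\<K> \<subseteq> bordered_carrier S" using K by blast
    have "{x. Inner x \<in> \<Union>\<K>} = (\<Union>U\<in>\<K>. {x. Inner x \<in> U})" by auto
    then show "open {x. Inner x \<in> \<Union>\<K>}" using K by auto
    fix p u assume "Ray p u \<in> \<Union>\<K>"
    then obtain U where U: "U \<in> \<K>" "Ray p u \<in> U" by blast
    then obtain \<epsilon> where "\<epsilon> > 0" "ray_nbhd p u \<epsilon> \<subseteq> U" using K by blast
    then show "\<exists>\<epsilon>>0. ray_nbhd p u \<epsilon> \<subseteq> \<Union>\<K>" using U(1) by blast
  qed
  then show ?thesis unfolding bordered_pruefer_def by (simp add: topology_inverse')
qed

lemma topspace_bordered_pruefer [simp]: "topspace (bordered_pruefer S) = bordered_carrier S"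
proof -
  have "{x. Inner x \<in> bordered_carrier S} = {x. snd x > 0}" for S :: "'a set"
    by (auto simp: bordered_carrier_def upper_half_space_def)
  moreover have "open {x :: 'a \<times> real. snd x > 0}"
    by (intro open_Collect_less continuous_intros)
  moreover have "ray_nbhd p u 1 \<subseteq> bordered_carrier S" if "Ray p u \<in> bordered_carrier S" for p u
    using that by (auto simp: bordered_carrier_def ray_nbhd_def)
  ultimately have "openin (bordered_pruefer S) (bordered_carrier S)"
    unfolding openin_bordered_pruefer by (metis order_refl zero_less_one)
  then have "bordered_carrier S \<subseteq> topspace (bordered_pruefer S)" by (rule openin_subset)
  moreover have "topspace (bordered_pruefer S) \<subseteq> bordered_carrier S"
    using openin_topspace[of "bordered_pruefer S"] unfolding openin_bordered_pruefer by (rule conjunct1)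
  ultimately show ?thesis by (rule subset_antisym[rotated])
qed

lemma vec_angle_sgn_left: "vec_angle (sgn x) u = vec_angle x u"
  by (cases "x = 0") (auto simp: vec_angle_def sgn_div_norm field_simps)

text \<open>The sets \<^const>\<open>ray_nbhd\<close> are open, hence form a neighbourhood basis at the ray.\<close>

lemma openin_ray_nbhd:
  assumes "p \<in> S" and u: "u \<in> upward_directions"
  shows "openin (bordered_pruefer S) (ray_nbhd p u \<epsilon>)"
proof -
  have nu: "norm u = 1" using u by (simp add: upward_directions_def)
  have cont: "continuous_on {v. v \<noteq> 0} (\<lambda>v. vec_angle v u)"
  proof -
    have "-1 \<le> v \<bullet> u / (norm v * norm u) \<and> v \<bullet> u / (norm v * norm u) \<le> 1" if "v \<noteq> 0" for v
    proof -
      have "\<bar>v \<bullet> u\<bar> \<le> norm v * norm u" by (rule Cauchy_Schwarz_ineq2)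
      then show ?thesis using that nu by (auto simp: field_simps abs_le_iff)
    qed
    then show ?thesis
      unfolding vec_angle_def using nu by (intro continuous_intros) auto
  qed
  have o1: "open {v. v \<noteq> 0 \<and> vec_angle v u < \<epsilon>}"
  proof -
    have "open ({v. v \<noteq> 0} \<inter> (\<lambda>v. vec_angle v u) -` {..<\<epsilon>})"
      by (rule continuous_open_preimage[OF cont]) (auto simp: open_Collect_neg)
    moreover have "{v. v \<noteq> 0} \<inter> (\<lambda>v. vec_angle v u) -` {..<\<epsilon>} = {v. v \<noteq> 0 \<and> vec_angle v u < \<epsilon>}"
      by auto
    ultimately show ?thesis by simp
  qed
  have in1: "{x. Inner x \<in> ray_nbhd p u \<epsilon>} = {x. snd x > 0} \<inter> ball (p, 0) \<epsilon> \<inter>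
     (\<lambda>x. x - (p, 0)) -` {v. v \<noteq> 0 \<and> vec_angle v u < \<epsilon>}"
  proof (rule Set.set_eqI)
    fix x :: "'a \<times> real"
    have "norm ((p, 0) - x) = norm (x - (p, 0))" by (rule norm_minus_commute)
    moreover have "x - (p, 0) \<noteq> 0" if "snd x > 0" using that by auto
    ultimately show "x \<in> {x. Inner x \<in> ray_nbhd p u \<epsilon>} \<longleftrightarrow> x \<in> {x. snd x > 0} \<inter> ball (p, 0) \<epsilon> \<inter>
       (\<lambda>x. x - (p, 0)) -` {v. v \<noteq> 0 \<and> vec_angle v u < \<epsilon>}"
      unfolding ray_nbhd_def upper_half_space_def ball_def dist_norm vimage_def by auto
  qed
  have "open {x :: 'a \<times> real. snd x > 0}"
    by (intro open_Collect_less continuous_intros)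
  moreover have "open ((\<lambda>x. x - (p, 0)) -` {v. v \<noteq> 0 \<and> vec_angle v u < \<epsilon>})"
    by (rule open_vimage[OF o1]) (intro continuous_intros)
  ultimately have "open {x. Inner x \<in> ray_nbhd p u \<epsilon>}"
    unfolding in1 by (intro open_Int open_ball)
  moreover have "ray_nbhd p u \<epsilon> \<subseteq> bordered_carrier S"
    using assms by (auto simp: ray_nbhd_def bordered_carrier_def)
  moreover have "\<exists>\<delta>>0. ray_nbhd q v \<delta> \<subseteq> ray_nbhd p u \<epsilon>" if qv: "Ray q v \<in> ray_nbhd p u \<epsilon>" for q v
  proof -
    from qv have [simp]: "q = p" and v: "norm v = 1" "snd v > 0" and av: "vec_angle v u < \<epsilon>"
      by (auto simp: ray_nbhd_def upward_directions_def)
    have "v \<in> {v. v \<noteq> 0 \<and> vec_angle v u < \<epsilon>}" using v av by auto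
    then obtain d where d: "d > 0" "ball v d \<subseteq> {v. v \<noteq> 0 \<and> vec_angle v u < \<epsilon>}"
      using o1 open_contains_ball by blast
    have "0 \<le> vec_angle v u"
      unfolding vec_angle_def
      using v nu Cauchy_Schwarz_ineq2[of v u] by (intro arccos_lbound) (auto simp: abs_le_iff)
    with av have "\<epsilon> > 0" by linarith
    define c where "c = max (- 1) (1 - d\<^sup>2 / 2)"
    have c: "-1 \<le> c" "c < 1" using d by (auto simp: c_def)
    define \<delta> where "\<delta> = min \<epsilon> (arccos c)"
    have "arccos c > 0" using arccos_less_arccos[of c 1] c by simp
    then have "\<delta> > 0" using \<open>\<epsilon> > 0\<close> by (simp add: \<delta>_def)
    have key: "vec_angle w u < \<epsilon>" if w: "w \<noteq> 0" "vec_angle w v < \<delta>" for w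
    proof -
      have ns: "norm (sgn w) = 1" using w by (simp add: norm_sgn)
      have le: "\<bar>sgn w \<bullet> v\<bar> \<le> 1" using Cauchy_Schwarz_ineq2[of "sgn w" v] ns v by simp
      have "arccos (sgn w \<bullet> v) < arccos c"
        using w vec_angle_sgn_left[of w v] ns v by (simp add: vec_angle_def \<delta>_def)
      moreover have "arccos c \<le> arccos (sgn w \<bullet> v)" if "sgn w \<bullet> v \<le> c"
        using that le c by (intro arccos_le_arccos) auto
      ultimately have "c < sgn w \<bullet> v" by fastforce
      then have "1 - d\<^sup>2 / 2 < sgn w \<bullet> v" by (simp add: c_def)
      moreover have "(norm (sgn w - v))\<^sup>2 = 2 - 2 * (sgn w \<bullet> v)"
      proof -
        have "sgn w \<bullet> sgn w = 1" "v \<bullet> v = 1"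
          using ns v by (simp_all add: norm_eq_1)
        then show ?thesis
          by (simp add: power2_norm_eq_inner inner_diff inner_commute)
      qed
      ultimately have "(norm (sgn w - v))\<^sup>2 < d\<^sup>2" by linarith
      then have "norm (sgn w - v) < d" by (rule power_less_imp_less_base) (use d(1) in simp)
      then have "sgn w \<in> ball v d" by (simp add: dist_norm norm_minus_commute)
      then show ?thesis using d(2) vec_angle_sgn_left[of w u] by auto
    qed
    have "ray_nbhd q v \<delta> \<subseteq> ray_nbhd p u \<epsilon>"
    proof
      fix y assume "y \<in> ray_nbhd q v \<delta>"
      then consider w where "y = Ray p w" "w \<in> upward_directions" "vec_angle w v < \<delta>"
        | x where "y = Inner x" "x \<in> upper_half_space" "norm (x - (p, 0)) < \<delta>"
            "vec_angle (x - (p, 0)) v < \<delta>"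
        by (auto simp: ray_nbhd_def)
      then show "y \<in> ray_nbhd p u \<epsilon>"
      proof cases
        case 1
        then have "w \<noteq> 0" by (auto simp: upward_directions_def)
        then have "vec_angle w u < \<epsilon>" using 1 key by blast
        then show ?thesis using 1 unfolding ray_nbhd_def by blast
      next
        case 2
        then have "x - (p, 0) \<noteq> 0" by (auto simp: upper_half_space_def)
        then have "vec_angle (x - (p, 0)) u < \<epsilon>" using 2 key by blast
        moreover have "norm (x - (p, 0)) < \<epsilon>" using 2 by (simp add: \<delta>_def)
        ultimately show ?thesis using 2 unfolding ray_nbhd_def by blast
      qed
    qed
    then show ?thesis using \<open>\<delta> > 0\<close> by blast
  qed
  ultimately show ?thesis unfolding openin_bordered_pruefer by blast
qed


subsection \<open>The double\<close>

text \<open>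
  The first copy of the bordered manifold has index \<^const>\<open>False\<close>, the second one \<^const>\<open>True\<close>.
  The boundary points of the two copies are identified.
\<close>

datatype 'a pruefer_pt = Sheet bool "'a \<times> real" | Seam 'a "'a \<times> real"

fun copy_incl :: "bool \<Rightarrow> 'a bordered_pt \<Rightarrow> 'a pruefer_pt" where
  "copy_incl c (Inner x) = Sheet c x"
| "copy_incl c (Ray p u) = Seam p u"

definition pruefer_carrier :: "'a::euclidean_space set \<Rightarrow> 'a pruefer_pt set" where
  "pruefer_carrier S = (\<Union>c. copy_incl c ` bordered_carrier S)"

definition pruefer :: "'a::euclidean_space set \<Rightarrow> 'a pruefer_pt topology" where
  "pruefer S = topology (\<lambda>U.
     U \<subseteq> pruefer_carrier S \<and>
     (\<forall>c. openin (bordered_pruefer S) {y \<in> bordered_carrier S. copy_incl c y \<in> U}))"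

lemma openin_pruefer:
  "openin (pruefer S) U \<longleftrightarrow>
     U \<subseteq> pruefer_carrier S \<and>
     (\<forall>c. openin (bordered_pruefer S) {y \<in> bordered_carrier S. copy_incl c y \<in> U})"
proof -
  let ?Q = "\<lambda>U. U \<subseteq> pruefer_carrier S \<and>
     (\<forall>c. openin (bordered_pruefer S) {y \<in> bordered_carrier S. copy_incl c y \<in> U})"
  have "istopology ?Q"
    unfolding istopology_def
  proof (intro conjI allI impI)
    fix U V c assume U: "?Q U" and V: "?Q V"
    show "U \<inter> V \<subseteq> pruefer_carrier S" using U by blast
    have "{y \<in> bordered_carrier S. copy_incl c y \<in> U \<inter> V} =
       {y \<in> bordered_carrier S. copy_incl c y \<in> U} \<inter> {y \<in> bordered_carrier S. copy_incl c y \<in> V}"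
      by auto
    then show "openin (bordered_pruefer S) {y \<in> bordered_carrier S. copy_incl c y \<in> U \<inter> V}"
      using U V by (simp add: openin_Int)
  next
    fix \<K> c assume K: "\<forall>U\<in>\<K>. ?Q U"
    show "\<Union>\<K> \<subseteq> pruefer_carrier S" using K by blast
    have "{y \<in> bordered_carrier S. copy_incl c y \<in> \<Union>\<K>} =
       (\<Union>U\<in>\<K>. {y \<in> bordered_carrier S. copy_incl c y \<in> U})"
      by auto
    then show "openin (bordered_pruefer S) {y \<in> bordered_carrier S. copy_incl c y \<in> \<Union>\<K>}"
      using K by auto
  qed
  then show ?thesis unfolding pruefer_def by (simp add: topology_inverse')
qed

lemma topspace_pruefer [simp]: "topspace (pruefer S) = pruefer_carrier S"
proof -
  have "{y \<in> bordered_carrier S. copy_incl c y \<in> pruefer_carrier S} = bordered_carrier S" for c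
    by (auto simp: pruefer_carrier_def)
  then have "openin (pruefer S) (pruefer_carrier S)"
    unfolding openin_pruefer using openin_topspace[of "bordered_pruefer S"] by simp
  then have "pruefer_carrier S \<subseteq> topspace (pruefer S)" by (rule openin_subset)
  moreover have "topspace (pruefer S) \<subseteq> pruefer_carrier S"
    using openin_topspace[of "pruefer S"] unfolding openin_pruefer by (rule conjunct1)
  ultimately show ?thesis by (rule subset_antisym[rotated])
qed

lemma quotient_map_pruefer:
  "quotient_map (sum_topology (\<lambda>_. bordered_pruefer S) UNIV) (pruefer S) (\<lambda>(c, y). copy_incl c y)"
proof -
  have "(\<lambda>(c, y). copy_incl c y) ` (UNIV \<times> bordered_carrier S) = pruefer_carrier S"
    by (force simp: pruefer_carrier_def)
  moreover have "openin (sum_topology (\<lambda>_. bordered_pruefer S) UNIV)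
      {z \<in> UNIV \<times> bordered_carrier S. (case z of (c, y) \<Rightarrow> copy_incl c y) \<in> U} \<longleftrightarrow>
      openin (pruefer S) U" if "U \<subseteq> pruefer_carrier S" for U
  proof -
    have "{z \<in> UNIV \<times> bordered_carrier S. (case z of (c, y) \<Rightarrow> copy_incl c y) \<in> U}
        \<subseteq> UNIV \<times> bordered_carrier S"
      by blast
    then show ?thesis
      using that unfolding openin_sum_topology openin_pruefer[of S U] by (simp add: comp_def)
  qed
  ultimately show ?thesis unfolding quotient_map_def by (simp add: comp_def)
qed


subsection \<open>The loops \<open>\<alpha>\<close>\<close>

abbreviation vertical :: "'a::euclidean_space \<times> real" where
  "vertical \<equiv> (0, 1)"

text \<open>
  The semicircle over the segment from \<open>p\<close> to \<open>q\<close>, parametrised by \<open>t \<in> [0, 1]\<close> proportionally to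
  arc length, with the end points \<open>(p, 0)\<close> and \<open>(q, 0)\<close> replaced by the vertical rays.
\<close>

definition semicircle :: "'a::euclidean_space \<Rightarrow> 'a \<Rightarrow> real \<Rightarrow> 'a bordered_pt" where
  "semicircle p q t =
     (if t \<le> 0 then Ray p vertical
      else if t \<ge> 1 then Ray q vertical
      else Inner (midpoint p q - (cos (pi * t) / 2) *\<^sub>R (q - p), sin (pi * t) * (dist p q / 2)))"

definition alpha :: "'a::euclidean_space \<Rightarrow> 'a \<Rightarrow> real \<Rightarrow> 'a pruefer_pt" where
  "alpha p q t =
     (if t \<le> 1/2 then copy_incl False (semicircle p q (2 * t))
      else copy_incl True (semicircle p q (2 - 2 * t)))"


section \<open>The fundamental group\<close>

definition based_loops :: "'x topology \<Rightarrow> 'x \<Rightarrow> (real \<Rightarrow> 'x) set" where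
  "based_loops X x0 = {\<gamma>. pathin X \<gamma> \<and> \<gamma> 0 = x0 \<and> \<gamma> 1 = x0}"

definition loop_class :: "'x topology \<Rightarrow> 'x \<Rightarrow> (real \<Rightarrow> 'x) \<Rightarrow> (real \<Rightarrow> 'x) set" where
  "loop_class X x0 \<gamma> =
     {\<delta>. homotopic_with (\<lambda>h. h 0 = x0 \<and> h 1 = x0) (top_of_set {0..1}) X \<gamma> \<delta>}"

text \<open>Concatenation as in \<^const>\<open>joinpaths\<close>, which is restricted to type class topologies.\<close>

definition loop_concat :: "(real \<Rightarrow> 'x) \<Rightarrow> (real \<Rightarrow> 'x) \<Rightarrow> real \<Rightarrow> 'x" where
  "loop_concat \<gamma> \<delta> t = (if t \<le> 1/2 then \<gamma> (2 * t) else \<delta> (2 * t - 1))"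

definition fundamental_group :: "'x topology \<Rightarrow> 'x \<Rightarrow> (real \<Rightarrow> 'x) set monoid" where
  "fundamental_group X x0 =
     \<lparr>carrier = loop_class X x0 ` based_loops X x0,
      monoid.mult = (\<lambda>A B. \<Union>\<gamma>\<in>A. \<Union>\<delta>\<in>B. loop_class X x0 (loop_concat \<gamma> \<delta>)),
      one = loop_class X x0 (\<lambda>_. x0)\<rparr>"

definition induced_map ::
  "'x topology \<Rightarrow> 'x \<Rightarrow> 'y topology \<Rightarrow> ('x \<Rightarrow> 'y) \<Rightarrow> (real \<Rightarrow> 'x) set \<Rightarrow> (real \<Rightarrow> 'y) set" where
  "induced_map X x0 Y g = (\<lambda>L \<in> carrier (fundamental_group X x0). \<Union>\<gamma>\<in>L. loop_class Y (g x0) (g \<circ> \<gamma>))"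


section \<open>First cohomotopy and the comparison morphism\<close>

abbreviation circle :: "complex topology" where
  "circle \<equiv> top_of_set (sphere 0 1)"

definition map_class :: "'x topology \<Rightarrow> ('x \<Rightarrow> complex) \<Rightarrow> ('x \<Rightarrow> complex) set" where
  "map_class X f = {g. homotopic_with (\<lambda>_. True) X circle f g}"

definition cohomotopy :: "'x topology \<Rightarrow> ('x \<Rightarrow> complex) set monoid" where
  "cohomotopy X =
     \<lparr>carrier = map_class X ` {f. continuous_map X circle f},
      monoid.mult = (\<lambda>A B. \<Union>f\<in>A. \<Union>g\<in>B. map_class X (\<lambda>x. f x * g x)),
      one = map_class X (\<lambda>_. 1)\<rparr>"

text \<open>The canonical isomorphism from the fundamental group of the circle (at any base point) to the
  integers is given by the winding number around the origin.\<close>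

definition circle_degree :: "(real \<Rightarrow> complex) set \<Rightarrow> int" where
  "circle_degree L = (THE k. \<forall>\<gamma>\<in>L. winding_number \<gamma> 0 = of_int k)"

definition hom_group :: "('a, 'c) monoid_scheme \<Rightarrow> ('b, 'd) monoid_scheme \<Rightarrow> ('a \<Rightarrow> 'b) monoid" where
  "hom_group G H =
     \<lparr>carrier = hom G H \<inter> extensional (carrier G),
      monoid.mult = (\<lambda>f g. \<lambda>x\<in>carrier G. f x \<otimes>\<^bsub>H\<^esub> g x),
      one = (\<lambda>x\<in>carrier G. \<one>\<^bsub>H\<^esub>)\<rparr>"

definition comparison :: "'x topology \<Rightarrow> 'x \<Rightarrow> ('x \<Rightarrow> complex) set \<Rightarrow> (real \<Rightarrow> 'x) set \<Rightarrow> int" where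
  "comparison X x0 A =
     (\<lambda>L \<in> carrier (fundamental_group X x0).
        THE k. \<forall>g\<in>A. circle_degree (induced_map X x0 circle g L) = k)"


section \<open>Baire-1 functions\<close>

definition baire1 :: "'x topology \<Rightarrow> 'y topology \<Rightarrow> ('x \<Rightarrow> 'y) \<Rightarrow> bool" where
  "baire1 X Y f \<longleftrightarrow> f \<in> topspace X \<rightarrow> topspace Y \<and>
     (\<forall>V. openin Y V \<longrightarrow> fsigma_in X {x \<in> topspace X. f x \<in> V})"

text \<open>Functions on a set are represented by their extensional versions, with pointwise addition.\<close>

abbreviation int_functions :: "'a set \<Rightarrow> ('a \<Rightarrow> int) monoid" where
  "int_functions T \<equiv> product_group T (\<lambda>_. integer_group)"

definition baire1_int_functions :: "'a::topological_space set \<Rightarrow> ('a \<Rightarrow> int) monoid" where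
  "baire1_int_functions T =
     (int_functions T)
       \<lparr>carrier := {f \<in> carrier (int_functions T). baire1 (top_of_set T) (discrete_topology UNIV) f}\<rparr>"


section \<open>Evaluation on the generators\<close>

abbreviation pruefer_pi1 :: "'a::euclidean_space set \<Rightarrow> 'a \<Rightarrow> (real \<Rightarrow> 'a pruefer_pt) set monoid" where
  "pruefer_pi1 S p0 \<equiv> fundamental_group (pruefer S) (Seam p0 vertical)"

abbreviation pruefer_comp ::
  "'a::euclidean_space set \<Rightarrow> 'a \<Rightarrow> ('a pruefer_pt \<Rightarrow> complex) set \<Rightarrow> (real \<Rightarrow> 'a pruefer_pt) set \<Rightarrow> int"
  where "pruefer_comp S p0 \<equiv> comparison (pruefer S) (Seam p0 vertical)"

text \<open>The fundamental group being free on the classes of the loops \<open>\<alpha>\<close> from \<open>p0\<close> to \<open>p\<close>, a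
  homomorphism corresponds to its family of values on these classes.\<close>

definition eval_generators ::
  "'a::euclidean_space set \<Rightarrow> 'a \<Rightarrow> ((real \<Rightarrow> 'a pruefer_pt) set \<Rightarrow> int) \<Rightarrow> 'a \<Rightarrow> int" where
  "eval_generators S p0 \<phi> =
     (\<lambda>p \<in> S - {p0}. \<phi> (loop_class (pruefer S) (Seam p0 vertical) (alpha p0 p)))"

end

theory Submission
  imports Defs
begin

text \<open>
  In the coordinates (slope with respect to \<open>p\<close>, signed height) the two open sheets together with
  the seam at \<open>p\<close> become a copy of \<open>\<real>\<^sup>n\<close>, and any two of these charts overlap exactly in the two
  sheets. Hence a homomorphism from the fundamental group to \<open>\<int>\<close> extends to an additive homotopy
  invariant of paths which vanishes in every chart once it vanishes on all loops \<open>\<alpha>\<close>.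

  A map to the circle lifts to a real function in each chart. Normalising the lifts to agree on the
  first sheet, the lift at \<open>p\<close> differs from the one at \<open>p0\<close> on the second sheet by an integer, which
  is the degree along the loop \<open>\<alpha>\<close> from \<open>p0\<close> to \<open>p\<close>. If all these integers vanish, the lifts
  patch together and the map is null-homotopic. Comparing the lifts on both sheets along the vertical
  ray at \<open>p\<close> exhibits the integer as a pointwise limit of continuous functions of \<open>p\<close>, which is
  therefore Baire-1. Conversely, a Baire-1 function \<open>k\<close> is constant on each set of a countable
  closed cover, and a sum of values weighted by the first set that is hit near a point of the upper
  half space is a continuous function equal to \<open>k p\<close> in all small cones at \<open>p\<close>; its exponential
  extends by 1 to a map to the circle with degrees \<open>k\<close>. Applied to indicator functions of points,
  this also yields homomorphisms with arbitrary values on the loops \<open>\<alpha>\<close>, since a loop meets only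
  finitely many seams in an essential way.
\<close>

section \<open>Path functionals\<close>

text \<open>Charts are contractible, but two of them overlap in two components. So vanishing on the
  sheets does not settle the value of a path functional: what remains in a chart is its value on a
  crossing from one sheet to the other. The middle of a loop \<alpha> is such a crossing, and its
  ends lie in the chart at \<open>p0\<close>. Injectivity and surjectivity of evaluation on these
  loops together express freeness as it is seen by homomorphisms to \<int>.

  The obstacle for prescribed degrees is that the closed sets of the cover may accumulate at each
  other's points. A point has positive distance from each of the finitely many earlier sets, all of
  which miss it, while later sets are masked by the first hit. The radius sqrt h serves both ends:
  it tends to 0, so that earlier sets are not felt near the point, and it dominates the width of
  every cone, which is linear in h.\<close>

lemma homotopic_paths_through_convex:
  fixes h :: "'v::real_normed_vector \<Rightarrow> 'b::topological_space"
  assumes "convex K" "continuous_on K h" "h ` K \<subseteq> C"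
    and "path f" "path_image f \<subseteq> K" "path g" "path_image g \<subseteq> K"
    and "pathstart f = pathstart g" "pathfinish f = pathfinish g"
  shows "homotopic_paths C (h \<circ> f) (h \<circ> g)"
proof -
  have "closed_segment (f t) (g t) \<subseteq> K" if "t \<in> {0..1}" for t
    using that assms by (intro closed_segment_subset) (auto simp: path_image_def)
  then have "homotopic_paths K f g"
    using assms by (intro homotopic_paths_linear) auto
  then show ?thesis
    using assms by (intro homotopic_paths_continuous_image[of K]) auto
qed

text \<open>Convexity of the unit interval makes the two parameter changes homotopic before \<gamma>
  is applied. The groupoid laws below are instances.\<close>

lemma homotopic_paths_reparametrized:
  fixes \<gamma> :: "real \<Rightarrow> 'b::topological_space"
  assumes "path \<gamma>" "path_image \<gamma> \<subseteq> C"
    and "path f" "path_image f \<subseteq> {0..1}" "path g" "path_image g \<subseteq> {0..1}"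
    and "pathstart f = pathstart g" "pathfinish f = pathfinish g"
  shows "homotopic_paths C (\<gamma> \<circ> f) (\<gamma> \<circ> g)"
  using assms by (intro homotopic_paths_through_convex[of "{0..1}"]) (auto simp: path_def path_image_def)

section \<open>Groupoid laws up to homotopy\<close>

lemma joinpaths_compose: "h \<circ> (p +++ q) = (h \<circ> p) +++ (h \<circ> q)"
  by (auto simp: joinpaths_def fun_eq_iff)

lemma homotopic_paths_reversepath_cancel:
  fixes p :: "real \<Rightarrow> 'b::topological_space"
  assumes "path p" "path_image p \<subseteq> C"
  shows "homotopic_paths C (p +++ reversepath p) (\<lambda>_. pathstart p)"
proof -
  have "homotopic_paths C (p \<circ> (linepath 0 1 +++ reversepath (linepath 0 1))) (p \<circ> linepath 0 0)"
    using assms by (intro homotopic_paths_reparametrized) (auto simp: path_image_join closed_segment_eq_real_ivl)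
  moreover have "p \<circ> (linepath 0 1 +++ reversepath (linepath 0 1)) = p +++ reversepath p"
    by (auto simp: joinpaths_def reversepath_def linepath_def fun_eq_iff)
  moreover have "p \<circ> linepath 0 0 = (\<lambda>_. pathstart p)"
    by (auto simp: linepath_def pathstart_def)
  ultimately show ?thesis by simp
qed

lemma homotopic_paths_join_const:
  fixes p :: "real \<Rightarrow> 'b::topological_space"
  assumes "path p" "path_image p \<subseteq> C"
  shows "homotopic_paths C ((\<lambda>_. pathstart p) +++ p) p"
proof -
  have "homotopic_paths C (p \<circ> (linepath 0 0 +++ linepath 0 1)) (p \<circ> linepath 0 1)"
    using assms by (intro homotopic_paths_reparametrized) (auto simp: path_image_join closed_segment_eq_real_ivl)
  moreover have "p \<circ> (linepath 0 0 +++ linepath 0 1) = (\<lambda>_. pathstart p) +++ p"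
    by (auto simp: joinpaths_def linepath_def pathstart_def fun_eq_iff)
  moreover have "p \<circ> linepath 0 1 = p"
    by (auto simp: linepath_def)
  ultimately show ?thesis by simp
qed

lemma homotopic_paths_join_const_right:
  fixes p :: "real \<Rightarrow> 'b::topological_space"
  assumes "path p" "path_image p \<subseteq> C"
  shows "homotopic_paths C (p +++ (\<lambda>_. pathfinish p)) p"
proof -
  have "homotopic_paths C (p \<circ> (linepath 0 1 +++ linepath 1 1)) (p \<circ> linepath 0 1)"
    using assms by (intro homotopic_paths_reparametrized) (auto simp: path_image_join closed_segment_eq_real_ivl)
  moreover have "p \<circ> (linepath 0 1 +++ linepath 1 1) = p +++ (\<lambda>_. pathfinish p)"
    by (auto simp: joinpaths_def linepath_def pathfinish_def fun_eq_iff)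
  moreover have "p \<circ> linepath 0 1 = p"
    by (auto simp: linepath_def)
  ultimately show ?thesis by simp
qed

lemma homotopic_paths_join_segments:
  fixes \<gamma> :: "real \<Rightarrow> 'b::topological_space"
  assumes "path \<gamma>" "path_image \<gamma> \<subseteq> C" "u \<in> {0..1}" "v \<in> {0..1}" "w \<in> {0..1}"
  shows "homotopic_paths C ((\<gamma> \<circ> linepath u v) +++ (\<gamma> \<circ> linepath v w)) (\<gamma> \<circ> linepath u w)"
proof -
  have "homotopic_paths C (\<gamma> \<circ> (linepath u v +++ linepath v w)) (\<gamma> \<circ> linepath u w)"
    using assms
    by (intro homotopic_paths_reparametrized) (auto simp: path_image_join closed_segment_eq_real_ivl)
  then show ?thesis by (simp add: joinpaths_compose)
qed

lemma path_segment:
  fixes \<gamma> :: "real \<Rightarrow> 'b::topological_space"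
  assumes "path \<gamma>" "u \<in> {0..1}" "v \<in> {0..1}"
  shows "path (\<gamma> \<circ> linepath u v)"
proof -
  have "closed_segment u v \<subseteq> {0..1}"
    using assms by (auto simp: closed_segment_eq_real_ivl split: if_splits)
  then show ?thesis
    using assms by (intro path_continuous_image) (auto simp: path_def intro: continuous_on_subset)
qed

text \<open>An integer-valued functor on the fundamental groupoid of \<open>C\<close>, described on
  representatives. Unlike a homomorphism on based loops, it can be evaluated on pieces of a path
  that lie in single charts.\<close>

locale path_functional =
  fixes C :: "'b::topological_space set" and \<Psi> :: "(real \<Rightarrow> 'b) \<Rightarrow> int"
  assumes homotopic: "homotopic_paths C p q \<Longrightarrow> \<Psi> p = \<Psi> q"
    and join: "\<lbrakk>path p; path_image p \<subseteq> C; path q; path_image q \<subseteq> C; pathfinish p = pathstart q\<rbrakk>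
                 \<Longrightarrow> \<Psi> (p +++ q) = \<Psi> p + \<Psi> q"
begin

text \<open>A constant path is its own concatenation, so its value v satisfies v = v + v.\<close>

lemma const:
  assumes "x \<in> C"
  shows "\<Psi> (\<lambda>_. x) = 0"
proof -
  have "path (\<lambda>_::real. x)" by (simp add: path_def)
  moreover have "(\<lambda>_. x) +++ (\<lambda>_. x) = (\<lambda>_::real. x)" by (auto simp: joinpaths_def)
  ultimately show ?thesis
    using join[of "\<lambda>_. x" "\<lambda>_. x"] assms by (auto simp: path_image_def pathstart_def pathfinish_def)
qed

lemma segment_join:
  assumes "path \<gamma>" "path_image \<gamma> \<subseteq> C" "u \<in> {0..1}" "v \<in> {0..1}" "w \<in> {0..1}"
  shows "\<Psi> (\<gamma> \<circ> linepath u w) = \<Psi> (\<gamma> \<circ> linepath u v) + \<Psi> (\<gamma> \<circ> linepath v w)"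
proof -
  have sub: "path_image (\<gamma> \<circ> linepath a b) \<subseteq> C" if "a \<in> {0..1}" "b \<in> {0..1}" for a b
  proof -
    have "closed_segment a b \<subseteq> {0..1}"
      using that by (auto simp: closed_segment_eq_real_ivl split: if_splits)
    then have "path_image (\<gamma> \<circ> linepath a b) \<subseteq> path_image \<gamma>"
      unfolding path_image_compose path_image_linepath unfolding path_image_def by (rule image_mono)
    then show ?thesis using assms(2) by (rule subset_trans)
  qed
  have "\<Psi> (\<gamma> \<circ> linepath u w) = \<Psi> ((\<gamma> \<circ> linepath u v) +++ (\<gamma> \<circ> linepath v w))"
    using homotopic[OF homotopic_paths_join_segments[OF assms]] by simp
  also have "\<dots> = \<Psi> (\<gamma> \<circ> linepath u v) + \<Psi> (\<gamma> \<circ> linepath v w)"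
    using assms sub by (intro join path_segment) (auto simp: pathfinish_compose pathstart_compose)
  finally show ?thesis .
qed

text \<open>The value on the initial segment up to \<open>t\<close> is locally constant in
  \<open>t\<close> and starts at 0; connectedness of the unit interval takes the place of a
  subdivision by a Lebesgue number.\<close>

lemma vanishes_if_locally:
  assumes "path \<gamma>" "path_image \<gamma> \<subseteq> C"
    and cover: "\<And>x. x \<in> C \<Longrightarrow> \<exists>U. open U \<and> x \<in> U \<and>
      (\<forall>\<sigma>. path \<sigma> \<and> path_image \<sigma> \<subseteq> U \<longrightarrow> \<Psi> \<sigma> = 0)"
  shows "\<Psi> \<gamma> = 0"
proof -
  let ?f = "\<lambda>t. \<Psi> (\<gamma> \<circ> linepath 0 t)"
  have loc: "\<exists>T. openin (top_of_set {0..1}) T \<and> t \<in> T \<and> (\<forall>s\<in>T. ?f s = ?f t)"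
    if t: "t \<in> {0..1}" for t
  proof -
    have "\<gamma> t \<in> C" using assms(2) t by (auto simp: path_image_def)
    from cover[OF this] obtain U where U: "open U" "\<gamma> t \<in> U"
        "\<forall>\<sigma>. path \<sigma> \<and> path_image \<sigma> \<subseteq> U \<longrightarrow> \<Psi> \<sigma> = 0"
      by (elim exE conjE)
    have "openin (top_of_set {0..1}) ({0..1} \<inter> \<gamma> -` U)"
      using assms(1) U(1) unfolding path_def by (rule continuous_openin_preimage_gen)
    then obtain d where d: "d > 0" "ball t d \<inter> {0..1} \<subseteq> \<gamma> -` U"
      using t U(2) unfolding openin_contains_ball by blast
    have "?f s = ?f t" if s: "s \<in> {0..1}" "dist s t < d" for s
    proof -
      have "closed_segment t s \<subseteq> ball t d \<inter> {0..1}"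
        using s t d(1) by (intro closed_segment_subset) (simp_all add: dist_commute convex_Int)
      then have "path_image (\<gamma> \<circ> linepath t s) \<subseteq> U"
        using d(2) unfolding path_image_compose path_image_linepath by blast
      then have "\<Psi> (\<gamma> \<circ> linepath t s) = 0"
        using U(3) path_segment[OF assms(1) t s(1)] by simp
      then show ?thesis using segment_join[of \<gamma> 0 t s] assms(1,2) s t by simp
    qed
    then have "\<forall>s \<in> {0..1} \<inter> ball t d. ?f s = ?f t" by (simp add: dist_commute)
    moreover have "openin (top_of_set {0..1}) ({0..1} \<inter> ball t d)" by (simp add: openin_open_Int)
    moreover have "t \<in> {0..1} \<inter> ball t d" using t d(1) by simp
    ultimately show ?thesis by blast
  qed
  have "?f constant_on {0..1}"
    by (rule locally_constant_imp_constant[OF _ loc]) auto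
  then have "?f 1 = ?f 0" unfolding constant_on_def by auto
  moreover have "?f 0 = 0"
    using const[of "\<gamma> 0"] assms(2) by (simp add: comp_def path_image_def image_subset_iff)
  ultimately show ?thesis by (simp add: comp_def linepath_def)
qed

end

section \<open>The fundamental group of a subspace\<close>

abbreviation pi1_set :: "'b::topological_space set \<Rightarrow> 'b \<Rightarrow> (real \<Rightarrow> 'b) set monoid" where
  "pi1_set C b \<equiv> fundamental_group (top_of_set C) b"

abbreviation loops_at :: "'b::topological_space set \<Rightarrow> 'b \<Rightarrow> (real \<Rightarrow> 'b) set" where
  "loops_at C b \<equiv> based_loops (top_of_set C) b"

abbreviation loop_cl :: "'b::topological_space set \<Rightarrow> 'b \<Rightarrow> (real \<Rightarrow> 'b) \<Rightarrow> (real \<Rightarrow> 'b) set" where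
  "loop_cl C b \<equiv> loop_class (top_of_set C) b"

lemma mem_loops_at:
  "\<gamma> \<in> loops_at C b \<longleftrightarrow> path \<gamma> \<and> path_image \<gamma> \<subseteq> C \<and> pathstart \<gamma> = b \<and> pathfinish \<gamma> = b"
  by (auto simp: based_loops_def pathin_canon_iff path_image_def pathstart_def pathfinish_def)

lemma loop_class_top_of_set:
  assumes "\<gamma> \<in> loops_at C b"
  shows "loop_cl C b \<gamma> = {\<delta>. homotopic_paths C \<gamma> \<delta>}"
  using assms by (auto simp: mem_loops_at loop_class_def homotopic_paths_def pathstart_def pathfinish_def)

lemma loop_class_eq_iff:
  assumes "\<gamma> \<in> loops_at C b" "\<delta> \<in> loops_at C b"
  shows "loop_cl C b \<gamma> = loop_cl C b \<delta> \<longleftrightarrow> homotopic_paths C \<gamma> \<delta>"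
proof
  assume "loop_cl C b \<gamma> = loop_cl C b \<delta>"
  moreover have "homotopic_paths C \<delta> \<delta>" using assms by (simp add: mem_loops_at)
  ultimately show "homotopic_paths C \<gamma> \<delta>" using assms by (auto simp: loop_class_top_of_set)
next
  assume "homotopic_paths C \<gamma> \<delta>"
  then show "loop_cl C b \<gamma> = loop_cl C b \<delta>"
    using assms by (auto simp: loop_class_top_of_set intro: homotopic_paths_trans homotopic_paths_sym)
qed

lemma homotopic_loops_at:
  assumes "\<gamma> \<in> loops_at C b" "homotopic_paths C \<gamma> \<delta>"
  shows "\<delta> \<in> loops_at C b"
  using assms homotopic_paths_imp_path[OF assms(2)] homotopic_paths_imp_subset[OF assms(2)]
    homotopic_paths_imp_pathstart[OF assms(2)] homotopic_paths_imp_pathfinish[OF assms(2)]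
  by (simp add: mem_loops_at)

lemma loop_class_self: "\<gamma> \<in> loops_at C b \<Longrightarrow> \<gamma> \<in> loop_cl C b \<gamma>"
  by (simp add: loop_class_top_of_set) (simp add: mem_loops_at)

lemma carrier_pi1_set: "carrier (pi1_set C b) = loop_cl C b ` loops_at C b"
  by (simp add: fundamental_group_def)

lemma join_loops_at: "\<gamma> \<in> loops_at C b \<Longrightarrow> \<delta> \<in> loops_at C b \<Longrightarrow> \<gamma> +++ \<delta> \<in> loops_at C b"
  by (auto simp: mem_loops_at path_image_join)

lemma loop_class_eqI: "\<gamma> \<in> loops_at C b \<Longrightarrow> \<delta> \<in> loop_cl C b \<gamma> \<Longrightarrow> \<delta> \<in> loops_at C b \<and> loop_cl C b \<delta> = loop_cl C b \<gamma>"
  by (metis homotopic_loops_at loop_class_eq_iff loop_class_top_of_set mem_Collect_eq)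

text \<open>The product is a union over all pairs of representatives. Concatenation respects
  homotopy, so every set in this union is the same class.\<close>

lemma mult_pi1_set:
  assumes "\<gamma> \<in> loops_at C b" "\<delta> \<in> loops_at C b"
  shows "loop_cl C b \<gamma> \<otimes>\<^bsub>pi1_set C b\<^esub> loop_cl C b \<delta> = loop_cl C b (\<gamma> +++ \<delta>)"
proof -
  have cj: "loop_concat = joinpaths" by (simp add: loop_concat_def joinpaths_def fun_eq_iff)
  have "loop_cl C b (\<gamma>' +++ \<delta>') = loop_cl C b (\<gamma> +++ \<delta>)"
    if "\<gamma>' \<in> loop_cl C b \<gamma>" "\<delta>' \<in> loop_cl C b \<delta>" for \<gamma>' \<delta>'
  proof -
    have m: "\<gamma>' \<in> loops_at C b" "\<delta>' \<in> loops_at C b" using that assms loop_class_eqI by blast+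
    have "homotopic_paths C (\<gamma> +++ \<delta>) (\<gamma>' +++ \<delta>')"
      using that assms by (intro homotopic_paths_join) (auto simp: loop_class_top_of_set mem_loops_at)
    then show ?thesis
      using loop_class_eq_iff[OF join_loops_at[OF assms] join_loops_at[OF m]] by simp
  qed
  then have "(\<Union>\<gamma>'\<in>loop_cl C b \<gamma>. \<Union>\<delta>'\<in>loop_cl C b \<delta>. loop_cl C b (\<gamma>' +++ \<delta>')) = loop_cl C b (\<gamma> +++ \<delta>)"
    using loop_class_self[OF assms(1)] loop_class_self[OF assms(2)] by blast
  then show ?thesis
    unfolding fundamental_group_def cj by simp
qed

lemma const_loops_at: "b \<in> C \<Longrightarrow> (\<lambda>_. b) \<in> loops_at C b"
  by (auto simp: mem_loops_at path_def path_image_def pathstart_def pathfinish_def)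

lemma hom_pi1_const:
  assumes "\<phi> \<in> hom (pi1_set C b) integer_group" "b \<in> C"
  shows "\<phi> (loop_cl C b (\<lambda>_. b)) = 0"
proof -
  have c: "(\<lambda>_. b) \<in> loops_at C b" using assms by (simp add: const_loops_at)
  have "(\<lambda>_. b) +++ (\<lambda>_. b) = (\<lambda>_::real. b)" by (simp add: joinpaths_def)
  then show ?thesis
    using hom_mult[OF assms(1), of "loop_cl C b (\<lambda>_. b)" "loop_cl C b (\<lambda>_. b)"] c mult_pi1_set[OF c c]
    by (simp add: carrier_pi1_set)
qed

text \<open>The shape of two consecutive paths, each conjugated to a loop:
  \<open>reversepath d\<close> and \<open>d\<close> are the tails at their common point and
  cancel.\<close>

lemma homotopic_paths_cancel_middle:
  fixes a :: "real \<Rightarrow> 'b::topological_space"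
  assumes "path a" "path_image a \<subseteq> C" "path p" "path_image p \<subseteq> C" "path d" "path_image d \<subseteq> C"
    "path q" "path_image q \<subseteq> C" "path e" "path_image e \<subseteq> C"
    and ends: "pathfinish a = pathstart p" "pathfinish p = pathfinish d" "pathstart q = pathfinish d"
    "pathfinish q = pathstart e"
  shows "homotopic_paths C ((a +++ (p +++ reversepath d)) +++ (d +++ (q +++ e))) (a +++ ((p +++ q) +++ e))"
proof -
  note [trans] = homotopic_paths_trans
  note [simp] = assms path_image_join
  let ?r = "q +++ e"
  have "homotopic_paths C ((p +++ reversepath d) +++ (d +++ ?r)) (((p +++ reversepath d) +++ d) +++ ?r)"
    by (rule homotopic_paths_assoc) auto
  also have "homotopic_paths C (((p +++ reversepath d) +++ d) +++ ?r) ((p +++ (reversepath d +++ d)) +++ ?r)"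
    by (intro homotopic_paths_join homotopic_paths_sym[OF homotopic_paths_assoc]) auto
  also have "homotopic_paths C ((p +++ (reversepath d +++ d)) +++ ?r) ((p +++ (\<lambda>_. pathfinish p)) +++ ?r)"
  proof -
    have "homotopic_paths C (reversepath d +++ d) (\<lambda>_. pathfinish p)"
      using homotopic_paths_reversepath_cancel[of "reversepath d" C] by simp
    then show ?thesis by (intro homotopic_paths_join) auto
  qed
  also have "homotopic_paths C ((p +++ (\<lambda>_. pathfinish p)) +++ ?r) (p +++ ?r)"
    by (intro homotopic_paths_join homotopic_paths_join_const_right)
      (simp_all, simp_all add: pathfinish_def pathstart_def joinpaths_def)
  also have "homotopic_paths C (p +++ ?r) ((p +++ q) +++ e)"
    by (rule homotopic_paths_assoc) auto
  finally have *: "homotopic_paths C ((p +++ reversepath d) +++ (d +++ ?r)) ((p +++ q) +++ e)" .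
  have "homotopic_paths C ((a +++ (p +++ reversepath d)) +++ (d +++ ?r)) (a +++ ((p +++ reversepath d) +++ (d +++ ?r)))"
    by (rule homotopic_paths_sym[OF homotopic_paths_assoc]) auto
  also have "homotopic_paths C (a +++ ((p +++ reversepath d) +++ (d +++ ?r))) (a +++ ((p +++ q) +++ e))"
    by (intro homotopic_paths_join *) auto
  finally show ?thesis .
qed

text \<open>Conjugating with a family of paths from the base point turns arbitrary paths into loops.\<close>

lemma path_functional_extension:
  fixes C :: "'b::topological_space set"
  assumes \<phi>: "\<phi> \<in> hom (pi1_set C b) integer_group" and b: "b \<in> C"
    and \<tau>: "\<And>x. x \<in> C \<Longrightarrow> path (\<tau> x)" "\<And>x. x \<in> C \<Longrightarrow> path_image (\<tau> x) \<subseteq> C"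
      "\<And>x. x \<in> C \<Longrightarrow> pathstart (\<tau> x) = b" "\<And>x. x \<in> C \<Longrightarrow> pathfinish (\<tau> x) = x"
    and \<tau>b: "\<tau> b = (\<lambda>_. b)"
  obtains \<Psi> where "path_functional C \<Psi>" "\<And>x. x \<in> C \<Longrightarrow> \<Psi> (\<tau> x) = 0"
    "\<And>\<gamma>. \<gamma> \<in> loops_at C b \<Longrightarrow> \<Psi> \<gamma> = \<phi> (loop_cl C b \<gamma>)"
proof
  define lp where "lp \<sigma> = \<tau> (pathstart \<sigma>) +++ (\<sigma> +++ reversepath (\<tau> (pathfinish \<sigma>)))" for \<sigma>
  define \<Psi> where "\<Psi> \<sigma> = \<phi> (loop_cl C b (lp \<sigma>))" for \<sigma>
  have ends: "pathstart \<sigma> \<in> C \<and> pathfinish \<sigma> \<in> C" if "path_image \<sigma> \<subseteq> C" for \<sigma>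
    using that by auto
  have lp: "lp \<sigma> \<in> loops_at C b" if "path \<sigma>" "path_image \<sigma> \<subseteq> C" for \<sigma>
    using that \<tau> ends[OF that(2)] by (simp add: lp_def mem_loops_at path_image_join)
  show "path_functional C \<Psi>"
  proof
    fix p q assume pq: "homotopic_paths C p q"
    have e: "path p" "path q" "path_image p \<subseteq> C" "path_image q \<subseteq> C"
      "pathstart q = pathstart p" "pathfinish q = pathfinish p"
      using homotopic_paths_imp_path[OF pq] homotopic_paths_imp_subset[OF pq]
        homotopic_paths_imp_pathstart[OF pq] homotopic_paths_imp_pathfinish[OF pq] by simp_all
    have "homotopic_paths C (lp p) (lp q)"
      unfolding lp_def e using e \<tau> ends[OF e(3)] pq
      by (intro homotopic_paths_join) simp_all
    then show "\<Psi> p = \<Psi> q"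
      unfolding \<Psi>_def using lp e loop_class_eq_iff by metis
  next
    fix p q :: "real \<Rightarrow> 'b"
    assume pq: "path p" "path_image p \<subseteq> C" "path q" "path_image q \<subseteq> C" "pathfinish p = pathstart q"
    have pj: "path (p +++ q)" "path_image (p +++ q) \<subseteq> C"
      using pq by (simp_all add: path_image_join)
    have "homotopic_paths C (lp p +++ lp q) (lp (p +++ q))"
      unfolding lp_def pathstart_join pathfinish_join pq(5)
      using pq(1-4) \<tau> ends[OF pq(2)] ends[OF pq(4)] pq(5)
      by (intro homotopic_paths_cancel_middle) simp_all
    then have "loop_cl C b (lp (p +++ q)) = loop_cl C b (lp p +++ lp q)"
      using lp pq pj join_loops_at loop_class_eq_iff by metis
    also have "\<dots> = loop_cl C b (lp p) \<otimes>\<^bsub>pi1_set C b\<^esub> loop_cl C b (lp q)"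
      using lp pq by (intro mult_pi1_set[symmetric]) auto
    finally show "\<Psi> (p +++ q) = \<Psi> p + \<Psi> q"
      unfolding \<Psi>_def using hom_mult[OF \<phi>, of "loop_cl C b (lp p)" "loop_cl C b (lp q)"] lp pq
      by (simp add: carrier_pi1_set)
  qed
  have \<Psi>_loop: "\<Psi> \<gamma> = \<phi> (loop_cl C b \<gamma>)" if \<gamma>: "\<gamma> \<in> loops_at C b" for \<gamma>
  proof -
    note [trans] = homotopic_paths_trans
    have g: "path \<gamma>" "path_image \<gamma> \<subseteq> C" "pathstart \<gamma> = b" "pathfinish \<gamma> = b"
      using \<gamma> by (simp_all add: mem_loops_at)
    \<comment> \<open>The tail at \<open>b\<close> is the constant path and not just some loop;
      hence conjugation does not change the class of a loop at \<open>b\<close>.\<close>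
    have lp_eq: "lp \<gamma> = (\<lambda>_. b) +++ (\<gamma> +++ (\<lambda>_. b))"
      unfolding lp_def g \<tau>b by (simp add: reversepath_def)
    have "homotopic_paths C (lp \<gamma>) (\<gamma> +++ (\<lambda>_. b))"
      unfolding lp_eq using homotopic_paths_join_const[of "\<gamma> +++ (\<lambda>_. b)" C] g b const_loops_at[OF b]
      by (simp add: path_image_join mem_loops_at)
    also have "homotopic_paths C (\<gamma> +++ (\<lambda>_. b)) \<gamma>"
      using homotopic_paths_join_const_right[of \<gamma> C] g by simp
    finally show ?thesis
      unfolding \<Psi>_def using lp[OF g(1,2)] \<gamma> loop_class_eq_iff by metis
  qed
  show "\<Psi> \<gamma> = \<phi> (loop_cl C b \<gamma>)" if "\<gamma> \<in> loops_at C b" for \<gamma>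
    by (rule \<Psi>_loop[OF that])
  show "\<Psi> (\<tau> x) = 0" if x: "x \<in> C" for x
  proof -
    note [trans] = homotopic_paths_trans
    have lp_eq: "lp (\<tau> x) = (\<lambda>_. b) +++ (\<tau> x +++ reversepath (\<tau> x))"
      unfolding lp_def \<tau>(3,4)[OF x] \<tau>b ..
    have "homotopic_paths C (lp (\<tau> x)) (\<tau> x +++ reversepath (\<tau> x))"
      unfolding lp_eq using homotopic_paths_join_const[of "\<tau> x +++ reversepath (\<tau> x)" C] \<tau>[OF x]
      by (simp add: path_image_join)
    also have "homotopic_paths C (\<tau> x +++ reversepath (\<tau> x)) (\<lambda>_. b)"
      using homotopic_paths_reversepath_cancel[of "\<tau> x" C] \<tau>[OF x] by simp
    finally have "loop_cl C b (lp (\<tau> x)) = loop_cl C b (\<lambda>_. b)"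
      using lp[OF \<tau>(1)[OF x] \<tau>(2)[OF x]] const_loops_at[OF b] loop_class_eq_iff by metis
    then show ?thesis unfolding \<Psi>_def using hom_pi1_const[OF \<phi> b] by simp
  qed
qed

section \<open>Degrees of maps to the circle\<close>

text \<open>On a contractible set there is a continuous logarithm, and modulus 1 forces its real
  part to be 0. Division by 2 pi measures the lift in full turns, so that two lifts differ by
  integers.\<close>

lemma circle_lift:
  fixes f :: "'v::real_normed_vector \<Rightarrow> complex"
  assumes "continuous_on K f" "f \<in> K \<rightarrow> sphere 0 1" "contractible K"
  obtains L where "continuous_on K L" "\<And>x. x \<in> K \<Longrightarrow> f x = cis (2 * pi * L x)"
proof -
  have n: "norm (f x) = 1" if "x \<in> K" for x using assms(2) that by auto
  then have "f x \<noteq> 0" if "x \<in> K" for x using that by force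
  then obtain g where g: "continuous_on K g" "\<And>x. x \<in> K \<Longrightarrow> f x = exp (g x)"
    using continuous_logarithm_on_contractible[OF assms(1,3)] by blast
  show thesis
  proof
    show "continuous_on K (\<lambda>x. Im (g x) / (2 * pi))"
      using g(1) by (intro continuous_intros) auto
    fix x assume x: "x \<in> K"
    have "exp (Re (g x)) = 1" using n[OF x] g(2)[OF x] by (simp add: norm_exp_eq_Re)
    then show "f x = cis (2 * pi * (Im (g x) / (2 * pi)))"
      using g(2)[OF x] by (simp add: exp_eq_polar)
  qed
qed

text \<open>Rounding down the real part turns the complex winding number into an integer without a
  definite description. On loops in the circle nothing is lost, by
  \<open>circle_index_winding\<close>.\<close>

definition circle_index :: "(real \<Rightarrow> complex) \<Rightarrow> int" where
  "circle_index \<gamma> = \<lfloor>Re (winding_number \<gamma> 0)\<rfloor>"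

lemma winding_number_cis:
  assumes "continuous_on {0..1} L" "\<And>t. t \<in> {0..1} \<Longrightarrow> \<gamma> t = cis (2 * pi * L t)"
  shows "winding_number \<gamma> 0 = of_real (L 1 - L 0)"
proof -
  define p where "p t = \<i> * of_real (2 * pi * L t)" for t
  have "path p" unfolding path_def p_def using assms(1) by (intro continuous_intros)
  then have "winding_number (exp \<circ> p) 0 = (pathfinish p - pathstart p) / (2 * of_real pi * \<i>)"
    by (rule winding_number_compose_exp)
  also have "\<dots> = of_real (L 1 - L 0)"
    by (simp add: p_def pathfinish_def pathstart_def field_simps)
  finally have *: "winding_number (exp \<circ> p) 0 = of_real (L 1 - L 0)" .
  have "path (exp \<circ> p)" using \<open>path p\<close> by (intro path_continuous_image continuous_intros)
  have eq: "\<gamma> t = (exp \<circ> p) t" if "t \<in> {0..1}" for t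
    using assms(2)[OF that] by (simp add: p_def cis_conv_exp)
  then have "path \<gamma>"
    using \<open>path (exp \<circ> p)\<close> unfolding path_def by (subst continuous_on_cong[OF refl eq]) auto
  \<comment> \<open>The formula for \<gamma> is known on the unit interval only, so the two winding
    numbers are compared through a homotopy instead of an equality of functions.\<close>
  have "winding_number \<gamma> 0 = winding_number (exp \<circ> p) 0"
  proof (rule winding_number_homotopic_paths)
    show "homotopic_paths (- {0}) \<gamma> (exp \<circ> p)"
      using \<open>path \<gamma>\<close> eq by (intro homotopic_paths_eq) (auto simp: path_image_def)
  qed
  with * show ?thesis by simp
qed

lemma cis_2pi_eq_1_int:
  assumes "cis (2 * pi * x) = 1"
  obtains n :: int where "x = n"
proof -
  have "exp (\<i> * of_real (2 * pi * x)) = 1" using assms by (simp add: cis_conv_exp)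
  then obtain n :: int where "2 * pi * x = of_int (2 * n) * pi"
    unfolding exp_eq_1 by auto
  then have "(2 * pi) * x = (2 * pi) * of_int n" by simp
  then have "x = of_int n" unfolding mult_cancel_left by simp
  then show thesis by (rule that)
qed

text \<open>All degrees below are computed this way: the increment of a real lift is an integer
  because the loop closes up.\<close>

lemma circle_index_cis:
  assumes "continuous_on {0..1} L" "\<And>t. t \<in> {0..1} \<Longrightarrow> \<gamma> t = cis (2 * pi * L t)" "\<gamma> 0 = \<gamma> 1"
  shows "of_int (circle_index \<gamma>) = L 1 - L 0"
proof -
  have "cis (2 * pi * (L 1 - L 0)) = 1"
    using assms(2)[of 0] assms(2)[of 1] assms(3)
    by (simp add: right_diff_distrib flip: cis_divide)
  then obtain n :: int where "L 1 - L 0 = n" by (rule cis_2pi_eq_1_int)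
  then show ?thesis using winding_number_cis[OF assms(1,2)] by (simp add: circle_index_def)
qed

lemma path_circle_lift:
  assumes "path \<gamma>" "path_image \<gamma> \<subseteq> sphere 0 (1::real)"
  obtains L where "continuous_on {0..1} L" "\<And>t. t \<in> {0..1} \<Longrightarrow> \<gamma> t = cis (2 * pi * L t)"
proof (rule circle_lift[of "{0..1}" \<gamma>])
  show "contractible {0..1::real}" by (intro convex_imp_contractible) auto
qed (use assms in \<open>auto simp: path_def path_image_def\<close>)

lemma circle_index_winding:
  assumes "path \<gamma>" "path_image \<gamma> \<subseteq> sphere 0 1" "pathstart \<gamma> = pathfinish \<gamma>"
  shows "winding_number \<gamma> 0 = of_int (circle_index \<gamma>)"
proof -
  obtain L where L: "continuous_on {0..1} L" "\<And>t. t \<in> {0..1} \<Longrightarrow> \<gamma> t = cis (2 * pi * L t)"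
    using path_circle_lift[OF assms(1,2)] by blast
  show ?thesis
    using winding_number_cis[OF L] circle_index_cis[OF L, symmetric] assms(3)
    by (simp add: pathstart_def pathfinish_def del: of_real_diff)
qed

lemma circle_index_mult:
  assumes "path \<gamma>" "path_image \<gamma> \<subseteq> sphere 0 1" "pathstart \<gamma> = pathfinish \<gamma>"
    and "path \<delta>" "path_image \<delta> \<subseteq> sphere 0 1" "pathstart \<delta> = pathfinish \<delta>"
  shows "circle_index (\<lambda>t. \<gamma> t * \<delta> t) = circle_index \<gamma> + circle_index \<delta>"
proof -
  obtain L where L: "continuous_on {0..1} L" "\<And>t. t \<in> {0..1} \<Longrightarrow> \<gamma> t = cis (2 * pi * L t)"
    using path_circle_lift[OF assms(1,2)] by blast
  obtain M where M: "continuous_on {0..1} M" "\<And>t. t \<in> {0..1} \<Longrightarrow> \<delta> t = cis (2 * pi * M t)"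
    using path_circle_lift[OF assms(4,5)] by blast
  have "continuous_on {0..1} (\<lambda>t. L t + M t)" using L M by (intro continuous_intros)
  moreover have "\<gamma> t * \<delta> t = cis (2 * pi * (L t + M t))" if "t \<in> {0..1}" for t
    using L(2)[OF that] M(2)[OF that] by (simp add: cis_mult algebra_simps)
  ultimately have "of_int (circle_index (\<lambda>t. \<gamma> t * \<delta> t)) = L 1 + M 1 - (L 0 + M 0)"
    using assms(3,6) by (intro circle_index_cis) (auto simp: pathstart_def pathfinish_def)
  also have "\<dots> = of_int (circle_index \<gamma> + circle_index \<delta>)"
    using circle_index_cis[OF L] circle_index_cis[OF M] assms(3,6)
    by (simp add: pathstart_def pathfinish_def)
  finally show ?thesis by linarith
qed

lemma circle_index_homotopic_loops:
  assumes "homotopic_loops (sphere 0 1) \<gamma> \<delta>"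
  shows "circle_index \<gamma> = circle_index \<delta>"
proof -
  have "homotopic_loops (- {0}) \<gamma> \<delta>"
    by (rule homotopic_loops_subset[OF assms]) auto
  then show ?thesis by (simp add: circle_index_def winding_number_homotopic_loops)
qed

lemma circle_index_join:
  assumes "path \<gamma>" "path_image \<gamma> \<subseteq> sphere 0 1" "pathstart \<gamma> = pathfinish \<gamma>"
    and "path \<delta>" "path_image \<delta> \<subseteq> sphere 0 1" "pathstart \<delta> = pathfinish \<delta>" "pathfinish \<gamma> = pathstart \<delta>"
  shows "circle_index (\<gamma> +++ \<delta>) = circle_index \<gamma> + circle_index \<delta>"
proof -
  have "winding_number (\<gamma> +++ \<delta>) 0 = winding_number \<gamma> 0 + winding_number \<delta> 0"
    using assms by (intro winding_number_join) auto
  moreover have "winding_number (\<gamma> +++ \<delta>) 0 = of_int (circle_index (\<gamma> +++ \<delta>))"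
    using assms by (intro circle_index_winding) (auto simp: path_image_join)
  ultimately show ?thesis
    using assms by (simp add: circle_index_winding flip: of_int_add)
qed


section \<open>First cohomotopy of a subspace\<close>

abbreviation circle_map :: "'b::topological_space set \<Rightarrow> ('b \<Rightarrow> complex) \<Rightarrow> bool" where
  "circle_map C \<equiv> continuous_map (top_of_set C) circle"

lemma circle_map_iff: "circle_map C f \<longleftrightarrow> continuous_on C f \<and> f \<in> C \<rightarrow> sphere 0 1"
  by (simp add: continuous_map_in_subtopology image_subset_iff_funcset)

lemma circle_map_mult:
  "circle_map C f \<Longrightarrow> circle_map C g \<Longrightarrow> circle_map C (\<lambda>x. f x * g x)"
  by (auto simp: circle_map_iff norm_mult Pi_iff intro: continuous_intros)

lemma circle_map_loop:
  assumes "circle_map C g" "\<gamma> \<in> loops_at C b"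
  shows "path (g \<circ> \<gamma>)" "path_image (g \<circ> \<gamma>) \<subseteq> sphere 0 1" "pathstart (g \<circ> \<gamma>) = g b" "pathfinish (g \<circ> \<gamma>) = g b"
proof -
  show "path (g \<circ> \<gamma>)"
    using assms unfolding circle_map_iff mem_loops_at
    by (intro path_continuous_image) (auto intro: continuous_on_subset)
  show "path_image (g \<circ> \<gamma>) \<subseteq> sphere 0 1"
    using assms by (auto simp: circle_map_iff mem_loops_at path_image_def Pi_iff image_subset_iff)
qed (use assms in \<open>auto simp: mem_loops_at pathstart_compose pathfinish_compose\<close>)

text \<open>A homotopy of maps may move the image of the base point, so it yields a free homotopy of
  loops; the winding number around 0 is invariant under these as well.\<close>

lemma circle_index_homotopic_maps:
  assumes "homotopic_with (\<lambda>_. True) (top_of_set C) circle f g" "\<gamma> \<in> loops_at C b"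
  shows "circle_index (f \<circ> \<gamma>) = circle_index (g \<circ> \<gamma>)"
proof (rule circle_index_homotopic_loops)
  have "continuous_map (top_of_set {0..1}) (top_of_set C) \<gamma>"
    using assms(2) by (auto simp: mem_loops_at path_def path_image_def continuous_map_in_subtopology)
  then show "homotopic_loops (sphere 0 1) (f \<circ> \<gamma>) (g \<circ> \<gamma>)"
    unfolding homotopic_loops_def
    using assms by (intro homotopic_with_compose_continuous_map_right[OF assms(1)])
      (auto simp: mem_loops_at pathstart_def pathfinish_def)
qed

lemma map_class_self: "circle_map C f \<Longrightarrow> f \<in> map_class (top_of_set C) f"
  by (simp add: map_class_def)

lemma map_class_eqI:
  assumes "homotopic_with (\<lambda>_. True) (top_of_set C) circle f g"
  shows "map_class (top_of_set C) f = map_class (top_of_set C) g"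
  using assms unfolding map_class_def by (auto intro: homotopic_with_trans homotopic_with_symD)

lemma map_class_mem:
  assumes "g \<in> map_class (top_of_set C) f"
  shows "circle_map C g"
  using homotopic_with_imp_continuous_maps[of "\<lambda>_. True" "top_of_set C" circle f g] assms
  by (simp add: map_class_def)

lemma mult_cohomotopy:
  assumes "circle_map C f" "circle_map C g"
  shows "map_class (top_of_set C) f \<otimes>\<^bsub>cohomotopy (top_of_set C)\<^esub> map_class (top_of_set C) g
    = map_class (top_of_set C) (\<lambda>x. f x * g x)"
proof -
  have "map_class (top_of_set C) (\<lambda>x. f' x * g' x) = map_class (top_of_set C) (\<lambda>x. f x * g x)"
    if fg: "f' \<in> map_class (top_of_set C) f" "g' \<in> map_class (top_of_set C) g" for f' g'
  proof (rule map_class_eqI)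
    let ?P = "prod_topology (top_of_set {0..1::real}) (top_of_set C)"
    obtain h where h: "continuous_map ?P circle h" "\<And>x. h (0, x) = f' x" "\<And>x. h (1, x) = f x"
      using homotopic_with_symD[of "\<lambda>_. True" "top_of_set C" circle f f'] fg(1)
      unfolding map_class_def mem_Collect_eq homotopic_with_def by auto
    obtain k where k: "continuous_map ?P circle k" "\<And>x. k (0, x) = g' x" "\<And>x. k (1, x) = g x"
      using homotopic_with_symD[of "\<lambda>_. True" "top_of_set C" circle g g'] fg(2)
      unfolding map_class_def mem_Collect_eq homotopic_with_def by auto
    have P: "?P = top_of_set ({0..1} \<times> C)" by (simp add: subtopology_Times)
    have "continuous_map ?P circle (\<lambda>z. h z * k z)"
      using h(1) k(1) unfolding P by (rule circle_map_mult)
    then show "homotopic_with (\<lambda>_. True) (top_of_set C) circle (\<lambda>x. f' x * g' x) (\<lambda>x. f x * g x)"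
      unfolding homotopic_with_def using h k by (intro exI[of _ "\<lambda>z. h z * k z"]) auto
  qed
  then have "(\<Union>f'\<in>map_class (top_of_set C) f. \<Union>g'\<in>map_class (top_of_set C) g.
      map_class (top_of_set C) (\<lambda>x. f' x * g' x)) = map_class (top_of_set C) (\<lambda>x. f x * g x)"
    using map_class_self[OF assms(1)] map_class_self[OF assms(2)] by blast
  then show ?thesis unfolding cohomotopy_def by simp
qed

lemma carrier_cohomotopy:
  "carrier (cohomotopy (top_of_set C)) = map_class (top_of_set C) ` {f. circle_map C f}"
  by (simp add: cohomotopy_def)

text \<open>Two layers of representatives have to be resolved: the induced map is a union over the
  class of \<gamma>, and \<open>circle_degree\<close> asks for one winding number shared by the
  whole resulting class. Homotopies in the circle are homotopies in the punctured plane, which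
  settles the second layer.\<close>

lemma circle_degree_induced_map:
  assumes g: "circle_map C g" and \<gamma>: "\<gamma> \<in> loops_at C b"
  shows "circle_degree (induced_map (top_of_set C) b circle g (loop_cl C b \<gamma>)) = circle_index (g \<circ> \<gamma>)"
proof -
  note gg = circle_map_loop[OF g \<gamma>]
  have gl: "g \<circ> \<gamma> \<in> loops_at (sphere 0 1) (g b)" using gg by (simp add: mem_loops_at)
  have "loop_cl (sphere 0 1) (g b) (g \<circ> \<delta>) = loop_cl (sphere 0 1) (g b) (g \<circ> \<gamma>)"
    if \<delta>: "\<delta> \<in> loop_cl C b \<gamma>" for \<delta>
  proof -
    have "homotopic_paths C \<gamma> \<delta>" using \<delta> \<gamma> by (simp add: loop_class_top_of_set)
    then have "homotopic_paths (sphere 0 1) (g \<circ> \<gamma>) (g \<circ> \<delta>)"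
      using g by (intro homotopic_paths_continuous_image) (auto simp: circle_map_iff)
    then show ?thesis using gl homotopic_loops_at loop_class_eq_iff by metis
  qed
  then have "(\<Union>\<delta>\<in>loop_cl C b \<gamma>. loop_cl (sphere 0 1) (g b) (g \<circ> \<delta>)) = loop_cl (sphere 0 1) (g b) (g \<circ> \<gamma>)"
    using loop_class_self[OF \<gamma>] by blast
  then have "induced_map (top_of_set C) b circle g (loop_cl C b \<gamma>) = loop_cl (sphere 0 1) (g b) (g \<circ> \<gamma>)"
    unfolding induced_map_def using \<gamma> by (simp add: carrier_pi1_set)
  moreover have "winding_number \<delta> 0 = of_int (circle_index (g \<circ> \<gamma>))"
    if \<delta>: "\<delta> \<in> loop_cl (sphere 0 1) (g b) (g \<circ> \<gamma>)" for \<delta>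
  proof -
    have "homotopic_paths (sphere 0 1) (g \<circ> \<gamma>) \<delta>" using \<delta> gl by (simp add: loop_class_top_of_set)
    then have "homotopic_paths (- {0}) (g \<circ> \<gamma>) \<delta>" by (rule homotopic_paths_subset) auto
    then have "winding_number (g \<circ> \<gamma>) 0 = winding_number \<delta> 0" by (rule winding_number_homotopic_paths)
    then show ?thesis using circle_index_winding[of "g \<circ> \<gamma>"] gg by simp
  qed
  ultimately show ?thesis
    unfolding circle_degree_def using loop_class_self[OF gl]
    by (intro the_equality) (fastforce, metis of_int_eq_iff)
qed

lemma comparison_loop_class:
  assumes g: "circle_map C g" and \<gamma>: "\<gamma> \<in> loops_at C b"
  shows "comparison (top_of_set C) b (map_class (top_of_set C) g) (loop_cl C b \<gamma>) = circle_index (g \<circ> \<gamma>)"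
proof -
  have *: "circle_degree (induced_map (top_of_set C) b circle f (loop_cl C b \<gamma>)) = circle_index (g \<circ> \<gamma>)"
    if f: "f \<in> map_class (top_of_set C) g" for f
    using circle_degree_induced_map[OF map_class_mem[OF f] \<gamma>] circle_index_homotopic_maps[OF _ \<gamma>, of g f] f
    by (simp add: map_class_def)
  have "(THE k. \<forall>f\<in>map_class (top_of_set C) g.
      circle_degree (induced_map (top_of_set C) b circle f (loop_cl C b \<gamma>)) = k) = circle_index (g \<circ> \<gamma>)"
    using * map_class_self[OF g] by (intro the_equality) auto
  then show ?thesis
    unfolding comparison_def using \<gamma> by (simp add: carrier_pi1_set)
qed

text \<open>Additivity of the degree under concatenation makes each value a homomorphism; additivity
  under pointwise products makes the comparison itself one.\<close>

lemma comparison_hom: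
  "comparison (top_of_set C) b
    \<in> hom (cohomotopy (top_of_set C)) (hom_group (pi1_set C b) integer_group)"
proof (rule homI)
  fix A assume "A \<in> carrier (cohomotopy (top_of_set C))"
  then obtain g where g: "circle_map C g" and A: "A = map_class (top_of_set C) g"
    by (auto simp: carrier_cohomotopy)
  have "comparison (top_of_set C) b A \<in> hom (pi1_set C b) integer_group"
  proof (rule homI)
    fix x y assume "x \<in> carrier (pi1_set C b)" "y \<in> carrier (pi1_set C b)"
    then obtain \<gamma> \<delta> where x: "\<gamma> \<in> loops_at C b" "x = loop_cl C b \<gamma>" and y: "\<delta> \<in> loops_at C b" "y = loop_cl C b \<delta>"
      by (auto simp: carrier_pi1_set)
    have "circle_index (g \<circ> (\<gamma> +++ \<delta>)) = circle_index (g \<circ> \<gamma>) + circle_index (g \<circ> \<delta>)"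
      unfolding joinpaths_compose
      using circle_map_loop[OF g x(1)] circle_map_loop[OF g y(1)] by (intro circle_index_join) simp_all
    then show "comparison (top_of_set C) b A (x \<otimes>\<^bsub>pi1_set C b\<^esub> y) =
        comparison (top_of_set C) b A x \<otimes>\<^bsub>integer_group\<^esub> comparison (top_of_set C) b A y"
      unfolding x(2) y(2) A mult_pi1_set[OF x(1) y(1)]
      using comparison_loop_class[OF g x(1)] comparison_loop_class[OF g y(1)]
        comparison_loop_class[OF g join_loops_at[OF x(1) y(1)]] by simp
  qed simp
  then show "comparison (top_of_set C) b A \<in> carrier (hom_group (pi1_set C b) integer_group)"
    by (simp add: hom_group_def comparison_def)
next
  fix A B assume "A \<in> carrier (cohomotopy (top_of_set C))" "B \<in> carrier (cohomotopy (top_of_set C))"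
  then obtain f g where f: "circle_map C f" "A = map_class (top_of_set C) f"
    and g: "circle_map C g" "B = map_class (top_of_set C) g"
    by (auto simp: carrier_cohomotopy)
  have "comparison (top_of_set C) b (map_class (top_of_set C) (\<lambda>x. f x * g x)) L =
      comparison (top_of_set C) b A L + comparison (top_of_set C) b B L"
    if L: "L \<in> carrier (pi1_set C b)" for L
  proof -
    obtain \<gamma> where \<gamma>: "\<gamma> \<in> loops_at C b" "L = loop_cl C b \<gamma>" using L by (auto simp: carrier_pi1_set)
    have "circle_index (\<lambda>t. (f \<circ> \<gamma>) t * (g \<circ> \<gamma>) t) = circle_index (f \<circ> \<gamma>) + circle_index (g \<circ> \<gamma>)"
      by (rule circle_index_mult[of "f \<circ> \<gamma>" "g \<circ> \<gamma>"]) (use circle_map_loop[OF f(1) \<gamma>(1)] circle_map_loop[OF g(1) \<gamma>(1)] in simp_all)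
    moreover have "(\<lambda>t. (f \<circ> \<gamma>) t * (g \<circ> \<gamma>) t) = (\<lambda>x. f x * g x) \<circ> \<gamma>" by auto
    ultimately show ?thesis
      unfolding \<gamma>(2) f(2) g(2)
      using comparison_loop_class[OF f(1) \<gamma>(1)] comparison_loop_class[OF g(1) \<gamma>(1)]
        comparison_loop_class[OF circle_map_mult[OF f(1) g(1)] \<gamma>(1)] by simp
  qed
  then show "comparison (top_of_set C) b (A \<otimes>\<^bsub>cohomotopy (top_of_set C)\<^esub> B) =
     comparison (top_of_set C) b A \<otimes>\<^bsub>hom_group (pi1_set C b) integer_group\<^esub> comparison (top_of_set C) b B"
    unfolding f(2) g(2) mult_cohomotopy[OF f(1) g(1)]
    by (auto simp: hom_group_def comparison_def fun_eq_iff)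
qed

section \<open>Charts of the Pruefer manifold\<close>

text \<open>The ray of slope w at \<open>p\<close> consists of the points (p + h w, h), so
  approaching \<open>(w, 0)\<close> in this chart means approaching \<open>p\<close> in the
  direction \<open>(w, 1)\<close>. Negative heights belong to the first copy, positive ones to the
  second.\<close>

definition chart :: "'a::euclidean_space \<Rightarrow> 'a \<times> real \<Rightarrow> 'a pruefer_pt" where
  "chart p z = (if snd z = 0 then Seam p (sgn (fst z, 1))
     else Sheet (snd z > 0) (p + \<bar>snd z\<bar> *\<^sub>R fst z, \<bar>snd z\<bar>))"

text \<open>Inverse to the chart on its range only: at a seam over another point \<open>q\<close>
  the second clause returns the slope at \<open>q\<close>.\<close>

fun chart_inv :: "'a::euclidean_space \<Rightarrow> 'a pruefer_pt \<Rightarrow> 'a \<times> real" where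
  "chart_inv p (Sheet c x) = (inverse (snd x) *\<^sub>R (fst x - p), if c then snd x else - snd x)"
| "chart_inv p (Seam q u) = (inverse (snd u) *\<^sub>R fst u, 0)"

lemma chart_inv_chart [simp]: "chart_inv p (chart p z) = z"
proof (cases "snd z = 0")
  case True
  have "norm (fst z, 1::real) > 0" by (simp add: norm_Pair add_nonneg_pos)
  then show ?thesis using True by (cases z) (simp add: chart_def sgn_div_norm)
next
  case False
  then show ?thesis by (cases z) (auto simp: chart_def)
qed

lemma inj_chart: "inj (chart p)"
  by (metis chart_inv_chart injI)

lemma sgn_slope:
  assumes "u \<in> upward_directions"
  shows "sgn (inverse (snd u) *\<^sub>R fst u, 1) = u"
proof -
  have "(inverse (snd u) *\<^sub>R fst u, 1) = inverse (snd u) *\<^sub>R u"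
    using assms by (cases u) (simp add: upward_directions_def)
  then show ?thesis
    using assms by (simp add: upward_directions_def sgn_scaleR sgn_div_norm)
qed

lemma chart_slope: "u \<in> upward_directions \<Longrightarrow> chart p (inverse (snd u) *\<^sub>R fst u, 0) = Seam p u"
  by (simp add: chart_def sgn_slope)

lemma chart_height:
  assumes "snd x > 0"
  shows "chart p (inverse (snd x) *\<^sub>R (fst x - p), if c then snd x else - snd x) = Sheet c x"
  using assms by (cases x) (auto simp: chart_def)

text \<open>Seen from \<open>p\<close> and from \<open>q\<close>, the slopes of one point at height
  h differ by (q - p) / h. The blow-up of this shear at height 0 keeps distinct seams apart.\<close>

lemma chart_transition:
  assumes "snd z \<noteq> 0"
  shows "chart q z = chart p (fst z + inverse \<bar>snd z\<bar> *\<^sub>R (q - p), snd z)"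
  using assms by (auto simp: chart_def algebra_simps)

lemma sgn_upward: "sgn (w, 1) \<in> upward_directions"
proof -
  have "norm (w, 1::real) > 0" by (simp add: norm_Pair add_nonneg_pos)
  then have "norm (sgn (w, 1::real)) = 1" by (simp add: norm_sgn)
  moreover have "snd (sgn (w, 1::real)) > 0"
    using \<open>norm (w, 1::real) > 0\<close> unfolding sgn_div_norm by simp
  ultimately
  show ?thesis by (simp add: upward_directions_def)
qed

lemma mem_bordered_carrier:
  "Inner x \<in> bordered_carrier S \<longleftrightarrow> snd x > 0"
  "Ray p u \<in> bordered_carrier S \<longleftrightarrow> p \<in> S \<and> u \<in> upward_directions"
  by (auto simp: bordered_carrier_def upper_half_space_def simp del: split_paired_Ex)

lemma mem_pruefer_carrier:
  "Sheet c x \<in> pruefer_carrier S \<longleftrightarrow> snd x > 0"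
  "Seam p u \<in> pruefer_carrier S \<longleftrightarrow> p \<in> S \<and> u \<in> upward_directions"
proof -
  have "Sheet c x = copy_incl d y \<longleftrightarrow> d = c \<and> y = Inner x" for d y by (cases y) auto
  then show "Sheet c x \<in> pruefer_carrier S \<longleftrightarrow> snd x > 0"
    by (auto simp: pruefer_carrier_def image_iff mem_bordered_carrier)
  have "Seam p u = copy_incl d y \<longleftrightarrow> y = Ray p u" for d y by (cases y) auto
  then show "Seam p u \<in> pruefer_carrier S \<longleftrightarrow> p \<in> S \<and> u \<in> upward_directions"
    by (auto simp: pruefer_carrier_def image_iff mem_bordered_carrier)
qed

lemma chart_in_carrier_iff: "chart q z \<in> pruefer_carrier S \<longleftrightarrow> snd z \<noteq> 0 \<or> q \<in> S"
  by (auto simp: chart_def mem_pruefer_carrier sgn_upward)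

lemma chart_in_carrier [simp]: "q \<in> S \<Longrightarrow> chart q z \<in> pruefer_carrier S"
  by (simp add: chart_in_carrier_iff)

lemma pruefer_carrier_cases:
  assumes "y \<in> pruefer_carrier S" "p \<in> S"
  obtains z where "y = chart p z" "snd z \<noteq> 0" | q w where "q \<in> S" "y = chart q (w, 0)"
proof (cases y)
  case (Sheet c x)
  then have "snd x > 0" using assms by (simp add: mem_pruefer_carrier)
  then show thesis using that(1)[of "(inverse (snd x) *\<^sub>R (fst x - p), if c then snd x else - snd x)"]
      chart_height[of x p c] Sheet by (simp split: if_splits)
next
  case (Seam q u)
  then have "q \<in> S" "u \<in> upward_directions" using assms by (simp_all add: mem_pruefer_carrier)
  then show thesis using that(2)[of q "inverse (snd u) *\<^sub>R fst u"] chart_slope[of u q] Seam by simp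
qed

lemma pruefer_carrier_eq: "p \<in> S \<Longrightarrow> pruefer_carrier S = (\<Union>q\<in>S. range (chart q))"
proof (intro equalityI subsetI)
  fix y assume "p \<in> S" "y \<in> pruefer_carrier S"
  then show "y \<in> (\<Union>q\<in>S. range (chart q))" by (elim pruefer_carrier_cases[where p = p]) auto
qed auto

text \<open>The topology coinduced by all charts contains every space \<^term>\<open>pruefer S\<close> as an open
  subspace, which makes the library theory of paths in type class topologies applicable.\<close>

instantiation pruefer_pt :: (euclidean_space) topological_space
begin

definition open_pruefer_pt :: "'a pruefer_pt set \<Rightarrow> bool" where
  "open_pruefer_pt U \<longleftrightarrow> (\<forall>p. open (chart p -` U))"

instance
  by standard (auto simp: open_pruefer_pt_def vimage_Union)

end

section \<open>Charts as homeomorphisms onto open sets\<close>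

lemma continuous_on_chart: "continuous_on A (chart p)"
  by (rule continuous_on_subset[of UNIV])
    (simp_all add: continuous_on_open_vimage open_pruefer_pt_def)

lemma continuous_transition:
  "continuous_on {z. snd z \<noteq> 0} (\<lambda>z::'a::euclidean_space \<times> real. (fst z + inverse \<bar>snd z\<bar> *\<^sub>R (q - p), snd z))"
  by (intro continuous_intros) auto

lemma open_nonzero_height: "open {z::'a::euclidean_space \<times> real. snd z \<noteq> 0}"
  by (intro open_Collect_neq continuous_intros)

text \<open>Charts at different points overlap exactly at nonzero heights. This is an open
  condition, and the transition is continuous there.\<close>

lemma open_chart_image:
  assumes "open W"
  shows "open (chart p ` W)"
  unfolding open_pruefer_pt_def
proof
  fix q
  show "open (chart q -` chart p ` W)"
  proof (cases "q = p")
    case True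
    then show ?thesis using assms by (simp add: inj_vimage_image_eq inj_chart)
  next
    case False
    have "chart q -` chart p ` W =
      {z. snd z \<noteq> 0} \<inter> (\<lambda>z. (fst z + inverse \<bar>snd z\<bar> *\<^sub>R (q - p), snd z)) -` W"
    proof -
      have "chart q z \<in> chart p ` W \<longleftrightarrow> snd z \<noteq> 0 \<and> (fst z + inverse \<bar>snd z\<bar> *\<^sub>R (q - p), snd z) \<in> W" for z
      proof (cases "snd z = 0")
        case True
        then have "chart q z \<notin> range (chart p)" using False by (auto simp: chart_def)
        then show ?thesis using True by blast
      next
        case z: False
        show ?thesis unfolding chart_transition[OF z, of q p] using z by (simp add: inj_image_mem_iff inj_chart)
      qed
      then show ?thesis by blast
    qed
    then show ?thesis
      using continuous_open_preimage[OF continuous_transition open_nonzero_height assms] by simp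
  qed
qed

lemma open_range_chart: "open (range (chart p))"
  by (rule open_chart_image) simp

lemma continuous_on_chart_inv: "continuous_on (range (chart p)) (chart_inv p)"
  unfolding continuous_on_open_vimage[OF open_range_chart]
proof (intro allI impI)
  fix B :: "('a \<times> real) set" assume "open B"
  moreover have "chart_inv p -` B \<inter> range (chart p) = chart p ` B" by auto
  ultimately show "open (chart_inv p -` B \<inter> range (chart p))" by (simp add: open_chart_image)
qed

lemma open_pruefer_carrier: "p \<in> S \<Longrightarrow> open (pruefer_carrier S)"
  unfolding pruefer_carrier_eq by (intro open_UN ballI open_range_chart)

lemma continuous_on_pruefer_carrier:
  fixes f :: "'a::euclidean_space pruefer_pt \<Rightarrow> 'c::topological_space"
  assumes "p \<in> S" "\<And>q. q \<in> S \<Longrightarrow> continuous_on UNIV (f \<circ> chart q)"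
  shows "continuous_on (pruefer_carrier S) f"
  unfolding pruefer_carrier_eq[OF assms(1)]
proof (rule continuous_on_open_UN)
  fix q assume q: "q \<in> S"
  have "continuous_on (range (chart q)) ((f \<circ> chart q) \<circ> chart_inv q)"
    by (rule continuous_on_compose[OF continuous_on_chart_inv continuous_on_subset[OF assms(2)[OF q]]]) simp
  then show "continuous_on (range (chart q)) f"
    by (rule continuous_on_eq) auto
qed (rule open_range_chart)

section \<open>Agreement of the chart topology with the topology given by angles\<close>

lemma vec_angle_small:
  fixes u :: "'b::real_inner"
  assumes "norm u = 1" "d > 0"
  obtains e where "e > 0" "\<And>w. w \<noteq> 0 \<Longrightarrow> vec_angle w u < e \<Longrightarrow> dist (sgn w) u < d"
proof
  \<comment> \<open>Unit vectors at angle a have squared distance 2 - 2 cos a, so a distance below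
    \<open>d\<close> means a cosine above 1 - d^2 / 2. The maximum keeps the argument in the domain
    of \<open>arccos\<close>.\<close>
  define c where "c = max (- 1) (1 - d\<^sup>2 / 2)"
  have c: "-1 \<le> c" "c < 1" using assms(2) by (auto simp: c_def)
  show "arccos c > 0" using arccos_less_arccos[of c 1] c by simp
  fix w assume w: "w \<noteq> 0" "vec_angle w u < arccos c"
  have ns: "norm (sgn w) = 1" using w by (simp add: norm_sgn)
  have le: "\<bar>sgn w \<bullet> u\<bar> \<le> 1" using Cauchy_Schwarz_ineq2[of "sgn w" u] ns assms(1) by simp
  have "arccos (sgn w \<bullet> u) < arccos c"
    using w vec_angle_sgn_left[of w u] ns assms(1) by (simp add: vec_angle_def)
  moreover have "arccos c \<le> arccos (sgn w \<bullet> u)" if "sgn w \<bullet> u \<le> c"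
    using that le c by (intro arccos_le_arccos) auto
  ultimately have "1 - d\<^sup>2 / 2 < sgn w \<bullet> u" unfolding c_def by fastforce
  moreover have "(norm (sgn w - u))\<^sup>2 = 2 - 2 * (sgn w \<bullet> u)"
    using ns assms(1) by (simp add: power2_norm_eq_inner inner_diff inner_commute norm_eq_1)
  ultimately have "(norm (sgn w - u))\<^sup>2 < d\<^sup>2" by linarith
  then show "dist (sgn w) u < d"
    using assms(2) power_less_imp_less_base[of "norm (sgn w - u)" 2 d] by (simp add: dist_norm)
qed

lemma continuous_on_vec_angle:
  fixes u :: "'b::real_inner"
  assumes "norm u = 1"
  shows "continuous_on {v. v \<noteq> 0} (\<lambda>v. vec_angle v u)"
proof -
  have "-1 \<le> v \<bullet> u / (norm v * norm u) \<and> v \<bullet> u / (norm v * norm u) \<le> 1" if "v \<noteq> 0" for v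
    using Cauchy_Schwarz_ineq2[of v u] that assms by (auto simp: field_simps abs_le_iff)
  then show ?thesis
    unfolding vec_angle_def using assms by (intro continuous_intros) auto
qed

lemma vec_angle_scaleR_left: "c > 0 \<Longrightarrow> vec_angle (c *\<^sub>R v) u = vec_angle v u"
  using vec_angle_sgn_left[of "c *\<^sub>R v" u] vec_angle_sgn_left[of v u] by (simp add: sgn_scaleR)

lemma open_chart_vimage_if_openin:
  assumes U: "openin (pruefer S) U" and p: "p \<in> S"
  shows "open (chart p -` U)"
proof (subst open_subopen, intro ballI)
  define B where "B c = {y \<in> bordered_carrier S. copy_incl c y \<in> U}" for c
  have B: "openin (bordered_pruefer S) (B c)" for c
    using U unfolding openin_pruefer B_def by blast
  then have Bo: "open {x. Inner x \<in> B c}" for c unfolding openin_bordered_pruefer by blast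
  fix z assume z: "z \<in> chart p -` U"
  show "\<exists>T. open T \<and> z \<in> T \<and> T \<subseteq> chart p -` U"
  proof (cases "snd z = 0")
    case False
    define c where "c \<longleftrightarrow> snd z > 0"
    let ?f = "\<lambda>z::'a \<times> real. (p + \<bar>snd z\<bar> *\<^sub>R fst z, \<bar>snd z\<bar>)"
    let ?T = "{z. (if c then snd z else - snd z) > 0} \<inter> ?f -` {x. Inner x \<in> B c}"
    have "open ?T"
      by (intro open_Int open_vimage[OF Bo] continuous_intros open_Collect_less) (cases c; simp add: continuous_intros)
    moreover have "z \<in> ?T"
      using z False by (auto simp: B_def c_def chart_def bordered_carrier_def upper_half_space_def)
    moreover have "?T \<subseteq> chart p -` U"
      by (auto simp: B_def chart_def split: if_splits)
    ultimately show ?thesis by blast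
  next
    case True
    define u where "u = sgn (fst z, 1::real)"
    have u: "u \<in> upward_directions" unfolding u_def by (rule sgn_upward)
    then have nu: "norm u = 1" by (simp add: upward_directions_def)
    have "Ray p u \<in> B c" for c
      using z True u p by (simp add: B_def chart_def mem_bordered_carrier u_def)
    then have "\<exists>\<epsilon>>0. ray_nbhd p u \<epsilon> \<subseteq> B c" for c using B unfolding openin_bordered_pruefer by blast
    then obtain E where E: "\<And>c. E c > 0" "\<And>c. ray_nbhd p u (E c) \<subseteq> B c" by metis
    \<comment> \<open>One radius for both copies, as a neighbourhood of a seam point extends into
      each of them.\<close>
    define \<epsilon> where "\<epsilon> = min (E True) (E False)"
    have \<epsilon>: "\<epsilon> > 0" "ray_nbhd p u \<epsilon> \<subseteq> B c" for c
      using E(1)[of True] E(1)[of False] E(2)[of c] ray_nbhd_mono[of \<epsilon> "E c" p u]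
      by (auto simp: \<epsilon>_def) (cases c; auto)
    \<comment> \<open>In this chart a point differs from \<open>(p, 0)\<close> by its height times
      (slope, 1), so these are the angle and distance conditions of \<open>ray_nbhd\<close>.\<close>
    let ?T = "{y::'a \<times> real. vec_angle (fst y, 1) u < \<epsilon>} \<inter> {y. \<bar>snd y\<bar> * norm (fst y, 1::real) < \<epsilon>}"
    have "open ?T"
    proof (intro open_Int open_Collect_less continuous_intros)
      show "continuous_on UNIV (\<lambda>y::'a \<times> real. vec_angle (fst y, 1) u)"
        by (rule continuous_on_compose2[OF continuous_on_vec_angle[OF nu]]) (auto intro!: continuous_intros simp: zero_prod_def)
    qed
    moreover have "z \<in> ?T"
    proof -
      have "vec_angle u u = 0" using nu by (simp add: vec_angle_def flip: power2_norm_eq_inner)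
      then have "vec_angle (fst z, 1) u = 0" using vec_angle_sgn_left[of "(fst z, 1)" u] by (simp add: u_def)
      then show ?thesis using \<epsilon>(1) True by simp
    qed
    moreover have "y \<in> chart p -` U" if y: "y \<in> ?T" for y
    proof (cases "snd y = 0")
      case True
      have "vec_angle (sgn (fst y, 1)) u < \<epsilon>" using y vec_angle_sgn_left[of "(fst y, 1)" u] by simp
      then have "Ray p (sgn (fst y, 1)) \<in> ray_nbhd p u \<epsilon>"
        unfolding ray_nbhd_def using sgn_upward[of "fst y"] by blast
      then have "Ray p (sgn (fst y, 1)) \<in> B False" using \<epsilon>(2) by blast
      then show ?thesis using True by (simp add: B_def chart_def)
    next
      case False
      let ?x = "(p + \<bar>snd y\<bar> *\<^sub>R fst y, \<bar>snd y\<bar>)"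
      have x: "?x - (p, 0) = \<bar>snd y\<bar> *\<^sub>R (fst y, 1)" by simp
      have "norm (?x - (p, 0)) < \<epsilon>" unfolding x norm_scaleR using y by simp
      moreover have "vec_angle (?x - (p, 0)) u < \<epsilon>"
        unfolding x using y False by (subst vec_angle_scaleR_left) auto
      ultimately have "Inner ?x \<in> ray_nbhd p u \<epsilon>"
        using False unfolding ray_nbhd_def upper_half_space_def by simp
      then have "Inner ?x \<in> B (snd y > 0)" using \<epsilon>(2) by blast
      then show ?thesis using False by (simp add: B_def chart_def)
    qed
    ultimately show ?thesis by blast
  qed
qed

lemma openin_if_open_chart_vimage:
  assumes US: "U \<subseteq> pruefer_carrier S" and "S \<noteq> {}" and U: "\<And>p. p \<in> S \<Longrightarrow> open (chart p -` U)"
  shows "openin (pruefer S) U"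
  unfolding openin_pruefer openin_bordered_pruefer
proof (intro conjI allI impI US)
  fix c
  let ?B = "{y \<in> bordered_carrier S. copy_incl c y \<in> U}"
  show "?B \<subseteq> bordered_carrier S" by blast
  obtain p where p: "p \<in> S" using assms(2) by blast
  let ?g = "\<lambda>x::'a \<times> real. (inverse (snd x) *\<^sub>R (fst x - p), if c then snd x else - snd x)"
  have "continuous_on {x. 0 < snd x} ?g"
    by (cases c; simp; intro continuous_intros; auto)
  then have "open ({x. 0 < snd x} \<inter> ?g -` (chart p -` U))"
    by (rule continuous_open_preimage[OF _ _ U[OF p]]) (intro open_Collect_less continuous_intros)
  moreover have "{x. Inner x \<in> ?B} = {x. 0 < snd x} \<inter> ?g -` (chart p -` U)"
    using chart_height[of _ p c] by (auto simp: mem_bordered_carrier)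
  ultimately show "open {x. Inner x \<in> ?B}" by simp
next
  fix c p u
  let ?B = "{y \<in> bordered_carrier S. copy_incl c y \<in> U}"
  let ?s = "\<lambda>v::'a \<times> real. inverse (snd v) *\<^sub>R fst v"
  assume "Ray p u \<in> ?B"
  then have p: "p \<in> S" and u: "u \<in> upward_directions" and "Seam p u \<in> U"
    by (auto simp: mem_bordered_carrier)
  then have "(?s u, 0) \<in> chart p -` U" by (simp add: chart_slope)
  then obtain d where d: "d > 0" "ball (?s u, 0) d \<subseteq> chart p -` U"
    using U[OF p] open_contains_ball by blast
  have u': "norm u = 1" "snd u > 0" using u by (auto simp: upward_directions_def)
  have "isCont ?s u" using u' by (intro continuous_intros) auto
  then obtain d' where d': "d' > 0" "\<And>v. dist v u < d' \<Longrightarrow> dist (?s v) (?s u) < d / 2"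
    unfolding continuous_at_eps_delta using d(1) half_gt_zero by metis
  obtain e where e: "e > 0" "\<And>w. w \<noteq> 0 \<Longrightarrow> vec_angle w u < e \<Longrightarrow> dist (sgn w) u < d'"
    using vec_angle_small[OF u'(1) d'(1)] by metis
  \<comment> \<open>Slopes are invariant under positive scaling, so a small angle controls the
    slope. The height is controlled separately, and each of the two gets half of
    \<open>d\<close>.\<close>
  have key: "chart p (?s v, h) \<in> U" if "v \<noteq> 0" "vec_angle v u < e" "\<bar>h\<bar> < d / 2" for v h
  proof -
    have "?s (sgn v) = ?s v" using that(1) by (simp add: sgn_div_norm)
    then have "dist (?s v) (?s u) < d / 2" using d'(2)[OF e(2)[OF that(1,2)]] by simp
    then have "dist (?s u, 0) (?s v, h) < d"
      using that(3) sqrt_sum_squares_le_sum_abs[of "dist (?s u) (?s v)" "dist 0 h"]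
      by (simp add: dist_Pair_Pair dist_commute dist_real_def)
    then show ?thesis using d(2) by auto
  qed
  have "ray_nbhd p u (min e (d / 2)) \<subseteq> ?B"
  proof
    fix y assume "y \<in> ray_nbhd p u (min e (d / 2))"
    then consider v where "y = Ray p v" "v \<in> upward_directions" "vec_angle v u < e"
      | x where "y = Inner x" "x \<in> upper_half_space" "norm (x - (p, 0)) < d / 2" "vec_angle (x - (p, 0)) u < e"
      by (auto simp: ray_nbhd_def)
    then show "y \<in> ?B"
    proof cases
      case 1
      then have "v \<noteq> 0" by (auto simp: upward_directions_def)
      then have "chart p (?s v, 0) \<in> U" using key[of v 0] 1 d(1) by simp
      then show ?thesis using 1 p by (simp add: chart_slope mem_bordered_carrier)
    next
      case 2
      have x: "snd x > 0" using 2 by (simp add: upper_half_space_def)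
      have "\<bar>snd x\<bar> < d / 2" using 2(3) norm_snd_le[of "snd x" "fst x - p"] by (cases x) simp
      moreover have "x - (p, 0) \<noteq> 0" using x by auto
      ultimately have "chart p (?s (x - (p, 0)), if c then snd x else - snd x) \<in> U"
        using key[of "x - (p, 0)" "if c then snd x else - snd x"] 2(4) by simp
      then show ?thesis using 2 x chart_height[OF x, of p c] by (simp add: mem_bordered_carrier)
    qed
  qed
  then show "\<exists>\<epsilon>>0. ray_nbhd p u \<epsilon> \<subseteq> ?B" using e(1) d(1) by (intro exI[of _ "min e (d / 2)"]) simp
qed

lemma pruefer_eq:
  assumes "p \<in> S"
  shows "pruefer S = top_of_set (pruefer_carrier S)"
proof -
  have "openin (pruefer S) U \<longleftrightarrow> U \<subseteq> pruefer_carrier S \<and> open U" for U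
  proof
    assume U: "openin (pruefer S) U"
    have sub: "U \<subseteq> pruefer_carrier S" using openin_subset[OF U] by simp
    have "open (chart q -` U)" for q
    proof (cases "q \<in> S")
      case True
      then show ?thesis using U by (rule open_chart_vimage_if_openin[rotated])
    next
      case False
      \<comment> \<open>A chart at a point outside \<open>S\<close> meets \<open>U\<close> in the
        two sheets only, and there the chart at \<open>p\<close> sees the same points.\<close>
      have "chart q -` U = {z. snd z \<noteq> 0} \<inter> (\<lambda>z. (fst z + inverse \<bar>snd z\<bar> *\<^sub>R (q - p), snd z)) -` (chart p -` U)"
      proof -
        have "chart q z \<in> U \<longleftrightarrow> snd z \<noteq> 0 \<and> chart p (fst z + inverse \<bar>snd z\<bar> *\<^sub>R (q - p), snd z) \<in> U" for z
        proof (cases "snd z = 0")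
          case True
          then have "chart q z \<notin> pruefer_carrier S" using False by (simp add: chart_in_carrier_iff)
          then show ?thesis using True sub by blast
        next
          case z: False
          then show ?thesis using chart_transition[OF z, of q p] by simp
        qed
        then show ?thesis by blast
      qed
      then show ?thesis
        using continuous_open_preimage[OF continuous_transition open_nonzero_height open_chart_vimage_if_openin[OF U assms]]
        by simp
    qed
    then show "U \<subseteq> pruefer_carrier S \<and> open U" using sub by (simp add: open_pruefer_pt_def)
  next
    assume "U \<subseteq> pruefer_carrier S \<and> open U"
    then show "openin (pruefer S) U"
      using assms by (intro openin_if_open_chart_vimage) (auto simp: open_pruefer_pt_def)
  qed
  then show ?thesis
    unfolding topology_eq by (simp add: openin_open_eq[OF open_pruefer_carrier[OF assms]] conj_commute)
qed

section \<open>The generating loops in the charts\<close>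

lemma cos_pi_pos: "0 \<le> t \<Longrightarrow> t < 1/2 \<Longrightarrow> cos (pi * t) > 0"
  by (rule cos_gt_zero_pi) (auto intro: order.strict_trans2[of _ 0])

lemma cos_pi_neg: "1/2 < t \<Longrightarrow> t \<le> 1 \<Longrightarrow> cos (pi * t) < 0"
  using cos_monotone_0_pi[of "pi / 2" "pi * t"] by simp

lemma sin_pi_pos: "0 < t \<Longrightarrow> t < 1 \<Longrightarrow> sin (pi * t) > 0"
  by (rule sin_gt_zero) auto

text \<open>By the double angle formulas, \<alpha> at time t lies over p + sin^2 (q - p) at height
  sin |cos| |q - p|, all at the angle pi t. Dividing the displacement from \<open>p\<close> by the
  height gives this slope, of norm |tan|. The signed height is negative on the first half, which
  runs in the first copy. In \<open>far_coord\<close> the slope is taken from \<open>q\<close> and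
  has norm |cot|.\<close>

definition near_coord :: "'a::euclidean_space \<Rightarrow> 'a \<Rightarrow> real \<Rightarrow> 'a \<times> real" where
  "near_coord p q t = ((sin (pi * t) / (\<bar>cos (pi * t)\<bar> * dist p q)) *\<^sub>R (q - p),
     - sin (pi * t) * cos (pi * t) * dist p q)"

definition far_coord :: "'a::euclidean_space \<Rightarrow> 'a \<Rightarrow> real \<Rightarrow> 'a \<times> real" where
  "far_coord p q t = ((\<bar>cos (pi * t)\<bar> / (sin (pi * t) * dist p q)) *\<^sub>R (p - q),
     - sin (pi * t) * cos (pi * t) * dist p q)"

lemma alpha_inside:
  assumes "0 < t" "t < 1" "t \<noteq> 1/2"
  shows "alpha p q t = Sheet (1/2 < t) (p + (sin (pi * t))\<^sup>2 *\<^sub>R (q - p), sin (pi * t) * \<bar>cos (pi * t)\<bar> * dist p q)"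
proof -
  have s2: "sin (pi * (2 * t)) = 2 * sin (pi * t) * cos (pi * t)"
    using sin_double[of "pi * t"] by (simp add: mult.left_commute)
  have c2: "cos (pi * (2 * t)) = 1 - 2 * (sin (pi * t))\<^sup>2"
    using cos_double_sin[of "pi * t"] by (simp add: mult.left_commute)
  have mid: "midpoint p q - ((1 - 2 * (sin (pi * t))\<^sup>2) / 2) *\<^sub>R (q - p) = p + (sin (pi * t))\<^sup>2 *\<^sub>R (q - p)"
  proof -
    have "midpoint p q = p + (1 / 2) *\<^sub>R (q - p)"
      by (simp add: midpoint_def algebra_simps flip: scaleR_left_distrib)
    moreover have "((1 - 2 * (sin (pi * t))\<^sup>2) / 2) *\<^sub>R (q - p) = (1 / 2) *\<^sub>R (q - p) - (sin (pi * t))\<^sup>2 *\<^sub>R (q - p)"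
      by (simp add: diff_divide_distrib flip: scaleR_left_diff_distrib)
    ultimately show ?thesis by simp
  qed
  show ?thesis
  proof (cases "t < 1/2")
    case True
    then show ?thesis
      using assms cos_pi_pos[of t] by (simp add: alpha_def semicircle_def s2 c2 mid)
  next
    case False
    have p2: "pi * (2 - 2 * t) = 2 * pi - pi * (2 * t)" by (simp add: algebra_simps)
    show ?thesis
      using assms False cos_pi_neg[of t]
      by (simp add: alpha_def semicircle_def p2 sin_diff cos_diff s2 c2 mid)
  qed
qed

lemma alpha_ends: "alpha p q 0 = Seam p vertical" "alpha p q (1/2) = Seam q vertical" "alpha p q 1 = Seam p vertical"
  by (simp_all add: alpha_def semicircle_def)

lemma chart_vertical: "chart p (0, 0) = Seam p vertical"
  by (simp add: chart_def sgn_div_norm norm_Pair)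

lemma sgn_height: "0 < t \<Longrightarrow> t < 1/2 \<Longrightarrow> d > 0 \<Longrightarrow> - sin (pi * t) * cos (pi * t) * d < 0"
  "1/2 < t \<Longrightarrow> t < 1 \<Longrightarrow> d > 0 \<Longrightarrow> - sin (pi * t) * cos (pi * t) * d > 0"
  using sin_pi_pos[of t] cos_pi_pos[of t] cos_pi_neg[of t] by (auto simp: mult_less_0_iff zero_less_mult_iff)

lemma height_pos_iff:
  assumes "0 < t" "t < 1" "t \<noteq> 1/2" "d > 0"
  shows "- sin (pi * t) * cos (pi * t) * d > 0 \<longleftrightarrow> 1/2 < t" "- sin (pi * t) * cos (pi * t) * d \<noteq> 0"
proof -
  consider "t < 1/2" | "1/2 < t" using assms(3) by linarith
  then have "(- sin (pi * t) * cos (pi * t) * d > 0 \<longleftrightarrow> 1/2 < t) \<and> - sin (pi * t) * cos (pi * t) * d \<noteq> 0"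
  proof cases
    case 1
    then show ?thesis using sgn_height(1)[OF assms(1) _ assms(4)] by linarith
  next
    case 2
    then show ?thesis using sgn_height(2)[OF _ assms(2,4)] by linarith
  qed
  then show "- sin (pi * t) * cos (pi * t) * d > 0 \<longleftrightarrow> 1/2 < t" "- sin (pi * t) * cos (pi * t) * d \<noteq> 0"
    by blast+
qed

lemma alpha_near:
  assumes "t \<in> {0..1}" "t \<noteq> 1/2" "p \<noteq> q"
  shows "alpha p q t = chart p (near_coord p q t)"
proof -
  consider "t = 0" | "t = 1" | "0 < t" "t < 1" using assms by fastforce
  then show ?thesis
  proof cases
    case 3
    let ?s = "sin (pi * t)" and ?c = "cos (pi * t)"
    have s: "?s > 0" using 3 by (rule sin_pi_pos)
    have c: "?c \<noteq> 0" using cos_pi_pos[of t] cos_pi_neg[of t] 3 assms by fastforce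
    have d: "dist p q > 0" using assms by simp
    have abs: "\<bar>- ?s * ?c * dist p q\<bar> = ?s * \<bar>?c\<bar> * dist p q" using s by (simp add: abs_mult)
    have "(?s * \<bar>?c\<bar> * dist p q) * (?s / (\<bar>?c\<bar> * dist p q)) = ?s\<^sup>2"
      using c d by (simp add: power2_eq_square)
    moreover note height_pos_iff[OF 3 assms(2) d]
    ultimately show ?thesis
      unfolding alpha_inside[OF 3 assms(2)] chart_def near_coord_def snd_conv fst_conv abs by simp
  qed (simp_all add: alpha_ends near_coord_def flip: chart_vertical)
qed

lemma alpha_far:
  assumes "0 < t" "t < 1" "p \<noteq> q"
  shows "alpha p q t = chart q (far_coord p q t)"
proof (cases "t = 1/2")
  case True
  then show ?thesis using alpha_ends(2)[of p q] by (simp only: far_coord_def) (simp add: chart_vertical)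
next
  case False
  let ?s = "sin (pi * t)" and ?c = "cos (pi * t)"
  have s: "?s > 0" using assms by (intro sin_pi_pos)
  have d: "dist p q > 0" using assms by simp
  have abs: "\<bar>- ?s * ?c * dist p q\<bar> = ?s * \<bar>?c\<bar> * dist p q" using s by (simp add: abs_mult)
  have "(?s * \<bar>?c\<bar> * dist p q) * (\<bar>?c\<bar> / (?s * dist p q)) = \<bar>?c\<bar>\<^sup>2"
    using s d unfolding power2_eq_square by (simp del: abs_mult_self_eq)
  then have "(?s * \<bar>?c\<bar> * dist p q) * (\<bar>?c\<bar> / (?s * dist p q)) = 1 - ?s\<^sup>2"
    by (simp add: cos_squared_eq)
  moreover note height_pos_iff[OF assms(1,2) False d]
  moreover have "p + ?s\<^sup>2 *\<^sub>R (q - p) = q + (1 - ?s\<^sup>2) *\<^sub>R (p - q)" by (simp add: algebra_simps)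
  ultimately show ?thesis
    unfolding alpha_inside[OF assms(1,2) False] chart_def far_coord_def snd_conv fst_conv abs by simp
qed

lemma continuous_on_near_coord:
  assumes "A \<subseteq> {0..1} - {1/2}"
  shows "continuous_on A (near_coord p q)"
proof -
  have "cos (pi * t) \<noteq> 0" if "t \<in> A" for t
    using cos_pi_pos[of t] cos_pi_neg[of t] that assms by fastforce
  then show ?thesis
    by (cases "p = q") (auto simp: near_coord_def[abs_def] intro!: continuous_intros)
qed

lemma continuous_on_far_coord:
  assumes "A \<subseteq> {0<..<1}"
  shows "continuous_on A (far_coord p q)"
proof -
  have "sin (pi * t) \<noteq> 0" if "t \<in> A" for t
    using sin_pi_pos[of t] that assms by fastforce
  then show ?thesis
    by (cases "p = q") (auto simp: far_coord_def[abs_def] intro!: continuous_intros)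
qed

text \<open>Made for \<alpha>: the outer pieces use the coordinates at the first point, singular at
  time 1/2, and the middle piece those at the second point, singular at times 0 and 1. The
  breakpoints 1/4 and 3/4 stay clear of all three.\<close>

lemma continuous_on_thirds:
  fixes f1 :: "real \<Rightarrow> 'c::topological_space"
  assumes "continuous_on {0..1/4} f1" "continuous_on {1/4..3/4} f2" "continuous_on {3/4..1} f3"
    and "f1 (1/4) = f2 (1/4)" "f2 (3/4) = f3 (3/4)"
  shows "continuous_on {0..1} (\<lambda>t. if t \<le> 1/4 then f1 t else if t \<le> 3/4 then f2 t else f3 t)"
proof (rule continuous_on_cases_le)
  show "continuous_on {t \<in> {0..1}. t \<le> 1/4} f1"
    using assms(1) by (rule continuous_on_subset) auto
  show "continuous_on {t \<in> {0..1}. 1/4 \<le> t} (\<lambda>t. if t \<le> 3/4 then f2 t else f3 t)"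
  proof (rule continuous_on_cases_le)
    show "continuous_on {t \<in> {t \<in> {0..1}. 1/4 \<le> t}. t \<le> 3/4} f2"
      using assms(2) by (rule continuous_on_subset) auto
    show "continuous_on {t \<in> {t \<in> {0..1}. 1/4 \<le> t}. 3/4 \<le> t} f3"
      using assms(3) by (rule continuous_on_subset) auto
    show "f2 t = f3 t" if "t = 3/4" for t unfolding that by (rule assms(5))
  qed (use assms in auto)
  show "f1 t = (if t \<le> 3/4 then f2 t else f3 t)" if "t = 1/4" for t unfolding that by (simp add: assms(4))
qed (use assms in auto)

lemma path_alpha:
  assumes "p \<noteq> q"
  shows "path (alpha p q)"
proof -
  have "continuous_on {0..1} (\<lambda>t. if t \<le> 1/4 then chart p (near_coord p q t)
      else if t \<le> 3/4 then chart q (far_coord p q t) else chart p (near_coord p q t))"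
  proof (rule continuous_on_thirds)
    show "continuous_on {1/4..3/4} (\<lambda>t. chart q (far_coord p q t))"
      by (rule continuous_on_compose2[OF continuous_on_chart[of UNIV] continuous_on_far_coord]) auto
  qed (use assms in \<open>auto simp: alpha_near[symmetric] alpha_far[symmetric]
      intro!: continuous_on_compose2[OF continuous_on_chart[of UNIV] continuous_on_near_coord]\<close>)
  then show ?thesis
    unfolding path_def by (rule continuous_on_eq) (use assms in \<open>auto simp: alpha_near alpha_far\<close>)
qed

lemma alpha_loop:
  assumes "p \<noteq> q" "p \<in> S" "q \<in> S"
  shows "alpha p q \<in> loops_at (pruefer_carrier S) (Seam p vertical)"
proof -
  have "alpha p q t \<in> pruefer_carrier S" if "t \<in> {0..1}" for t
  proof (cases "t = 1/2")
    case True
    show ?thesis unfolding True alpha_far[of "1/2" p q, simplified, OF assms(1)] using assms(3) by simp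
  next
    case False
    then show ?thesis using alpha_near[OF that False assms(1)] assms(2) by simp
  qed
  then show ?thesis
    using path_alpha[OF assms(1)] alpha_ends[of p q]
    by (auto simp: mem_loops_at path_image_def pathstart_def pathfinish_def)
qed

abbreviation transition :: "'a::euclidean_space \<Rightarrow> 'a \<Rightarrow> 'a \<times> real \<Rightarrow> 'a \<times> real" where
  "transition p q z \<equiv> (fst z + inverse \<bar>snd z\<bar> *\<^sub>R (q - p), snd z)"

text \<open>Both sides are coordinates of the same point of \<alpha> in the chart at
  \<open>p\<close>, and charts are injective.\<close>

lemma transition_far_coord:
  assumes "0 < t" "t < 1" "t \<noteq> 1/2" "p \<noteq> q"
  shows "transition p q (far_coord p q t) = near_coord p q t"
proof -
  have "snd (far_coord p q t) \<noteq> 0"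
    using sgn_height[of t "dist p q"] assms by (cases "t < 1/2") (auto simp: far_coord_def)
  then have "chart p (transition p q (far_coord p q t)) = chart p (near_coord p q t)"
    using chart_transition[of "far_coord p q t" q p] alpha_near[of t p q] alpha_far[of t p q] assms by simp
  then show ?thesis using inj_chart[of p] by (simp add: inj_eq)
qed


section \<open>Lifts over the charts\<close>

lemma cis_lifts_differ_by_int:
  fixes f g :: "'b::topological_space \<Rightarrow> real"
  assumes "connected A" "continuous_on A f" "continuous_on A g"
    and "\<And>x. x \<in> A \<Longrightarrow> cis (2 * pi * f x) = cis (2 * pi * g x)"
  obtains m :: int where "\<And>x. x \<in> A \<Longrightarrow> f x = g x + m"
proof -
  have int: "f x - g x \<in> \<int>" if "x \<in> A" for x
  proof -
    have "cis (2 * pi * (f x - g x)) = 1"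
      using assms(4)[OF that] by (simp add: right_diff_distrib flip: cis_divide)
    then obtain n :: int where "f x - g x = n" by (rule cis_2pi_eq_1_int)
    then show ?thesis by simp
  qed
  have "(\<lambda>x. f x - g x) constant_on A"
  proof (rule continuous_discrete_range_constant[OF assms(1)])
    show "continuous_on A (\<lambda>x. f x - g x)" using assms(2,3) by (intro continuous_intros)
    fix x assume x: "x \<in> A"
    have "1 \<le> norm (f y - g y - (f x - g x))" if "y \<in> A" "f y - g y \<noteq> f x - g x" for y
      using int[OF x] int[OF that(1)] that(2) by (auto elim!: Ints_cases simp flip: of_int_diff)
    then show "\<exists>e>0. \<forall>y. y \<in> A \<and> f y - g y \<noteq> f x - g x \<longrightarrow> e \<le> norm (f y - g y - (f x - g x))"
      by (intro exI[of _ 1]) auto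
  qed
  then obtain c where c: "\<And>x. x \<in> A \<Longrightarrow> f x - g x = c" unfolding constant_on_def by blast
  show thesis
  proof (cases "A = {}")
    case True
    then show thesis using that by blast
  next
    case False
    then obtain m :: int where "c = m" using c int by (metis Ints_cases ex_in_conv)
    then show thesis using that[of m] c by (simp add: algebra_simps)
  qed
qed

lemma chart_lifts:
  fixes S :: "'a::euclidean_space set"
  assumes g: "circle_map (pruefer_carrier S) g" and p0: "p0 \<in> S"
  obtains G :: "'a \<Rightarrow> 'a \<times> real \<Rightarrow> real" and k :: "'a \<Rightarrow> int"
  where "\<And>p. p \<in> S \<Longrightarrow> continuous_on UNIV (G p)"
    "\<And>p z. p \<in> S \<Longrightarrow> g (chart p z) = cis (2 * pi * G p z)"
    "\<And>p z. p \<in> S \<Longrightarrow> snd z < 0 \<Longrightarrow> G p z = G p0 (transition p0 p z)"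
    "\<And>p z. p \<in> S \<Longrightarrow> snd z > 0 \<Longrightarrow> G p z = G p0 (transition p0 p z) + k p"
proof -
  have "\<exists>L. continuous_on UNIV L \<and> (\<forall>z. g (chart p z) = cis (2 * pi * L z))" if p: "p \<in> S" for p
  proof (rule circle_lift[of UNIV "g \<circ> chart p"])
    show "continuous_on UNIV (g \<circ> chart p)"
      using g p unfolding circle_map_iff
      by (intro continuous_on_compose continuous_on_chart) (auto intro: continuous_on_subset)
    show "g \<circ> chart p \<in> UNIV \<rightarrow> sphere 0 1" using g p by (auto simp: circle_map_iff Pi_iff)
  qed (auto intro: convex_imp_contractible)
  then obtain L where L: "\<And>p. p \<in> S \<Longrightarrow> continuous_on UNIV (L p)"
      "\<And>p z. p \<in> S \<Longrightarrow> g (chart p z) = cis (2 * pi * L p z)"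
    by metis
  have diff: "\<exists>m::int. \<forall>z\<in>A. L p z = L p0 (transition p0 p z) + m"
    if p: "p \<in> S" and A: "connected A" "A \<subseteq> {z. snd z \<noteq> 0}" for p A
  proof (rule cis_lifts_differ_by_int[OF A(1), of "L p" "\<lambda>z. L p0 (transition p0 p z)"])
    show "continuous_on A (L p)" using L(1)[OF p] by (rule continuous_on_subset) simp
    show "continuous_on A (\<lambda>z. L p0 (transition p0 p z))"
      by (rule continuous_on_compose2[OF L(1)[OF p0] continuous_on_subset[OF continuous_transition A(2)]]) simp
    fix z assume "z \<in> A"
    then have "chart p z = chart p0 (transition p0 p z)" using A(2) by (intro chart_transition) auto
    then show "cis (2 * pi * L p z) = cis (2 * pi * L p0 (transition p0 p z))"
      using L(2)[OF p] L(2)[OF p0] by metis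
  qed blast
  have conn: "connected (UNIV \<times> {..<0} :: ('a \<times> real) set)" "connected (UNIV \<times> {0<..} :: ('a \<times> real) set)"
    by (simp_all add: connected_Times connected_Iio connected_Ioi convex_connected)
  have "\<exists>m::int. \<forall>z. snd z < 0 \<longrightarrow> L p z = L p0 (transition p0 p z) + m"
    "\<exists>m::int. \<forall>z. snd z > 0 \<longrightarrow> L p z = L p0 (transition p0 p z) + m" if "p \<in> S" for p
  proof -
    have "\<exists>m::int. \<forall>z\<in>UNIV \<times> {..<0}. L p z = L p0 (transition p0 p z) + m"
      by (rule diff[OF that conn(1)]) auto
    then show "\<exists>m::int. \<forall>z. snd z < 0 \<longrightarrow> L p z = L p0 (transition p0 p z) + m"
      by (simp only: Ball_def mem_Times_iff UNIV_I lessThan_iff simp_thms)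
    have "\<exists>m::int. \<forall>z\<in>UNIV \<times> {0<..}. L p z = L p0 (transition p0 p z) + m"
      by (rule diff[OF that conn(2)]) auto
    then show "\<exists>m::int. \<forall>z. snd z > 0 \<longrightarrow> L p z = L p0 (transition p0 p z) + m"
      by (simp only: Ball_def mem_Times_iff UNIV_I greaterThan_iff simp_thms)
  qed
  then obtain a b :: "'a \<Rightarrow> int" where a: "\<And>p z. p \<in> S \<Longrightarrow> snd z < 0 \<Longrightarrow> L p z = L p0 (transition p0 p z) + a p"
    and b: "\<And>p z. p \<in> S \<Longrightarrow> snd z > 0 \<Longrightarrow> L p z = L p0 (transition p0 p z) + b p"
    by metis
  \<comment> \<open>The transition from \<open>p0\<close> to itself is the identity, so the
    normalisation leaves the reference lift at \<open>p0\<close> as it is.\<close>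
  have a0: "a p0 = 0" using a[OF p0, of "(0, -1)"] by simp
  show thesis
  proof (rule that[of "\<lambda>p z. L p z - a p" "\<lambda>p. b p - a p"])
    show "continuous_on UNIV (\<lambda>z. L p z - a p)" if "p \<in> S" for p
      using L(1)[OF that] by (intro continuous_intros)
    show "g (chart p z) = cis (2 * pi * (L p z - a p))" if "p \<in> S" for p z
    proof -
      have "cis (2 * pi * a p) = 1" by (simp add: cis_multiple_2pi)
      then show ?thesis using L(2)[OF that] by (simp add: right_diff_distrib flip: cis_divide)
    qed
  qed (simp_all add: a b a0)
qed

text \<open>A lift along \<alpha> starts in the chart at \<open>p0\<close>, changes to the chart at
  \<open>p\<close> on the first sheet, where the two lifts agree, and changes back on the second,
  where it has to add \<open>k\<close> to stay continuous. Both ends of \<alpha> have coordinates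
  \<open>(0, 0)\<close> at \<open>p0\<close>, so the total increment is \<open>k\<close>.\<close>

lemma circle_index_alpha:
  assumes p: "p \<in> S" "p0 \<in> S" "p \<noteq> p0"
    and "\<And>p. p \<in> S \<Longrightarrow> continuous_on UNIV (G p)"
    "\<And>p z. p \<in> S \<Longrightarrow> g (chart p z) = cis (2 * pi * G p z)"
    "\<And>z. snd z < 0 \<Longrightarrow> G p z = G p0 (transition p0 p z)"
    "\<And>z. snd z > 0 \<Longrightarrow> G p z = G p0 (transition p0 p z) + real_of_int k"
  shows "circle_index (g \<circ> alpha p0 p) = k"
proof -
  let ?n = "near_coord p0 p" and ?f = "far_coord p0 p"
  define L where "L t = (if t \<le> 1/4 then G p0 (?n t) else if t \<le> 3/4 then G p (?f t) else G p0 (?n t) + k)" for t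
  have d: "dist p0 p > 0" using p by simp
  have before: "G p (?f t) = G p0 (?n t)" if "0 < t" "t < 1/2" for t
    using assms(6)[of "?f t"] transition_far_coord[of t p0 p] that p sgn_height(1)[OF that d]
    by (simp add: far_coord_def)
  have after: "G p (?f t) = G p0 (?n t) + k" if "1/2 < t" "t < 1" for t
    using assms(7)[of "?f t"] transition_far_coord[of t p0 p] that p sgn_height(2)[OF that d]
    by (simp add: far_coord_def)
  have "continuous_on {0..1} L"
    unfolding L_def
  proof (rule continuous_on_thirds)
    show "continuous_on {0..1/4} (\<lambda>t. G p0 (?n t))" "continuous_on {3/4..1} (\<lambda>t. G p0 (?n t) + k)"
      by (intro continuous_intros continuous_on_compose2[OF assms(4)[OF p(2)] continuous_on_near_coord]; auto)+
    show "continuous_on {1/4..3/4} (\<lambda>t. G p (?f t))"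
      by (rule continuous_on_compose2[OF assms(4)[OF p(1)] continuous_on_far_coord]) auto
  qed (use before[of "1/4"] after[of "3/4"] in auto)
  moreover have "(g \<circ> alpha p0 p) t = cis (2 * pi * L t)" if t: "t \<in> {0..1}" for t
  proof -
    have k: "cis (2 * pi * k) = 1" by (simp add: cis_multiple_2pi)
    consider "t \<le> 1/4" | "1/4 < t" "t \<le> 3/4" | "3/4 < t" by linarith
    then show ?thesis
    proof cases
      case 2
      then show ?thesis using alpha_far[of t p0 p] p assms(5)[OF p(1)] by (simp add: L_def)
    qed (use t p alpha_near[of t p0 p] assms(5)[OF p(2)] k in \<open>simp_all add: L_def distrib_left flip: cis_mult\<close>)
  qed
  moreover have "(g \<circ> alpha p0 p) 0 = (g \<circ> alpha p0 p) 1" by (simp add: alpha_ends)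
  ultimately have "of_int (circle_index (g \<circ> alpha p0 p)) = L 1 - L 0" by (rule circle_index_cis)
  also have "\<dots> = k" by (simp add: L_def near_coord_def)
  finally show ?thesis by simp
qed

lemma circle_map_lift:
  fixes S :: "'a::euclidean_space set"
  assumes g: "circle_map (pruefer_carrier S) g" and p0: "p0 \<in> S"
    and "\<And>p. p \<in> S \<Longrightarrow> p \<noteq> p0 \<Longrightarrow> circle_index (g \<circ> alpha p0 p) = 0"
  obtains F :: "'a pruefer_pt \<Rightarrow> real"
  where "continuous_on (pruefer_carrier S) F" "\<And>y. y \<in> pruefer_carrier S \<Longrightarrow> g y = cis (2 * pi * F y)"
proof -
  obtain G k where G: "\<And>p. p \<in> S \<Longrightarrow> continuous_on UNIV (G p)"
    "\<And>p z. p \<in> S \<Longrightarrow> g (chart p z) = cis (2 * pi * G p z)"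
    "\<And>p z. p \<in> S \<Longrightarrow> snd z < 0 \<Longrightarrow> G p z = G p0 (transition p0 p z)"
    "\<And>p z. p \<in> S \<Longrightarrow> snd z > 0 \<Longrightarrow> G p z = G p0 (transition p0 p z) + real_of_int (k p)"
    using chart_lifts[OF g p0] by metis
  have k: "G p z = G p0 (transition p0 p z)" if p: "p \<in> S" and z: "snd z > 0" for p z
  proof (cases "p = p0")
    case False
    then have "circle_index (g \<circ> alpha p0 p) = k p"
      using circle_index_alpha[of p S p0 G g "k p"] p p0 False G(1,2) G(3,4)[OF p] by blast
    then show ?thesis using G(4)[OF p z] assms(3)[OF p False] by simp
  qed simp
  \<comment> \<open>The reference lift serves on both sheets and the lift at \<open>q\<close> on the
    seam over \<open>q\<close>; with all integers zero, this is \<open>G p\<close> in every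
    chart.\<close>
  define F where "F y = (case y of Sheet c x \<Rightarrow> G p0 (chart_inv p0 y) | Seam q u \<Rightarrow> G q (chart_inv q y))" for y
  have F: "F (chart p z) = G p z" if p: "p \<in> S" for p z
  proof (cases "snd z = 0")
    case True
    then have "F (chart p z) = G p (chart_inv p (chart p z))" unfolding F_def by (simp add: chart_def)
    then show ?thesis by simp
  next
    case False
    have "F (chart p z) = G p0 (chart_inv p0 (chart p z))" unfolding F_def using False by (simp add: chart_def)
    also have "\<dots> = G p0 (transition p0 p z)" unfolding chart_transition[OF False, of p p0] by simp
    also have "\<dots> = G p z" using k[OF p] G(3)[OF p] False by (cases "snd z < 0") auto
    finally show ?thesis .
  qed
  show thesis
  proof
    show "continuous_on (pruefer_carrier S) F"
      using p0 by (rule continuous_on_pruefer_carrier) (simp add: comp_def F G)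
    fix y assume "y \<in> pruefer_carrier S"
    then obtain p z where "p \<in> S" "y = chart p z" using pruefer_carrier_eq[OF p0] by auto
    then show "g y = cis (2 * pi * F y)" by (simp add: F G)
  qed
qed

text \<open>The quotient of the two maps has degree 0 along every \<alpha> and thus a global real
  lift. Multiplying this lift by the homotopy parameter deforms the quotient to 1.\<close>

lemma homotopic_if_circle_index_eq:
  fixes S :: "'a::euclidean_space set"
  assumes f: "circle_map (pruefer_carrier S) f" and g: "circle_map (pruefer_carrier S) g" and p0: "p0 \<in> S"
    and eq: "\<And>p. p \<in> S \<Longrightarrow> p \<noteq> p0 \<Longrightarrow> circle_index (f \<circ> alpha p0 p) = circle_index (g \<circ> alpha p0 p)"
  shows "homotopic_with (\<lambda>_. True) (top_of_set (pruefer_carrier S)) circle f g"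
proof -
  let ?C = "pruefer_carrier S"
  define h where "h y = g y * cnj (f y)" for y
  have cf: "circle_map ?C (\<lambda>y. cnj (f y))"
    using f by (auto simp: circle_map_iff Pi_iff intro: continuous_intros)
  have h: "circle_map ?C h" unfolding h_def by (rule circle_map_mult[OF g cf])
  have fh: "f y * h y = g y" if "y \<in> ?C" for y
  proof -
    have "norm (f y) = 1" using f that by (auto simp: circle_map_iff)
    then have "f y * cnj (f y) = 1" by (simp add: complex_norm_square[symmetric])
    then show ?thesis unfolding h_def by (simp add: mult.left_commute)
  qed
  have "circle_index (h \<circ> alpha p0 p) = 0" if p: "p \<in> S" "p \<noteq> p0" for p
  proof -
    have al: "alpha p0 p \<in> loops_at ?C (Seam p0 vertical)" using p p0 by (intro alpha_loop) auto
    have "circle_index (\<lambda>t. (f \<circ> alpha p0 p) t * (h \<circ> alpha p0 p) t)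
        = circle_index (f \<circ> alpha p0 p) + circle_index (h \<circ> alpha p0 p)"
      by (rule circle_index_mult[of "f \<circ> alpha p0 p" "h \<circ> alpha p0 p"])
        (use circle_map_loop[OF f al] circle_map_loop[OF h al] in simp_all)
    moreover have "circle_index (\<lambda>t. (f \<circ> alpha p0 p) t * (h \<circ> alpha p0 p) t) = circle_index (g \<circ> alpha p0 p)"
    proof (rule circle_index_homotopic_loops, rule homotopic_loops_eq)
      fix t :: real assume "t \<in> {0..1}"
      then have "alpha p0 p t \<in> ?C" using al by (auto simp: mem_loops_at path_image_def)
      then show "(f \<circ> alpha p0 p) t * (h \<circ> alpha p0 p) t = (g \<circ> alpha p0 p) t" using fh by simp
    qed (use circle_map_loop[OF circle_map_mult[OF f h] al] in \<open>simp_all add: comp_def\<close>)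
    ultimately show ?thesis using eq[OF p] by simp
  qed
  then obtain F where F: "continuous_on ?C F" "\<And>y. y \<in> ?C \<Longrightarrow> h y = cis (2 * pi * F y)"
    using circle_map_lift[OF h p0] by metis
  let ?H = "\<lambda>(s, y). f y * cis (2 * pi * (s * F y))"
  have "continuous_on ({0..1} \<times> ?C) (\<lambda>z. F (snd z))"
    by (rule continuous_on_compose2[OF F(1)]) (auto intro: continuous_intros)
  moreover have "continuous_on ({0..1} \<times> ?C) (\<lambda>z. f (snd z))"
    using f unfolding circle_map_iff
    by (intro continuous_on_compose2[of ?C f "{0..1} \<times> ?C" snd] continuous_intros) auto
  ultimately have "continuous_on ({0..1} \<times> ?C) ?H"
    unfolding case_prod_beta cis_conv_exp by (intro continuous_intros)
  moreover have "?H \<in> {0..1} \<times> ?C \<rightarrow> sphere 0 1"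
    using f by (auto simp: circle_map_iff Pi_iff norm_mult)
  ultimately have "homotopic_with (\<lambda>_. True) (top_of_set ?C) circle (\<lambda>y. ?H (0, y)) (\<lambda>y. ?H (1, y))"
    unfolding homotopic_with_def
    by (intro exI[of _ ?H]) (simp add: subtopology_Times[symmetric] continuous_map_in_subtopology image_subset_iff_funcset flip: subtopology_Times)
  then show ?thesis
    by (rule homotopic_with_eq) (use F fh in auto)
qed

section \<open>Vanishing of path functionals\<close>

lemma homotopic_paths_in_chart:
  assumes p: "p \<in> S" and "path \<sigma>" "path_image \<sigma> \<subseteq> range (chart p)"
    and "path \<rho>" "path_image \<rho> \<subseteq> range (chart p)"
    and "pathstart \<sigma> = pathstart \<rho>" "pathfinish \<sigma> = pathfinish \<rho>"
  shows "homotopic_paths (pruefer_carrier S) \<sigma> \<rho>"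
proof -
  note [trans] = homotopic_paths_trans
  let ?C = "pruefer_carrier S"
  have inC: "range (chart p) \<subseteq> ?C" using p by auto
  have path_inv: "path (chart_inv p \<circ> \<tau>)" if "path \<tau>" "path_image \<tau> \<subseteq> range (chart p)" for \<tau>
    using that by (intro path_continuous_image continuous_on_subset[OF continuous_on_chart_inv])
  have eq: "homotopic_paths ?C \<tau> (chart p \<circ> (chart_inv p \<circ> \<tau>))"
    if \<tau>: "path \<tau>" "path_image \<tau> \<subseteq> range (chart p)" for \<tau>
  proof (rule homotopic_paths_eq)
    fix t :: real assume "t \<in> {0..1}"
    then have "\<tau> t \<in> range (chart p)" using \<tau>(2) by (auto simp: path_image_def)
    then show "\<tau> t = (chart p \<circ> (chart_inv p \<circ> \<tau>)) t" by auto
  qed (use \<tau> inC in auto)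
  have "homotopic_paths ?C \<sigma> (chart p \<circ> (chart_inv p \<circ> \<sigma>))" using eq assms by blast
  also have "homotopic_paths ?C (chart p \<circ> (chart_inv p \<circ> \<sigma>)) (chart p \<circ> (chart_inv p \<circ> \<rho>))"
    using path_inv assms inC
    by (intro homotopic_paths_through_convex[of UNIV] continuous_on_chart) (auto simp: pathstart_compose pathfinish_compose)
  also have "homotopic_paths ?C (chart p \<circ> (chart_inv p \<circ> \<rho>)) \<rho>"
    using eq assms by (blast intro: homotopic_paths_sym)
  finally show ?thesis .
qed

lemma path_chart_segment: "path (chart p \<circ> linepath z z')"
  by (intro path_continuous_image continuous_on_chart) simp

lemma path_image_chart_segment: "path_image (chart p \<circ> linepath z z') \<subseteq> range (chart p)"
  by (auto simp: path_image_compose)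

text \<open>Within the chart at \<open>p\<close> the value depends on the end points only and is
  additive, so it suffices to move from \<open>(0, -1)\<close> to an arbitrary point. Moves inside a
  sheet take place in the chart at \<open>p0\<close>, moves to the seam are covered by the ray
  hypothesis, and moves to the other sheet go through the crossing provided by \<alpha>.\<close>

lemma path_functional_zero:
  assumes "path_functional (pruefer_carrier S) \<Psi>" and p0: "p0 \<in> S"
    and zero_p0: "\<And>\<sigma>. path \<sigma> \<Longrightarrow> path_image \<sigma> \<subseteq> range (chart p0) \<Longrightarrow> \<Psi> \<sigma> = 0"
    and zero_ray: "\<And>p w. p \<in> S \<Longrightarrow> \<Psi> (chart p \<circ> linepath (0, -1) (w, 0)) = 0"
    and zero_alpha: "\<And>p. p \<in> S \<Longrightarrow> p \<noteq> p0 \<Longrightarrow> \<Psi> (alpha p0 p) = 0"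
    and \<gamma>: "path \<gamma>" "path_image \<gamma> \<subseteq> pruefer_carrier S"
  shows "\<Psi> \<gamma> = 0"
proof -
  interpret path_functional "pruefer_carrier S" \<Psi> by fact
  let ?C = "pruefer_carrier S"
  have zero_chart: "\<Psi> \<sigma> = 0"
    if p: "p \<in> S" and \<sigma>: "path \<sigma>" "path_image \<sigma> \<subseteq> range (chart p)" for p \<sigma>
  proof (cases "p = p0")
    case True
    then show ?thesis using zero_p0 \<sigma> by simp
  next
    case False
    define \<psi> where "\<psi> z z' = \<Psi> (chart p \<circ> linepath z z')" for z z'
    have inC: "path_image (chart p \<circ> linepath z z') \<subseteq> ?C" for z z'
      using path_image_chart_segment[of p z z'] p by auto
    have \<psi>_eq: "\<Psi> \<rho> = \<psi> z z'" if "path \<rho>" "path_image \<rho> \<subseteq> range (chart p)"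
      "pathstart \<rho> = chart p z" "pathfinish \<rho> = chart p z'" for \<rho> z z'
      unfolding \<psi>_def using that
      by (intro homotopic homotopic_paths_in_chart[OF p] path_chart_segment path_image_chart_segment)
        (simp_all add: pathstart_compose pathfinish_compose)
    have \<psi>_add: "\<psi> z z'' = \<psi> z z' + \<psi> z' z''" for z z' z''
    proof -
      have "\<psi> z z'' = \<Psi> ((chart p \<circ> linepath z z') +++ (chart p \<circ> linepath z' z''))"
      proof (rule \<psi>_eq[symmetric])
        show "path_image ((chart p \<circ> linepath z z') +++ (chart p \<circ> linepath z' z'')) \<subseteq> range (chart p)"
          by (intro subset_path_image_join path_image_chart_segment)
      qed (simp_all add: path_chart_segment pathstart_compose pathfinish_compose)
      also have "\<dots> = \<psi> z z' + \<psi> z' z''"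
        unfolding \<psi>_def using inC
        by (intro join path_chart_segment) (auto simp: pathstart_compose pathfinish_compose)
      finally show ?thesis .
    qed
    have \<psi>_sheet: "\<psi> z z' = 0" if "snd z * snd z' > 0" for z z'
    proof -
      have nz: "snd y \<noteq> 0" if "y \<in> closed_segment z z'" for y
      proof -
        have "snd y \<in> closed_segment (snd z) (snd z')"
          using that by (auto simp: closed_segment_def)
        then show ?thesis
          using \<open>snd z * snd z' > 0\<close> by (auto simp: closed_segment_eq_real_ivl zero_less_mult_iff split: if_splits)
      qed
      have "path_image (chart p \<circ> linepath z z') \<subseteq> range (chart p0)"
        using nz chart_transition[of _ p p0] by (auto simp: path_image_compose)
      then show ?thesis unfolding \<psi>_def by (intro zero_p0 path_chart_segment)
    qed
    \<comment> \<open>The outer quarters of \<alpha> lie in the chart at \<open>p0\<close> and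
      contribute nothing, so the middle half, which crosses the seam at \<open>p\<close>, carries
      the whole value.\<close>
    have \<psi>_cross: "\<psi> (far_coord p0 p (1/4)) (far_coord p0 p (3/4)) = 0"
    proof -
      have al: "path (alpha p0 p)" "path_image (alpha p0 p) \<subseteq> ?C"
        using alpha_loop[of p0 p S] False p p0 by (auto simp: mem_loops_at)
      have seg: "path (alpha p0 p \<circ> linepath a b)" if "a \<in> {0..1}" "b \<in> {0..1}" for a b
        using al(1) that by (rule path_segment)
      have near: "\<Psi> (alpha p0 p \<circ> linepath a b) = 0"
        if "a \<in> {0..1}" "b \<in> {0..1}" "closed_segment a b \<subseteq> {0..1} - {1/2}" for a b
      proof (rule zero_p0[OF seg])
        show "path_image (alpha p0 p \<circ> linepath a b) \<subseteq> range (chart p0)"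
        proof
          fix y assume "y \<in> path_image (alpha p0 p \<circ> linepath a b)"
          then obtain t where "t \<in> closed_segment a b" "y = alpha p0 p t"
            by (auto simp: path_image_compose)
          moreover from this have "t \<in> {0..1}" "t \<noteq> 1/2" using that(3) by blast+
          ultimately show "y \<in> range (chart p0)" using alpha_near[of t p0 p] False by simp
        qed
      qed (use that in auto)
      have "path_image (alpha p0 p \<circ> linepath (1/4) (3/4)) \<subseteq> range (chart p)"
      proof
        fix y assume "y \<in> path_image (alpha p0 p \<circ> linepath (1/4) (3/4))"
        then obtain t where "1/4 \<le> t" "t \<le> 3/4" "y = alpha p0 p t"
          by (auto simp: path_image_compose closed_segment_eq_real_ivl)
        then show "y \<in> range (chart p)" using alpha_far[of t p0 p] False by simp
      qed
      then have "\<Psi> (alpha p0 p \<circ> linepath (1/4) (3/4)) = \<psi> (far_coord p0 p (1/4)) (far_coord p0 p (3/4))"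
        using False by (intro \<psi>_eq seg) (auto simp: pathstart_compose pathfinish_compose alpha_far)
      moreover have "\<Psi> (alpha p0 p \<circ> linepath 0 1) = \<Psi> (alpha p0 p \<circ> linepath 0 (1/4)) +
          (\<Psi> (alpha p0 p \<circ> linepath (1/4) (3/4)) + \<Psi> (alpha p0 p \<circ> linepath (3/4) 1))"
        using segment_join[OF al, of 0 "1/4" 1] segment_join[OF al, of "1/4" "3/4" 1] by simp
      moreover have "\<Psi> (alpha p0 p \<circ> linepath 0 (1/4)) = 0" "\<Psi> (alpha p0 p \<circ> linepath (3/4) 1) = 0"
        by (intro near; auto simp: closed_segment_eq_real_ivl)+
      moreover have "alpha p0 p \<circ> linepath 0 1 = alpha p0 p" by (auto simp: linepath_def)
      ultimately show ?thesis using zero_alpha[OF p False] by simp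
    qed
    have d: "dist p0 p > 0" using False by simp
    have h: "snd (far_coord p0 p (1/4)) < 0" "snd (far_coord p0 p (3/4)) > 0"
      using sgn_height(1)[of "1/4", OF _ _ d] sgn_height(2)[of "3/4", OF _ _ d] by (simp_all add: far_coord_def)
    have base: "\<psi> (0, -1) z = 0" for z
    proof -
      consider "snd z < 0" | "snd z = 0" | "snd z > 0" by linarith
      then show ?thesis
      proof cases
        case 1
        then show ?thesis by (intro \<psi>_sheet) simp
      next
        case 2
        then show ?thesis using zero_ray[OF p, of "fst z"] by (cases z) (simp add: \<psi>_def)
      next
        case 3
        have "\<psi> (0, -1) (far_coord p0 p (1/4)) = 0" "\<psi> (far_coord p0 p (3/4)) z = 0"
          using h 3 by (auto intro!: \<psi>_sheet)
        then show ?thesis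
          using \<psi>_add[of "(0, -1)" z "far_coord p0 p (1/4)"] \<psi>_add[of "far_coord p0 p (1/4)" z "far_coord p0 p (3/4)"]
            \<psi>_cross by simp
      qed
    qed
    have "pathstart \<sigma> \<in> range (chart p)" "pathfinish \<sigma> \<in> range (chart p)" using \<sigma>(2) by auto
    then obtain z z' where "pathstart \<sigma> = chart p z" "pathfinish \<sigma> = chart p z'" by blast
    then have "\<Psi> \<sigma> = \<psi> z z'" using \<sigma> by (intro \<psi>_eq)
    then show ?thesis using \<psi>_add[of "(0, -1)" z' z] base by simp
  qed
  show ?thesis
  proof (rule vanishes_if_locally[OF \<gamma>])
    fix x assume "x \<in> ?C"
    then obtain p where "p \<in> S" "x \<in> range (chart p)" using pruefer_carrier_eq[OF p0] by auto
    then show "\<exists>U. open U \<and> x \<in> U \<and> (\<forall>\<sigma>. path \<sigma> \<and> path_image \<sigma> \<subseteq> U \<longrightarrow> \<Psi> \<sigma> = 0)"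
      using zero_chart open_range_chart by blast
  qed
qed

text \<open>The tails are chosen so that the extended functional vanishes on the chart at
  \<open>p0\<close> and on the segments from \<open>(0, -1)\<close> to each seam. They are straight
  in the chart at \<open>p0\<close>; a point on the seam over another \<open>p\<close> is reached
  through the point \<open>chart p (0, -1)\<close> and then along exactly such a segment.\<close>

lemma hom_pi1_pruefer_zero:
  fixes S :: "'a::euclidean_space set"
  defines "C \<equiv> pruefer_carrier S"
  assumes p0: "p0 \<in> S" and b: "b = Seam p0 vertical"
    and \<phi>: "\<phi> \<in> hom (pi1_set C b) integer_group"
    and zero: "\<And>p. p \<in> S \<Longrightarrow> p \<noteq> p0 \<Longrightarrow> \<phi> (loop_cl C b (alpha p0 p)) = 0"
    and L: "L \<in> carrier (pi1_set C b)"
  shows "\<phi> L = 0"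
proof -
  have b': "b = chart p0 (0, 0)" by (simp add: b chart_vertical)
  have bC: "b \<in> C" unfolding b' C_def using p0 by simp
  define \<tau>0 where "\<tau>0 x = chart p0 \<circ> linepath (0, 0) (chart_inv p0 x)" for x
  define \<tau> where "\<tau> x = (case x of Sheet c y \<Rightarrow> \<tau>0 x | Seam p u \<Rightarrow> if p = p0 then \<tau>0 x else
      \<tau>0 (chart p (0, -1)) +++ (chart p \<circ> linepath (0, -1) (chart_inv p x)))" for x
  have \<tau>0: "\<tau> x = \<tau>0 x" if "x \<in> range (chart p0)" for x
    using that by (auto simp: \<tau>_def chart_def)
  have \<tau>1: "\<tau> (chart p (w, 0)) = \<tau>0 (chart p (0, -1)) +++ (chart p \<circ> linepath (0, -1) (w, 0))"
    if "p \<noteq> p0" for p w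
  proof -
    have "\<tau> (chart p (w, 0)) = \<tau>0 (chart p (0, -1)) +++ (chart p \<circ> linepath (0, -1) (chart_inv p (chart p (w, 0))))"
      using that unfolding \<tau>_def by (simp add: chart_def)
    then show ?thesis by simp
  qed
  have p0C: "range (chart p0) \<subseteq> C" using p0 by (auto simp: C_def)
  have base_p0: "chart p (0, -1) \<in> range (chart p0)" for p
    using chart_transition[of "(0, -1)" p p0] by simp
  have \<tau>0_props: "path (\<tau>0 x)" "path_image (\<tau>0 x) \<subseteq> range (chart p0)" "pathstart (\<tau>0 x) = b"
    "x \<in> range (chart p0) \<Longrightarrow> pathfinish (\<tau>0 x) = x" for x
    unfolding \<tau>0_def
    by (rule path_chart_segment, rule path_image_chart_segment) (auto simp: pathstart_compose pathfinish_compose b')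
  have \<tau>_props: "path (\<tau> x) \<and> path_image (\<tau> x) \<subseteq> C \<and> pathstart (\<tau> x) = b \<and> pathfinish (\<tau> x) = x" if x: "x \<in> C" for x
  proof (cases "x \<in> range (chart p0)")
    case True
    then show ?thesis using \<tau>0_props[of x] p0C by (auto simp: \<tau>0)
  next
    case False
    then obtain p w where p: "p \<in> S" "x = chart p (w, 0)"
      using x p0 unfolding C_def by (elim pruefer_carrier_cases[where p = p0]) auto
    with False have "p \<noteq> p0" by auto
    have pC: "range (chart p) \<subseteq> C" using p by (auto simp: C_def)
    note s = path_chart_segment[of p "(0, -1)" "(w, 0)"]
    note t = \<tau>0_props[of "chart p (0, -1)"]
    have "path_image (\<tau>0 (chart p (0, -1)) +++ (chart p \<circ> linepath (0, -1) (w, 0))) \<subseteq> C"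
      using t(2) p0C path_image_chart_segment[of p "(0, -1)" "(w, 0)"] pC
      by (intro subset_path_image_join) blast+
    then show ?thesis
      unfolding p(2) \<tau>1[OF \<open>p \<noteq> p0\<close>] using s t base_p0[of p]
      by (simp add: pathstart_compose pathfinish_compose)
  qed
  have "\<tau> b = (\<lambda>_. b)"
  proof -
    have "\<tau> b = \<tau>0 b" unfolding b' by (rule \<tau>0) simp
    also have "\<dots> = (\<lambda>_. b)" unfolding \<tau>0_def b' by (simp add: linepath_def comp_def zero_prod_def[symmetric])
    finally show ?thesis .
  qed
  then have "\<exists>\<Psi>. path_functional C \<Psi> \<and> (\<forall>x\<in>C. \<Psi> (\<tau> x) = 0) \<and>
      (\<forall>\<gamma>\<in>loops_at C b. \<Psi> \<gamma> = \<phi> (loop_cl C b \<gamma>))"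
    by (rule path_functional_extension[OF \<phi> bC, of \<tau>, rotated 4]) (simp_all add: \<tau>_props, blast)
  then obtain \<Psi> where \<Psi>: "path_functional C \<Psi>" "\<And>x. x \<in> C \<Longrightarrow> \<Psi> (\<tau> x) = 0"
      "\<And>\<gamma>. \<gamma> \<in> loops_at C b \<Longrightarrow> \<Psi> \<gamma> = \<phi> (loop_cl C b \<gamma>)"
    by blast
  interpret path_functional C \<Psi> by (rule \<Psi>(1))
  obtain \<gamma> where \<gamma>: "\<gamma> \<in> loops_at C b" "L = loop_cl C b \<gamma>" using L by (auto simp: carrier_pi1_set)
  have "\<Psi> \<gamma> = 0"
  proof (rule path_functional_zero[OF \<Psi>(1)[unfolded C_def] p0])
    fix \<sigma> :: "real \<Rightarrow> 'a pruefer_pt"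
    assume \<sigma>: "path \<sigma>" "path_image \<sigma> \<subseteq> range (chart p0)"
    then have e: "pathstart \<sigma> \<in> range (chart p0)" "pathfinish \<sigma> \<in> range (chart p0)" by auto
    note ts = \<tau>0_props[of "pathstart \<sigma>"] and tf = \<tau>0_props[of "pathfinish \<sigma>"]
    \<comment> \<open>The tail to the start of \<sigma> followed by \<sigma> can be straightened
      within the chart to the tail to its end, and both tails have value 0.\<close>
    have "homotopic_paths C (\<tau>0 (pathstart \<sigma>) +++ \<sigma>) (\<tau>0 (pathfinish \<sigma>))"
      unfolding C_def using \<sigma> e ts tf
      by (intro homotopic_paths_in_chart[OF p0] subset_path_image_join) auto
    then have "\<Psi> (\<tau>0 (pathstart \<sigma>) +++ \<sigma>) = \<Psi> (\<tau>0 (pathfinish \<sigma>))" by (rule homotopic)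
    moreover have "\<Psi> (\<tau>0 (pathstart \<sigma>) +++ \<sigma>) = \<Psi> (\<tau>0 (pathstart \<sigma>)) + \<Psi> \<sigma>"
      using \<sigma> e ts p0C by (intro join) auto
    moreover have "\<Psi> (\<tau>0 (pathstart \<sigma>)) = 0" "\<Psi> (\<tau>0 (pathfinish \<sigma>)) = 0"
      using \<Psi>(2) \<tau>0 e p0C by (metis subsetD)+
    ultimately show "\<Psi> \<sigma> = 0" by simp
  next
    fix p w assume p: "p \<in> S"
    show "\<Psi> (chart p \<circ> linepath (0, -1) (w, 0)) = 0"
    proof (cases "p = p0")
      case True
      note t = \<tau>0_props[of "chart p0 (0, -1)"] and t' = \<tau>0_props[of "chart p0 (w, 0)"]
      let ?s = "chart p0 \<circ> linepath (0, -1) (w, 0)"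
      note s = path_chart_segment[of p0 "(0, -1)" "(w, 0)"] path_image_chart_segment[of p0 "(0, -1)" "(w, 0)"]
      have "homotopic_paths C (\<tau>0 (chart p0 (0, -1)) +++ ?s) (\<tau>0 (chart p0 (w, 0)))"
        unfolding C_def using s t t'
        by (intro homotopic_paths_in_chart[OF p0] subset_path_image_join)
          (auto simp: pathstart_compose pathfinish_compose)
      then have "\<Psi> (\<tau>0 (chart p0 (0, -1)) +++ ?s) = \<Psi> (\<tau>0 (chart p0 (w, 0)))" by (rule homotopic)
      moreover have "\<Psi> (\<tau>0 (chart p0 (0, -1)) +++ ?s) = \<Psi> (\<tau>0 (chart p0 (0, -1))) + \<Psi> ?s"
        using s t p0C by (intro join) (auto simp: pathstart_compose pathfinish_compose)
      moreover have "\<Psi> (\<tau>0 (chart p0 z)) = 0" for z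
        using \<Psi>(2)[of "chart p0 z"] \<tau>0[of "chart p0 z"] p0C by auto
      ultimately show ?thesis using True by simp
    next
      case False
      note s = path_chart_segment[of p "(0, -1)" "(w, 0)"] path_image_chart_segment[of p "(0, -1)" "(w, 0)"]
      note t = \<tau>0_props[of "chart p (0, -1)"]
      have pC: "range (chart p) \<subseteq> C" using p by (auto simp: C_def)
      have "\<Psi> (\<tau> (chart p (w, 0))) = \<Psi> (\<tau>0 (chart p (0, -1))) + \<Psi> (chart p \<circ> linepath (0, -1) (w, 0))"
        unfolding \<tau>1[OF False] using s t pC p0C base_p0[of p]
        by (intro join) (auto simp: pathstart_compose pathfinish_compose)
      moreover have "\<Psi> (\<tau>0 (chart p (0, -1))) = 0"
        using \<Psi>(2)[of "chart p (0, -1)"] \<tau>0[OF base_p0[of p]] pC by auto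
      moreover have "\<Psi> (\<tau> (chart p (w, 0))) = 0" using \<Psi>(2) pC by auto
      ultimately show ?thesis by simp
    qed
  next
    fix p assume p: "p \<in> S" "p \<noteq> p0"
    then have "alpha p0 p \<in> loops_at C b" unfolding C_def b using p0 by (intro alpha_loop) auto
    then show "\<Psi> (alpha p0 p) = 0" using \<Psi>(3) zero[OF p] by simp
  qed (use \<gamma> in \<open>auto simp: mem_loops_at C_def\<close>)
  then show ?thesis using \<Psi>(3)[OF \<gamma>(1)] \<gamma>(2) by simp
qed

section \<open>Baire-1 functions as nontangential limits\<close>

text \<open>The value at \<open>p\<close> lies in \<open>V\<close> iff, for some \<open>m\<close> in
  \<open>V\<close>, all late terms are within 1/3 of \<open>m\<close>. For fixed \<open>m\<close>
  and starting index this is a closed condition, and there are countably many such pairs. An integer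
  limit within 1/3 of \<open>m\<close> equals \<open>m\<close>.\<close>

lemma baire1_pointwise_limit:
  fixes k :: "'a::metric_space \<Rightarrow> int" and K :: "nat \<Rightarrow> 'a \<Rightarrow> real"
  assumes cont: "\<And>n. continuous_on T (K n)" and lim: "\<And>p. p \<in> T \<Longrightarrow> (\<lambda>n. K n p) \<longlonglongrightarrow> of_int (k p)"
  shows "baire1 (top_of_set T) (discrete_topology UNIV) k"
  unfolding baire1_def
proof (intro conjI allI impI)
  fix V :: "int set"
  define A where "A m N = {p \<in> T. \<forall>n\<ge>N. \<bar>K n p - of_int m\<bar> \<le> 1/3}" for m :: int and N :: nat
  have "closedin (top_of_set T) (A m N)" for m N
  proof -
    have "closedin (top_of_set T) (T \<inter> (\<lambda>p. \<bar>K n p - of_int m\<bar>) -` {..1/3})" for n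
      by (intro continuous_closedin_preimage continuous_intros cont)
    then have "closedin (top_of_set T) (\<Inter>n\<in>{N..}. T \<inter> (\<lambda>p. \<bar>K n p - of_int m\<bar>) -` {..1/3})"
      by (intro closedin_INT) auto
    moreover have "A m N = (\<Inter>n\<in>{N..}. T \<inter> (\<lambda>p. \<bar>K n p - of_int m\<bar>) -` {..1/3})"
      unfolding A_def by auto
    ultimately show ?thesis by simp
  qed
  then have "fsigma_in (top_of_set T) (\<Union>((\<lambda>(m, N). A m N) ` (V \<times> UNIV)))"
    by (intro fsigma_in_Union countable_image countableI_type) (auto intro: closed_imp_fsigma_in)
  moreover have "{p \<in> topspace (top_of_set T). k p \<in> V} = (\<Union>((\<lambda>(m, N). A m N) ` (V \<times> UNIV)))"
  proof -
    have "k p \<in> V \<longleftrightarrow> (\<exists>m\<in>V. \<exists>N. p \<in> A m N)" if p: "p \<in> T" for p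
    proof
      assume "k p \<in> V"
      moreover obtain N where "\<And>n. n \<ge> N \<Longrightarrow> norm (K n p - of_int (k p)) < 1/3"
        using lim[OF p] unfolding LIMSEQ_iff by (meson zero_less_divide_1_iff zero_less_numeral)
      then have "p \<in> A (k p) N" using p unfolding A_def by (auto intro: less_imp_le)
      ultimately show "\<exists>m\<in>V. \<exists>N. p \<in> A m N" by blast
    next
      assume "\<exists>m\<in>V. \<exists>N. p \<in> A m N"
      then obtain m N where m: "m \<in> V" and "\<And>n. n \<ge> N \<Longrightarrow> \<bar>K n p - of_int m\<bar> \<le> 1/3" by (auto simp: A_def)
      moreover have "(\<lambda>n. \<bar>K n p - of_int m\<bar>) \<longlonglongrightarrow> \<bar>of_int (k p) - of_int m\<bar>"
        using lim[OF p] by (intro tendsto_intros)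
      ultimately have "\<bar>of_int (k p) - of_int m\<bar> \<le> (1/3 :: real)" by (intro Lim_bounded[where M = N]) auto
      then have "k p = m" by linarith
      then show "k p \<in> V" using m by simp
    qed
    moreover have "A m N \<subseteq> T" for m N by (auto simp: A_def)
    ultimately show ?thesis by fastforce
  qed
  ultimately show "fsigma_in (top_of_set T) {p \<in> topspace (top_of_set T). k p \<in> V}" by simp
qed simp

lemma baire1_int_closed_cover:
  fixes k :: "'a::topological_space \<Rightarrow> int"
  assumes "baire1 (top_of_set T) (discrete_topology UNIV) k"
  obtains C :: "nat \<Rightarrow> 'a set" and m :: "nat \<Rightarrow> int"
  where "\<And>i. closedin (top_of_set T) (C i)" "T \<subseteq> (\<Union>i. C i)" "\<And>i p. p \<in> C i \<Longrightarrow> k p = m i"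
proof -
  have "fsigma_in (top_of_set T) {p \<in> topspace (top_of_set T). k p \<in> {j}}" for j
    using assms unfolding baire1_def openin_discrete_topology by blast
  then have "\<exists>D::nat \<Rightarrow> 'a set. (\<forall>n. closedin (top_of_set T) (D n)) \<and> \<Union> (range D) = {p \<in> T. k p = j}" for j
    unfolding fsigma_in_ascending by (simp, meson)
  then obtain D :: "int \<Rightarrow> nat \<Rightarrow> 'a set" where D: "\<And>j n. closedin (top_of_set T) (D j n)"
      "\<And>j. (\<Union>n. D j n) = {p \<in> T. k p = j}" by metis
  \<comment> \<open>Every fibre is a countable union of closed sets, and the pairs of a value and an
    index into its union are enumerated by one natural number.\<close>
  define C where "C i = (case prod_decode i of (a, b) \<Rightarrow> D (int_decode a) b)" for i
  define m where "m i = int_decode (fst (prod_decode i))" for i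
  show thesis
  proof
    show "closedin (top_of_set T) (C i)" for i by (simp add: C_def D split: prod.split)
    show "k p = m i" if "p \<in> C i" for p i
    proof -
      have "p \<in> (\<Union>n. D (m i) n)" using that by (auto simp: C_def m_def split: prod.splits)
      then show ?thesis unfolding D by simp
    qed
    show "T \<subseteq> (\<Union>i. C i)"
    proof
      fix p assume "p \<in> T"
      then have "p \<in> (\<Union>n. D (k p) n)" unfolding D by simp
      then obtain n where "p \<in> D (k p) n" by blast
      then have "p \<in> C (prod_encode (int_encode (k p), n))" by (simp add: C_def)
      then show "p \<in> (\<Union>i. C i)" by blast
    qed
  qed
qed

section \<open>Continuous functions on the half space with prescribed values in small cones\<close>

definition clamp01 :: "real \<Rightarrow> real" where
  "clamp01 x = max 0 (min 1 x)"

lemma continuous_on_clamp01 [continuous_intros]: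
  "continuous_on A f \<Longrightarrow> continuous_on A (\<lambda>x. clamp01 (f x))"
  unfolding clamp01_def by (intro continuous_intros)

text \<open>The weight of \<open>A\<close> at the point \<open>(x, h)\<close> is 1 if \<open>x\<close> has distance at most \<open>sqrt h\<close> from \<open>A\<close>, hence
  near the vertex of every cone over a point of \<open>A\<close>. The second factor, which tends to 1 for fixed
  \<open>i\<close>, makes the sum over all \<open>i\<close> below locally finite.\<close>

definition weight :: "'a::metric_space set \<Rightarrow> nat \<Rightarrow> 'a \<times> real \<Rightarrow> real" where
  "weight A i z = (if A = {} then 0
     else clamp01 (2 - infdist (fst z) A / sqrt (snd z)) * clamp01 (inverse (snd z) - of_nat i))"

text \<open>If each j were hit independently with probability \<open>weight (E j) j z\<close>, the
  coefficient of \<open>v i\<close> would be the probability that i is the first index hit. All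
  truncations \<open>M\<close> that are at least the reciprocal of the height agree.\<close>

definition first_hit_sum :: "(nat \<Rightarrow> 'a::metric_space set) \<Rightarrow> (nat \<Rightarrow> int) \<Rightarrow> nat \<Rightarrow> 'a \<times> real \<Rightarrow> real" where
  "first_hit_sum E v M z = (\<Sum>i<M. of_int (v i) * (weight (E i) i z * (\<Prod>j<i. 1 - weight (E j) j z)))"

lemma continuous_on_weight: "continuous_on {z. snd z > 0} (weight A i)"
proof (cases "A = {}")
  case False
  then show ?thesis
    unfolding weight_def[abs_def] by (auto intro!: continuous_intros)
qed (simp add: weight_def[abs_def])

lemma weight_zero: "inverse (snd z) \<le> of_nat i \<Longrightarrow> weight A i z = 0"
  by (simp add: weight_def clamp01_def)

lemma first_hit_sum_cutoff:
  assumes "inverse (snd z) \<le> of_nat M" "inverse (snd z) \<le> of_nat M'"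
  shows "first_hit_sum E v M z = first_hit_sum E v M' z"
proof -
  have "first_hit_sum E v N z = first_hit_sum E v (min M M') z" if "N \<in> {M, M'}" for N
    unfolding first_hit_sum_def
  proof (rule sum.mono_neutral_right)
    show "\<forall>i\<in>{..<N} - {..<min M M'}. real_of_int (v i) * (weight (E i) i z * (\<Prod>j<i. 1 - weight (E j) j z)) = 0"
    proof
      fix i assume "i \<in> {..<N} - {..<min M M'}"
      then have "min M M' \<le> i" by simp
      then have "inverse (snd z) \<le> of_nat i" using assms by (simp add: min_def split: if_splits)
      then show "real_of_int (v i) * (weight (E i) i z * (\<Prod>j<i. 1 - weight (E j) j z)) = 0"
        by (simp add: weight_zero)
    qed
  qed (use that in auto)
  then show ?thesis by simp
qed

lemma first_hit_sum_eq:
  assumes "N < M" "weight (E N) N z = 1" "\<And>j. j < N \<Longrightarrow> weight (E j) j z = 0"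
  shows "first_hit_sum E v M z = of_int (v N)"
proof -
  have "first_hit_sum E v M z = (\<Sum>i\<in>{N}. of_int (v i) * (weight (E i) i z * (\<Prod>j<i. 1 - weight (E j) j z)))"
    unfolding first_hit_sum_def
  proof (rule sum.mono_neutral_right)
    show "\<forall>i\<in>{..<M} - {N}. real_of_int (v i) * (weight (E i) i z * (\<Prod>j<i. 1 - weight (E j) j z)) = 0"
    proof
      fix i assume "i \<in> {..<M} - {N}"
      then consider "i < N" | "N < i" by fastforce
      then show "real_of_int (v i) * (weight (E i) i z * (\<Prod>j<i. 1 - weight (E j) j z)) = 0"
      proof cases
        case 2
        then have "(\<Prod>j<i. 1 - weight (E j) j z) = 0" using assms(2) by (intro prod_zero) auto
        then show ?thesis by simp
      qed (simp add: assms(3))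
    qed
  qed (use assms(1) in auto)
  also have "\<dots> = of_int (v N)" using assms(2,3) by simp
  finally show ?thesis .
qed

lemma eventually_nhds_less:
  fixes f :: "'b::topological_space \<Rightarrow> real"
  assumes "continuous_on UNIV f" "f a < c"
  shows "eventually (\<lambda>x. f x < c) (nhds a)"
proof -
  have "open {x. f x < c}" by (intro open_Collect_less assms(1) continuous_intros)
  then have "eventually (\<lambda>x. x \<in> {x. f x < c}) (nhds a)"
    by (rule eventually_nhds_in_open) (simp add: assms(2))
  then show ?thesis by simp
qed

lemma baire1_nontangential_extension:
  fixes k :: "'a::euclidean_space \<Rightarrow> int"
  assumes k: "baire1 (top_of_set (S - {p0})) (discrete_topology UNIV) k" and k0: "k p0 = 0"
  obtains G :: "'a \<times> real \<Rightarrow> real" where "continuous_on {z. snd z > 0} G"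
    "\<And>p w. p \<in> insert p0 S \<Longrightarrow> eventually (\<lambda>z. snd z > 0 \<longrightarrow> G (p + snd z *\<^sub>R fst z, snd z) = of_int (k p)) (nhds (w, 0))"
proof -
  obtain C :: "nat \<Rightarrow> 'a set" and m :: "nat \<Rightarrow> int" where C: "\<And>i. closedin (top_of_set (S - {p0})) (C i)" "S - {p0} \<subseteq> (\<Union>i. C i)"
      "\<And>i p. p \<in> C i \<Longrightarrow> k p = m i"
    using baire1_int_closed_cover[OF k] by metis
  \<comment> \<open>Putting \<open>{p0}\<close> in front, with value 0, forces the value 0 in the
    cones at \<open>p0\<close>, a point outside the domain of the Baire-1 hypothesis.\<close>
  define E where "E i = (case i of 0 \<Rightarrow> {p0} | Suc j \<Rightarrow> C j)" for i
  define v where "v i = (case i of 0 \<Rightarrow> 0 | Suc j \<Rightarrow> m j)" for i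
  have kE: "k p = v i" if "p \<in> E i" for p i
    using that C(3) k0 by (auto simp: E_def v_def split: nat.splits)
  have cover: "\<exists>i. p \<in> E i" if p: "p \<in> insert p0 S" for p
  proof (cases "p = p0")
    case True
    then have "p \<in> E 0" by (simp add: E_def)
    then show ?thesis ..
  next
    case False
    then obtain i where "p \<in> C i" using C(2) p by blast
    then have "p \<in> E (Suc i)" by (simp add: E_def)
    then show ?thesis ..
  qed
  \<comment> \<open>The sets \<open>E (Suc j)\<close> are closed relative to \<open>S - {p0}\<close>
    and may accumulate at \<open>p0\<close>; hence the condition that \<open>p\<close> avoids
    \<open>E 0\<close>.\<close>
  have positive: "infdist p (E i) > 0" if p: "p \<in> insert p0 S" "p \<notin> E i" "E i \<noteq> {}" "p \<notin> E 0" for p i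
  proof -
    obtain K where K: "closed K" "E i \<subseteq> K" "p \<notin> K"
    proof (cases i)
      case 0
      then show thesis using that[of "{p0}"] p(2) by (simp add: E_def)
    next
      case (Suc j)
      obtain K where "closed K" "C j = (S - {p0}) \<inter> K" using C(1) unfolding closedin_closed by blast
      moreover have "p \<in> S - {p0}" using p(1,4) by (auto simp: E_def)
      ultimately show thesis using that[of K] p(2) Suc by (simp add: E_def)
    qed
    then have "p \<notin> closure (E i)" using closure_minimal by blast
    then have "infdist p (E i) \<noteq> 0" using in_closure_iff_infdist_zero[OF p(3)] by blast
    then show ?thesis using infdist_nonneg[of p "E i"] by linarith
  qed
  define G where "G z = first_hit_sum E v (nat \<lceil>inverse (snd z)\<rceil>) z" for z
  have G: "G z = first_hit_sum E v M z" if "inverse (snd z) \<le> of_nat M" for z M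
    unfolding G_def using that by (intro first_hit_sum_cutoff real_nat_ceiling_ge)
  show thesis
  proof
    \<comment> \<open>Above height 1 / (n + 1) the function is one fixed finite sum, and these open
      regions exhaust the half space.\<close>
    have "continuous_on (\<Union>n. {z. inverse (of_nat (Suc n)) < snd z}) G"
    proof (rule continuous_on_open_UN)
      fix n :: nat
      show "open {z::'a \<times> real. inverse (of_nat (Suc n)) < snd z}"
        by (intro open_Collect_less continuous_intros)
      have pos: "0 < snd z" if "inverse (of_nat (Suc n)) < snd z" for z :: "'a \<times> real"
        using that by (rule order.strict_trans[rotated]) simp
      have "continuous_on {z. inverse (of_nat (Suc n)) < snd z} (first_hit_sum E v (Suc n))"
        unfolding first_hit_sum_def[abs_def]
        by (intro continuous_intros continuous_on_subset[OF continuous_on_weight]) (auto intro: pos)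
      moreover have "G z = first_hit_sum E v (Suc n) z" if z: "inverse (of_nat (Suc n)) < snd z" for z
      proof (rule G)
        have "inverse (snd z) \<le> inverse (inverse (real (Suc n)))" using z by (intro le_imp_inverse_le) auto
        then show "inverse (snd z) \<le> real (Suc n)" by simp
      qed
      ultimately show "continuous_on {z. inverse (of_nat (Suc n)) < snd z} G"
        by (subst continuous_on_cong[OF refl]) auto
    qed
    moreover have "{z::'a \<times> real. snd z > 0} \<subseteq> (\<Union>n. {z. inverse (of_nat (Suc n)) < snd z})"
      using reals_Archimedean by auto
    ultimately show "continuous_on {z. snd z > 0} G" by (rule continuous_on_subset)
  next
    fix p w assume p: "p \<in> insert p0 S"
    define N where "N = (LEAST i. p \<in> E i)"
    have pN: "p \<in> E N" unfolding N_def using cover[OF p] by (rule LeastI_ex)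
    have notin: "p \<notin> E j" if "j < N" for j using not_less_Least that unfolding N_def by blast
    \<comment> \<open>With h the height, the first condition gives 1 / h > N + 1, which makes the
      cutoff factor of \<open>E N\<close> equal to 1. By the second, the horizontal displacement
      from \<open>p\<close> is at most sqrt h, so the distance factor is 1 too.\<close>
    have "eventually (\<lambda>z::'a \<times> real. snd z * real (Suc N) < 1) (nhds (w, 0))"
      "eventually (\<lambda>z::'a \<times> real. sqrt (snd z) * norm (fst z) < 1) (nhds (w, 0))"
      by (rule eventually_nhds_less; auto intro!: continuous_intros)+
    \<comment> \<open>This keeps the point at distance at least 2 sqrt h from each earlier set,
      where the clamped distance factor is 0. Finitely many such conditions hold simultaneously near
      \<open>(w, 0)\<close>.\<close>
    moreover have "eventually (\<lambda>z. \<forall>j\<in>{..<N} \<inter> {j. E j \<noteq> {}}.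
        snd z * norm (fst z) + 2 * sqrt (snd z) < infdist p (E j)) (nhds (w, 0))"
    proof (intro eventually_ball_finite ballI)
      fix j assume j: "j \<in> {..<N} \<inter> {j. E j \<noteq> {}}"
      then have "0 < infdist p (E j)" using positive[OF p, of j] notin[of j] notin[of 0] by (cases j) auto
      then show "eventually (\<lambda>z. snd z * norm (fst z) + 2 * sqrt (snd z) < infdist p (E j)) (nhds (w, 0))"
        by (intro eventually_nhds_less continuous_intros) auto
    qed simp
    ultimately show "eventually (\<lambda>z. snd z > 0 \<longrightarrow> G (p + snd z *\<^sub>R fst z, snd z) = of_int (k p)) (nhds (w, 0))"
    proof eventually_elim
      case (elim z)
      show ?case
      proof
        assume h: "snd z > 0"
        let ?y = "(p + snd z *\<^sub>R fst z, snd z)"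
        have inv: "inverse (snd z) > real (Suc N)"
          using elim(1) h by (simp add: field_simps)
        have d: "dist (fst ?y) p = snd z * norm (fst z)" using h by (simp add: dist_norm)
        obtain M where M: "inverse (snd ?y) \<le> real M" using real_nat_ceiling_ge by blast
        then have "N < M" using inv by simp
        have "weight (E N) N ?y = 1"
        proof -
          have "infdist (fst ?y) (E N) \<le> sqrt (snd z) * (sqrt (snd z) * norm (fst z))"
            using infdist_le[OF pN, of "fst ?y"] d h by (simp flip: mult.assoc)
          also have "\<dots> \<le> sqrt (snd z) * 1" using elim(2) h by (intro mult_left_mono) auto
          finally have "infdist (fst ?y) (E N) / sqrt (snd z) \<le> 1" using h by simp
          then show ?thesis using pN inv by (auto simp: weight_def clamp01_def)
        qed
        moreover have "weight (E j) j ?y = 0" if j: "j < N" for j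
        proof (cases "E j = {}")
          case False
          then have "snd z * norm (fst z) + 2 * sqrt (snd z) < infdist p (E j)" using elim(3) j by blast
          moreover have "infdist p (E j) \<le> infdist (fst ?y) (E j) + dist p (fst ?y)" by (rule infdist_triangle)
          ultimately have "2 * sqrt (snd z) \<le> infdist (fst ?y) (E j)" using d by (simp add: dist_commute)
          then have "2 \<le> infdist (fst ?y) (E j) / sqrt (snd z)" using h by (simp add: field_simps)
          then show ?thesis by (simp add: weight_def clamp01_def)
        qed (simp add: weight_def)
        ultimately have "first_hit_sum E v M ?y = of_int (v N)" using \<open>N < M\<close> by (intro first_hit_sum_eq)
        then show "G ?y = of_int (k p)" using G[OF M] kE[OF pN] by simp
      qed
    qed
  qed
qed


section \<open>Maps to the circle with prescribed degrees\<close>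

text \<open>On the chart at \<open>p\<close> a lift is 0 on the first sheet and \<open>k p\<close>
  minus \<open>G\<close> on the second; it vanishes near every seam point and is therefore
  continuous. The minus sign makes the degree \<open>k p\<close> and not its negative. Where only
  seams with \<open>k p = 0\<close> are present, \<open>F\<close> itself is a continuous lift, which
  gives degree 0 for loops avoiding the other seams.\<close>

lemma circle_map_with_degrees:
  fixes S :: "'a::euclidean_space set" and k :: "'a \<Rightarrow> int"
  assumes p0: "p0 \<in> S" and k: "baire1 (top_of_set (S - {p0})) (discrete_topology UNIV) k" and k0: "k p0 = 0"
  obtains g where "circle_map (pruefer_carrier S) g"
    "\<And>p. p \<in> S \<Longrightarrow> p \<noteq> p0 \<Longrightarrow> circle_index (g \<circ> alpha p0 p) = k p"
    "\<And>\<gamma> b. \<gamma> \<in> loops_at (pruefer_carrier {p \<in> S. k p = 0}) b \<Longrightarrow> circle_index (g \<circ> \<gamma>) = 0"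
proof -
  obtain G :: "'a \<times> real \<Rightarrow> real" where G: "continuous_on {z. snd z > 0} G"
    "\<And>p w. p \<in> insert p0 S \<Longrightarrow> eventually (\<lambda>z. snd z > 0 \<longrightarrow> G (p + snd z *\<^sub>R fst z, snd z) = of_int (k p)) (nhds (w, 0))"
    by (rule baire1_nontangential_extension[OF k k0], rule that)
  define F :: "'a pruefer_pt \<Rightarrow> real" where "F y = (case y of Sheet c x \<Rightarrow> if c then - G x else 0 | Seam q u \<Rightarrow> 0)" for y
  define g where "g y = cis (2 * pi * F y)" for y
  define H where "H p z = (if snd z > 0 then of_int (k p) - G (p + snd z *\<^sub>R fst z, snd z) else 0)" for p z
  have F_chart: "F (chart p z) = (if snd z > 0 then H p z - of_int (k p) else H p z)" for p z
    by (simp add: F_def H_def chart_def)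
  have H: "continuous_on UNIV (H p)" if p: "p \<in> S" for p
  proof (rule continuous_at_imp_continuous_on, rule ballI)
    fix z :: "'a \<times> real"
    consider "snd z > 0" | "snd z < 0" | "snd z = 0" by linarith
    then show "isCont (H p) z"
    proof cases
      case 1
      have "continuous_on {z. snd z > 0} (\<lambda>z. of_int (k p) - G (p + snd z *\<^sub>R fst z, snd z))"
        by (intro continuous_intros continuous_on_compose2[OF G(1)]) auto
      then have "continuous_on {z. snd z > 0} (H p)" by (rule continuous_on_eq) (simp add: H_def)
      moreover have "open {z::'a \<times> real. snd z > 0}" by (intro open_Collect_less continuous_intros)
      ultimately show ?thesis using 1 by (cases z) (simp add: continuous_on_eq_continuous_at)
    next
      case 2
      have "continuous_on {z. snd z < 0} (H p)" by (rule continuous_on_eq[of _ "\<lambda>_. 0"]) (auto simp: H_def)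
      moreover have "open {z::'a \<times> real. snd z < 0}" by (intro open_Collect_less continuous_intros)
      ultimately show ?thesis using 2 by (cases z) (simp add: continuous_on_eq_continuous_at)
    next
      case 3
      have "eventually (\<lambda>y. H p y = 0) (nhds z)"
        using G(2)[of p "fst z"] p 3 by (cases z) (auto simp: H_def elim!: eventually_mono)
      then have "isCont (H p) z \<longleftrightarrow> isCont (\<lambda>_. 0 :: real) z" by (rule isCont_cong)
      then show ?thesis by simp
    qed
  qed
  have g_chart: "g (chart p z) = cis (2 * pi * H p z)" for p z
  proof -
    have "cis (2 * pi * of_int (k p)) = 1" by (simp add: cis_multiple_2pi)
    then show ?thesis by (simp add: g_def F_chart right_diff_distrib flip: cis_divide)
  qed
  show thesis
  proof
    show "circle_map (pruefer_carrier S) g"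
      unfolding circle_map_iff
    proof
      show "continuous_on (pruefer_carrier S) g"
      proof (rule continuous_on_pruefer_carrier[OF p0])
        fix q assume "q \<in> S"
        then show "continuous_on UNIV (g \<circ> chart q)"
          unfolding comp_def g_chart cis_conv_exp by (intro continuous_intros H)
      qed
    qed (simp add: g_def)
  next
    fix p assume p: "p \<in> S" "p \<noteq> p0"
    show "circle_index (g \<circ> alpha p0 p) = k p"
    proof (rule circle_index_alpha[OF p(1) p0 p(2) H g_chart])
      fix z :: "'a \<times> real"
      show "H p z = H p0 (transition p0 p z)" if "snd z < 0" using that by (simp add: H_def)
      show "H p z = H p0 (transition p0 p z) + real_of_int (k p)" if "snd z > 0"
        using that k0 by (simp add: H_def scaleR_add_right add.commute add.left_commute)
    qed auto
  next
    fix \<gamma> b assume \<gamma>: "\<gamma> \<in> loops_at (pruefer_carrier {p \<in> S. k p = 0}) b"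
    let ?C = "pruefer_carrier {p \<in> S. k p = 0}"
    have "continuous_on ?C F"
    proof (rule continuous_on_pruefer_carrier[of p0])
      fix q assume q: "q \<in> {p \<in> S. k p = 0}"
      then have "F \<circ> chart q = H q" by (auto simp: F_chart)
      then show "continuous_on UNIV (F \<circ> chart q)" using H q by simp
    qed (use p0 k0 in simp)
    then have "continuous_on {0..1} (\<lambda>t. F (\<gamma> t))"
      using \<gamma> by (intro continuous_on_compose2[of ?C F "{0..1}" \<gamma>]) (auto simp: mem_loops_at path_def path_image_def)
    moreover have e: "\<gamma> 0 = \<gamma> 1" using \<gamma> by (simp add: mem_loops_at pathstart_def pathfinish_def)
    ultimately have "of_int (circle_index (g \<circ> \<gamma>)) = F (\<gamma> 1) - F (\<gamma> 0)"
      by (intro circle_index_cis) (simp_all add: g_def)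
    then show "circle_index (g \<circ> \<gamma>) = 0" using e by simp
  qed
qed

lemma baire1_degrees:
  fixes S :: "'a::euclidean_space set"
  assumes g: "circle_map (pruefer_carrier S) g" and p0: "p0 \<in> S"
  shows "baire1 (top_of_set (S - {p0})) (discrete_topology UNIV) (\<lambda>p. circle_index (g \<circ> alpha p0 p))"
proof -
  obtain G and k :: "'a \<Rightarrow> int" where G: "\<And>p. p \<in> S \<Longrightarrow> continuous_on UNIV (G p)"
    "\<And>p z. p \<in> S \<Longrightarrow> g (chart p z) = cis (2 * pi * G p z)"
    "\<And>p z. p \<in> S \<Longrightarrow> snd z < 0 \<Longrightarrow> G p z = G p0 (transition p0 p z)"
    "\<And>p z. p \<in> S \<Longrightarrow> snd z > 0 \<Longrightarrow> G p z = G p0 (transition p0 p z) + real_of_int (k p)"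
    using chart_lifts[OF g p0] by metis
  define h where "h n = inverse (real (Suc n))" for n
  have h: "h n > 0" for n by (simp add: h_def)
  have h0: "h \<longlonglongrightarrow> 0" unfolding h_def[abs_def] by (rule LIMSEQ_inverse_real_of_nat)
  \<comment> \<open>The two points over \<open>p\<close> at height \<open>h n\<close>, one in each
    copy, have slope (p - p0) / h at \<open>p0\<close>, which is continuous in \<open>p\<close> for
    fixed \<open>n\<close>. In the chart at \<open>p\<close> both points tend to the vertical ray,
    so only the jump between the lifts survives in the limit.\<close>
  define K where "K n p = G p0 (transition p0 p (0, - h n)) - G p0 (transition p0 p (0, h n))" for n p
  show ?thesis
  proof (rule baire1_pointwise_limit)
    show "continuous_on (S - {p0}) (K n)" for n
      unfolding K_def using h[of n]
      by (intro continuous_intros continuous_on_compose2[OF G(1)[OF p0]]) auto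
    fix p assume p: "p \<in> S - {p0}"
    then have pS: "p \<in> S" "p \<noteq> p0" by auto
    have K: "K n p = G p (0, - h n) - G p (0, h n) + k p" for n
      using G(3)[OF pS(1), of "(0, - h n)"] G(4)[OF pS(1), of "(0, h n)"] h[of n] by (simp add: K_def)
    have lim: "(\<lambda>n. G p (f n)) \<longlonglongrightarrow> G p (0, 0)" if "f \<longlonglongrightarrow> (0, 0)" for f
      using G(1)[OF pS(1)] that by (rule continuous_on_tendsto_compose) auto
    have "(\<lambda>n. G p (0, - h n) - G p (0, h n) + k p) \<longlonglongrightarrow> G p (0, 0) - G p (0, 0) + k p"
      using h0 tendsto_minus[OF h0] by (intro tendsto_intros lim) auto
    moreover have "circle_index (g \<circ> alpha p0 p) = k p"
      using circle_index_alpha[of p S p0 G g "k p"] pS p0 G(1,2) G(3,4)[OF pS(1)] by blast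
    ultimately show "(\<lambda>n. K n p) \<longlonglongrightarrow> of_int (circle_index (g \<circ> alpha p0 p))"
      by (simp add: K)
  qed
qed

section \<open>The comparison isomorphism\<close>

lemma eval_generators_hom:
  fixes S :: "'a::euclidean_space set"
  assumes p0: "p0 \<in> S"
  shows "eval_generators S p0 \<in> hom (hom_group (pruefer_pi1 S p0) integer_group) (int_functions (S - {p0}))"
proof (rule homI)
  fix \<phi> \<psi> :: "(real \<Rightarrow> 'a pruefer_pt) set \<Rightarrow> int"
  have "loop_class (pruefer S) (Seam p0 vertical) (alpha p0 p) \<in> carrier (pruefer_pi1 S p0)" if "p \<in> S - {p0}" for p
    unfolding pruefer_eq[OF p0] carrier_pi1_set using that p0 by (auto intro: alpha_loop)
  then show "eval_generators S p0 (\<phi> \<otimes>\<^bsub>hom_group (pruefer_pi1 S p0) integer_group\<^esub> \<psi>) =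
      eval_generators S p0 \<phi> \<otimes>\<^bsub>int_functions (S - {p0})\<^esub> eval_generators S p0 \<psi>"
    by (auto simp: eval_generators_def hom_group_def restrict_def fun_eq_iff)
qed (auto simp: eval_generators_def)

text \<open>As \<int> is commutative, the difference of two homomorphisms is again one, and it
  vanishes on every \<alpha>.\<close>

lemma eval_generators_inj:
  fixes S :: "'a::euclidean_space set"
  assumes p0: "p0 \<in> S"
  shows "inj_on (eval_generators S p0) (carrier (hom_group (pruefer_pi1 S p0) integer_group))"
proof (rule inj_onI)
  let ?C = "pruefer_carrier S" and ?b = "Seam p0 vertical :: 'a pruefer_pt"
  note eq = pruefer_eq[OF p0]
  fix \<phi> \<psi> assume \<phi>: "\<phi> \<in> carrier (hom_group (pruefer_pi1 S p0) integer_group)"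
    and \<psi>: "\<psi> \<in> carrier (hom_group (pruefer_pi1 S p0) integer_group)"
    and ev: "eval_generators S p0 \<phi> = eval_generators S p0 \<psi>"
  have hom: "\<phi> \<in> hom (pi1_set ?C ?b) integer_group" "\<psi> \<in> hom (pi1_set ?C ?b) integer_group"
    and ext: "\<phi> \<in> extensional (carrier (pi1_set ?C ?b))" "\<psi> \<in> extensional (carrier (pi1_set ?C ?b))"
    using \<phi> \<psi> unfolding hom_group_def eq by simp_all
  have diff: "(\<lambda>L. \<phi> L - \<psi> L) \<in> hom (pi1_set ?C ?b) integer_group"
    using hom by (auto simp: hom_def)
  have "\<phi> (loop_cl ?C ?b (alpha p0 p)) - \<psi> (loop_cl ?C ?b (alpha p0 p)) = 0" if "p \<in> S" "p \<noteq> p0" for p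
    using fun_cong[OF ev, of p] that unfolding eval_generators_def eq by simp
  then have "\<phi> L - \<psi> L = 0" if "L \<in> carrier (pi1_set ?C ?b)" for L
    using hom_pi1_pruefer_zero[OF p0 refl diff] that by blast
  then show "\<phi> = \<psi>" by (intro extensionalityI[OF ext]) simp
qed

section \<open>Homomorphisms with arbitrary values on the loops\<close>

lemma baire1_indicator:
  fixes q :: "'a::metric_space"
  shows "baire1 (top_of_set T) (discrete_topology UNIV) (\<lambda>p. if p = q then 1 else 0 :: int)"
  unfolding baire1_def
proof (intro conjI allI impI)
  fix V :: "int set"
  have "closedin (top_of_set T) (T \<inter> {q})" by (intro closedin_closed_Int) simp
  then have 1: "fsigma_in (top_of_set T) (T \<inter> {q})" by (rule closed_imp_fsigma_in)
  \<comment> \<open>The complement of the point is open, and open sets of metrizable spaces are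
    countable unions of closed sets.\<close>
  have "metrizable_space (top_of_set T)"
    by (intro metrizable_space_subtopology metrizable_space_euclidean)
  moreover have "openin (top_of_set T) (T \<inter> - {q})" by (intro openin_open_Int) (simp add: open_Compl)
  ultimately have 2: "fsigma_in (top_of_set T) (T \<inter> - {q})" by (rule open_imp_fsigma_in)
  have 3: "fsigma_in (top_of_set T) T" using fsigma_in_topspace[of "top_of_set T"] by simp
  have "{p \<in> topspace (top_of_set T). (if p = q then 1 else 0) \<in> V} =
      (if 1 \<in> V then if 0 \<in> V then T else T \<inter> {q} else if 0 \<in> V then T \<inter> - {q} else {})"
    by auto
  then show "fsigma_in (top_of_set T) {p \<in> topspace (top_of_set T). (if p = q then 1 else 0) \<in> V}"
    using 1 2 3 by simp
qed simp

text \<open>The image of the loop is compact, so finitely many of the open charts cover it, and the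
  chart at a point meets no seam but its own.\<close>

lemma loop_avoids_most_seams:
  assumes p0: "p0 \<in> S" and \<gamma>: "\<gamma> \<in> loops_at (pruefer_carrier S) b"
  obtains A where "finite A" "A \<subseteq> S" "\<And>q. q \<notin> A \<Longrightarrow> q \<noteq> p0 \<Longrightarrow> \<gamma> \<in> loops_at (pruefer_carrier (S - {q})) b"
proof -
  have "path \<gamma>" and sub: "path_image \<gamma> \<subseteq> (\<Union>q\<in>S. range (chart q))"
    using \<gamma> by (simp_all add: mem_loops_at pruefer_carrier_eq[OF p0])
  then have "compact (path_image \<gamma>)"
    unfolding path_def path_image_def by (intro compact_continuous_image) auto
  then obtain A where A: "A \<subseteq> S" "finite A" "path_image \<gamma> \<subseteq> (\<Union>q\<in>A. range (chart q))"
    using sub open_range_chart by (elim compactE_image) auto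
  show thesis
  proof
    fix q assume q: "q \<notin> A" "q \<noteq> p0"
    then have "range (chart p) \<subseteq> pruefer_carrier (S - {q})" if "p \<in> A" for p
      using that A(1) q(1) by (auto intro!: chart_in_carrier)
    then show "\<gamma> \<in> loops_at (pruefer_carrier (S - {q})) b"
      using A(3) \<gamma> by (fastforce simp: mem_loops_at)
  qed (use A in auto)
qed

text \<open>The indicator of \<open>q\<close> yields a homomorphism \<open>d q\<close> that is dual
  to the loop \<alpha> to \<open>q\<close> and vanishes on loops avoiding the seam over
  \<open>q\<close>. Hence the combination of all \<open>d q\<close> with coefficients
  \<open>f q\<close>, although possibly infinite, is a finite sum on each class.\<close>

lemma eval_generators_surj:
  fixes S :: "'a::euclidean_space set"
  assumes p0: "p0 \<in> S" and f: "f \<in> carrier (int_functions (S - {p0}))"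
  shows "f \<in> eval_generators S p0 ` carrier (hom_group (pruefer_pi1 S p0) integer_group)"
proof -
  let ?C = "pruefer_carrier S" and ?b = "Seam p0 vertical :: 'a pruefer_pt" and ?T = "S - {p0}"
  let ?P = "pi1_set ?C ?b"
  note eq = pruefer_eq[OF p0]
  have "\<exists>g. circle_map ?C g \<and> (\<forall>p\<in>?T. circle_index (g \<circ> alpha p0 p) = (if p = q then 1 else 0)) \<and>
      (\<forall>\<gamma>\<in>loops_at (pruefer_carrier (S - {q})) ?b. circle_index (g \<circ> \<gamma>) = 0)" if q: "q \<in> ?T" for q
  proof (rule circle_map_with_degrees[OF p0 baire1_indicator[of _ q]])
    show "(if p0 = q then 1 else 0) = (0::int)" using q by auto
    fix g assume "circle_map ?C g"
      and "\<And>p. p \<in> S \<Longrightarrow> p \<noteq> p0 \<Longrightarrow> circle_index (g \<circ> alpha p0 p) = (if p = q then 1 else 0)"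
      and "\<And>\<gamma> b. \<gamma> \<in> loops_at (pruefer_carrier {p \<in> S. (if p = q then 1 else 0) = (0::int)}) b \<Longrightarrow> circle_index (g \<circ> \<gamma>) = 0"
    moreover have "{p \<in> S. (if p = q then 1 else 0) = (0::int)} = S - {q}" by auto
    ultimately show ?thesis by auto
  qed
  then obtain g where g: "\<And>q. q \<in> ?T \<Longrightarrow> circle_map ?C (g q)"
    "\<And>q p. q \<in> ?T \<Longrightarrow> p \<in> ?T \<Longrightarrow> circle_index (g q \<circ> alpha p0 p) = (if p = q then 1 else 0)"
    "\<And>q \<gamma>. q \<in> ?T \<Longrightarrow> \<gamma> \<in> loops_at (pruefer_carrier (S - {q})) ?b \<Longrightarrow> circle_index (g q \<circ> \<gamma>) = 0"
    by metis
  define d where "d q = comparison (top_of_set ?C) ?b (map_class (top_of_set ?C) (g q))" for q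
  have d: "d q (loop_cl ?C ?b \<gamma>) = circle_index (g q \<circ> \<gamma>)" if "q \<in> ?T" "\<gamma> \<in> loops_at ?C ?b" for q \<gamma>
    unfolding d_def using that g(1) by (intro comparison_loop_class) auto
  have d_hom: "d q \<in> hom ?P integer_group" if q: "q \<in> ?T" for q
    using hom_in_carrier[OF comparison_hom[of ?C ?b], of "map_class (top_of_set ?C) (g q)"] g(1)[OF q]
    by (auto simp: carrier_cohomotopy hom_group_def d_def)
  define supp where "supp L = {q \<in> ?T. d q L \<noteq> 0}" for L
  have fin: "finite (supp L)" if L: "L \<in> carrier ?P" for L
  proof -
    obtain \<gamma> where \<gamma>: "\<gamma> \<in> loops_at ?C ?b" "L = loop_cl ?C ?b \<gamma>" using L by (auto simp: carrier_pi1_set)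
    obtain A where A: "finite A" "A \<subseteq> S"
        "\<And>q. q \<notin> A \<Longrightarrow> q \<noteq> p0 \<Longrightarrow> \<gamma> \<in> loops_at (pruefer_carrier (S - {q})) ?b"
      using loop_avoids_most_seams[OF p0 \<gamma>(1)] by metis
    have "supp L \<subseteq> A" using A(3) g(3) d \<gamma> by (fastforce simp: supp_def)
    then show ?thesis using A(1) finite_subset by blast
  qed
  define \<phi> where "\<phi> = (\<lambda>L\<in>carrier ?P. \<Sum>q\<in>supp L. f q * d q L)"
  have \<phi>_sum: "\<phi> L = (\<Sum>q\<in>A. f q * d q L)" if "L \<in> carrier ?P" "finite A" "supp L \<subseteq> A" "A \<subseteq> ?T" for L A
    using that unfolding \<phi>_def by (simp, intro sum.mono_neutral_left) (auto simp: supp_def)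
  have "\<phi> \<in> hom ?P integer_group"
  proof (rule homI)
    fix x y assume x: "x \<in> carrier ?P" and y: "y \<in> carrier ?P"
    have xy: "x \<otimes>\<^bsub>?P\<^esub> y \<in> carrier ?P"
      using x y by (auto simp: carrier_pi1_set mult_pi1_set join_loops_at)
    have add: "d q (x \<otimes>\<^bsub>?P\<^esub> y) = d q x + d q y" if "q \<in> ?T" for q
      using hom_mult[OF d_hom[OF that] x y] by simp
    \<comment> \<open>Contributions may cancel in the product, so its support can be smaller than
      this union; all three sums are extended to the union before they are compared.\<close>
    let ?A = "supp x \<union> supp y"
    have A: "finite ?A" "supp x \<subseteq> ?A" "supp y \<subseteq> ?A" "supp (x \<otimes>\<^bsub>?P\<^esub> y) \<subseteq> ?A" "?A \<subseteq> ?T"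
      using fin[OF x] fin[OF y] by (auto simp: supp_def add)
    have "(\<Sum>q\<in>?A. f q * d q (x \<otimes>\<^bsub>?P\<^esub> y)) = (\<Sum>q\<in>?A. f q * d q x + f q * d q y)"
    proof (rule sum.cong)
      fix q assume "q \<in> ?A"
      then have "q \<in> ?T" using A(5) by blast
      then show "f q * d q (x \<otimes>\<^bsub>?P\<^esub> y) = f q * d q x + f q * d q y"
        by (simp only: add distrib_left)
    qed simp
    then show "\<phi> (x \<otimes>\<^bsub>?P\<^esub> y) = \<phi> x \<otimes>\<^bsub>integer_group\<^esub> \<phi> y"
      using \<phi>_sum[OF x A(1,2,5)] \<phi>_sum[OF y A(1,3,5)] \<phi>_sum[OF xy A(1,4,5)] by (simp add: sum.distrib)
  qed simp
  then have "\<phi> \<in> carrier (hom_group (pruefer_pi1 S p0) integer_group)"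
    unfolding eq hom_group_def by (simp add: \<phi>_def)
  moreover have "f = eval_generators S p0 \<phi>"
  proof
    fix p
    show "f p = eval_generators S p0 \<phi> p"
    proof (cases "p \<in> ?T")
      case True
      then have al: "alpha p0 p \<in> loops_at ?C ?b" using p0 by (intro alpha_loop) auto
      then have L: "loop_cl ?C ?b (alpha p0 p) \<in> carrier ?P" by (simp add: carrier_pi1_set)
      have dp: "d q (loop_cl ?C ?b (alpha p0 p)) = (if p = q then 1 else 0)" if "q \<in> ?T" for q
        using d[OF that al] g(2)[OF that True] by simp
      have "\<phi> (loop_cl ?C ?b (alpha p0 p)) = (\<Sum>q\<in>{p}. f q * d q (loop_cl ?C ?b (alpha p0 p)))"
        using True dp by (intro \<phi>_sum[OF L]) (auto simp: supp_def split: if_splits)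
      then show ?thesis using True dp[OF True] by (simp add: eval_generators_def eq)
    qed (use f in \<open>auto simp: eval_generators_def PiE_def extensional_def\<close>)
  qed
  ultimately show ?thesis by blast
qed

lemma eval_comparison:
  fixes S :: "'a::euclidean_space set"
  assumes p0: "p0 \<in> S" and g: "circle_map (pruefer_carrier S) g"
  shows "(eval_generators S p0 \<circ> pruefer_comp S p0) (map_class (pruefer S) g)
    = (\<lambda>p\<in>S - {p0}. circle_index (g \<circ> alpha p0 p))"
  using comparison_loop_class[OF g alpha_loop[OF _ p0, of _]] unfolding pruefer_eq[OF p0]
  by (auto simp: eval_generators_def pruefer_eq[OF p0] restrict_def fun_eq_iff)

theorem theorem1p5:
  fixes S :: "'a::euclidean_space set" and p0 :: 'a
  assumes "p0 \<in> S"
  shows "eval_generators S p0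
           \<in> iso (hom_group (pruefer_pi1 S p0) integer_group) (int_functions (S - {p0})) \<and>
         pruefer_comp S p0
           \<in> mon (cohomotopy (pruefer S)) (hom_group (pruefer_pi1 S p0) integer_group) \<and>
         eval_generators S p0 \<circ> pruefer_comp S p0
           \<in> iso (cohomotopy (pruefer S)) (baire1_int_functions (S - {p0}))"
proof (intro conjI)
  let ?C = "pruefer_carrier S" and ?T = "S - {p0}"
  let ?ec = "eval_generators S p0 \<circ> pruefer_comp S p0"
  note eq = pruefer_eq[OF assms]
  have carrier: "carrier (cohomotopy (pruefer S)) = map_class (pruefer S) ` {g. circle_map ?C g}"
    unfolding eq by (rule carrier_cohomotopy)
  have ev_hom: "eval_generators S p0 \<in> hom (hom_group (pruefer_pi1 S p0) integer_group) (int_functions ?T)"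
    using assms by (rule eval_generators_hom)
  have comp_hom: "pruefer_comp S p0 \<in> hom (cohomotopy (pruefer S)) (hom_group (pruefer_pi1 S p0) integer_group)"
    unfolding eq by (rule comparison_hom)
  have ec_hom: "?ec \<in> hom (cohomotopy (pruefer S)) (int_functions ?T)"
    using comp_hom ev_hom by (rule hom_compose)
  \<comment> \<open>Group elements are extensional functions, while degrees and the modified
    function below are defined on the whole type; being Baire-1 concerns the values on the subspace
    alone.\<close>
  have restr: "baire1 (top_of_set ?T) (discrete_topology UNIV) (\<lambda>p\<in>?T. k p) \<longleftrightarrow>
      baire1 (top_of_set ?T) (discrete_topology UNIV) k" for k :: "'a \<Rightarrow> int"
  proof -
    have "{p \<in> ?T. (\<lambda>p\<in>?T. k p) p \<in> V} = {p \<in> ?T. k p \<in> V}" for V by auto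
    then show ?thesis by (simp add: baire1_def)
  qed
  have inj: "inj_on ?ec (carrier (cohomotopy (pruefer S)))"
  proof (rule inj_onI)
    fix A B assume "A \<in> carrier (cohomotopy (pruefer S))" "B \<in> carrier (cohomotopy (pruefer S))"
      and AB: "?ec A = ?ec B"
    then obtain f g where f: "circle_map ?C f" "A = map_class (pruefer S) f"
      and g: "circle_map ?C g" "B = map_class (pruefer S) g"
      unfolding carrier by blast
    have "circle_index (f \<circ> alpha p0 p) = circle_index (g \<circ> alpha p0 p)" if "p \<in> S" "p \<noteq> p0" for p
      using fun_cong[OF AB, of p] that unfolding f(2) g(2) eval_comparison[OF assms f(1)] eval_comparison[OF assms g(1)]
      by simp
    then have "homotopic_with (\<lambda>_. True) (top_of_set ?C) circle f g"
      using homotopic_if_circle_index_eq[OF f(1) g(1) assms] by blast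
    then show "A = B" unfolding f(2) g(2) eq by (rule map_class_eqI)
  qed
  have image: "?ec ` carrier (cohomotopy (pruefer S)) = carrier (baire1_int_functions ?T)"
  proof (intro equalityI subsetI)
    fix f assume "f \<in> ?ec ` carrier (cohomotopy (pruefer S))"
    then obtain g where g: "circle_map ?C g" and f: "f = ?ec (map_class (pruefer S) g)"
      unfolding carrier by blast
    show "f \<in> carrier (baire1_int_functions ?T)"
      unfolding f eval_comparison[OF assms g] using baire1_degrees[OF g assms]
      by (simp add: baire1_int_functions_def restr)
  next
    fix f assume "f \<in> carrier (baire1_int_functions ?T)"
    then have f: "f \<in> extensional ?T" "baire1 (top_of_set ?T) (discrete_topology UNIV) f"
      by (auto simp: baire1_int_functions_def PiE_def)
    \<comment> \<open>Extensionality makes \<open>f\<close> equal to \<open>undefined\<close> at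
      \<open>p0\<close>, whereas the construction of a map with given degrees asks for the value 0
      there.\<close>
    define k where "k = f(p0 := 0)"
    have "restrict k ?T = f" using f(1) by (auto simp: k_def extensional_def restrict_def fun_eq_iff)
    then have "baire1 (top_of_set ?T) (discrete_topology UNIV) k" using f(2) restr[of k] by simp
    then obtain g where g: "circle_map ?C g"
        "\<And>p. p \<in> S \<Longrightarrow> p \<noteq> p0 \<Longrightarrow> circle_index (g \<circ> alpha p0 p) = k p"
      by (rule circle_map_with_degrees[OF assms]) (simp add: k_def, blast)
    have "?ec (map_class (pruefer S) g) = restrict k ?T"
      unfolding eval_comparison[OF assms g(1)] using g(2) by (intro restrict_ext) auto
    then show "f \<in> ?ec ` carrier (cohomotopy (pruefer S))"
      unfolding carrier using g(1) \<open>restrict k ?T = f\<close> by (intro image_eqI[OF _ imageI]) auto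
  qed
  show "eval_generators S p0 \<in> iso (hom_group (pruefer_pi1 S p0) integer_group) (int_functions ?T)"
    unfolding iso_def bij_betw_def
    using ev_hom eval_generators_inj[OF assms] eval_generators_surj[OF assms] hom_in_carrier[OF ev_hom]
    by blast
  \<comment> \<open>Injectivity of the comparison is inherited from its composite with the
    evaluation.\<close>
  show "pruefer_comp S p0 \<in> mon (cohomotopy (pruefer S)) (hom_group (pruefer_pi1 S p0) integer_group)"
    unfolding mon_def using comp_hom inj_on_imageI2[OF inj] by blast
  have "?ec \<in> hom (cohomotopy (pruefer S)) (baire1_int_functions ?T)"
  proof (rule homI)
    fix A B assume "A \<in> carrier (cohomotopy (pruefer S))" "B \<in> carrier (cohomotopy (pruefer S))"
    then show "?ec (A \<otimes>\<^bsub>cohomotopy (pruefer S)\<^esub> B) = ?ec A \<otimes>\<^bsub>baire1_int_functions ?T\<^esub> ?ec B"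
      using hom_mult[OF ec_hom] by (simp add: baire1_int_functions_def)
  qed (use image in blast)
  then show "?ec \<in> iso (cohomotopy (pruefer S)) (baire1_int_functions ?T)"
    unfolding iso_def bij_betw_def using inj image by blast
qed

end
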